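(* Let $\varphi_A(X):=\sum_{i=1}^nA_iXA_i^*$ ($n\in\mathbb N$ or $n=\infty$) be a $w^*$-continuous completely positive linear map on $B(\mathcal H)$. The following are equivalent: (i) $\varphi_A$ is similar to a $w^*$-continuous completely positive linear map $\psi$ on $B(\mathcal H)$ with $\|\psi\|\le1$; (ii) there is an invertible positive $R\in B(\mathcal H)$ with $\varphi_A(R)\le R$; (iii) there are constants $0<a\le b$ and a positive $D\in B(\mathcal H)$ with $aI\le\varphi_A^0(D)+\varphi_A^1(D)+\cdots+\varphi_A^{k-1}(D)+\varphi_A^k(I)\le bI$ for all $k\in\mathbb N$; (iv) the map $\Phi:\mathcal A_n\to B(\mathcal H)$, $\Phi(p):=p(A_1,\dots,A_n)$ on polynomials, is completely bounded. Moreover, if (iii) holds then $\|\Phi\|_{cb}\le\sqrt{b/a}$.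
   Context: Two linear maps $\varphi,\lambda$ on $B(\mathcal H)$ are similar if there is an invertible $R$ with $\varphi(RXR^* )=R\lambda(X)R^*$ for all $X$. The noncommutative disc algebra $\mathcal A_n$ is the norm-closed algebra generated by the left creation operators $S_1,\dots,S_n$ on the full Fock space $F^2(H_n)$ and the identity; for a noncommutative polynomial $p(S_1,\dots,S_n)=\sum a_\alpha S_\alpha$, $p(A_1,\dots,A_n):=\sum a_\alpha A_\alpha$. *)

theory Defs
  imports "HOL-Analysis.Analysis" "HOL-Library.Extended_Nat"
begin

class chilbert = ab_group_add +
  fixes hscale :: "complex \<Rightarrow> 'a \<Rightarrow> 'a"
    and hinner :: "'a \<Rightarrow> 'a \<Rightarrow> complex"
  assumes hscale_add_right: "hscale c (x + y) = hscale c x + hscale c y"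
    and hscale_add_left: "hscale (c + d) x = hscale c x + hscale d x"
    and hscale_hscale: "hscale c (hscale d x) = hscale (c * d) x"
    and hscale_one: "hscale 1 x = x"
    and hinner_add_left: "hinner (x + y) z = hinner x z + hinner y z"
    and hinner_scale_left: "hinner (hscale c x) y = c * hinner x y"
    and hinner_commute: "hinner y x = cnj (hinner x y)"
    and hinner_nonneg: "0 \<le> Re (hinner x x)"
    and hinner_eq_zero: "hinner x x = 0 \<longleftrightarrow> x = 0"
    and hcomplete: "(\<forall>e>0. \<exists>N. \<forall>m\<ge>N. \<forall>n\<ge>N.
                        sqrt (Re (hinner (X m - X n) (X m - X n))) < e)
                    \<Longrightarrow> \<exists>L. (\<lambda>n. sqrt (Re (hinner (X n - L) (X n - L)))) \<longlonglongrightarrow> 0"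

definition hnorm :: "'a::chilbert \<Rightarrow> real" where
  "hnorm x = sqrt (Re (hinner x x))"

definition bop :: "('a::chilbert \<Rightarrow> 'a) \<Rightarrow> bool" where
  "bop T \<longleftrightarrow> (\<forall>x y. T (x + y) = T x + T y) \<and> (\<forall>c x. T (hscale c x) = hscale c (T x))
      \<and> (\<exists>K. \<forall>x. hnorm (T x) \<le> K * hnorm x)"

definition adj :: "('a::chilbert \<Rightarrow> 'a) \<Rightarrow> ('a \<Rightarrow> 'a)" where
  "adj T = (SOME S. bop S \<and> (\<forall>x y. hinner (T x) y = hinner x (S y)))"

definition opnorm :: "('a::chilbert \<Rightarrow> 'a) \<Rightarrow> real" where
  "opnorm T = Sup ((\<lambda>x. hnorm (T x)) ` {x. hnorm x \<le> 1})"

definition opid :: "'a::chilbert \<Rightarrow> 'a" where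
  "opid = (\<lambda>x. x)"

definition opscal :: "real \<Rightarrow> 'a::chilbert \<Rightarrow> 'a" where
  "opscal a = (\<lambda>x. hscale (complex_of_real a) x)"

definition opos :: "('a::chilbert \<Rightarrow> 'a) \<Rightarrow> bool" where
  "opos T \<longleftrightarrow> bop T \<and> (\<forall>x. Im (hinner (T x) x) = 0 \<and> 0 \<le> Re (hinner (T x) x))"

definition ople :: "('a::chilbert \<Rightarrow> 'a) \<Rightarrow> ('a \<Rightarrow> 'a) \<Rightarrow> bool" where
  "ople S T \<longleftrightarrow> bop S \<and> bop T \<and> opos (\<lambda>x. T x - S x)"

definition oinvertible :: "('a::chilbert \<Rightarrow> 'a) \<Rightarrow> bool" where
  "oinvertible R \<longleftrightarrow> bop R \<and> (\<exists>S. bop S \<and> R \<circ> S = id \<and> S \<circ> R = id)"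

definition lin_map :: "(('a::chilbert \<Rightarrow> 'a) \<Rightarrow> ('a \<Rightarrow> 'a)) \<Rightarrow> bool" where
  "lin_map \<psi> \<longleftrightarrow> (\<forall>X. bop X \<longrightarrow> bop (\<psi> X))
     \<and> (\<forall>X Y. bop X \<longrightarrow> bop Y \<longrightarrow> \<psi> (\<lambda>x. X x + Y x) = (\<lambda>x. \<psi> X x + \<psi> Y x))
     \<and> (\<forall>c X. bop X \<longrightarrow> \<psi> (\<lambda>x. hscale c (X x)) = (\<lambda>x. hscale c (\<psi> X x)))"

definition blockpos :: "nat \<Rightarrow> (nat \<Rightarrow> nat \<Rightarrow> ('a::chilbert \<Rightarrow> 'a)) \<Rightarrow> bool" where
  "blockpos k X \<longleftrightarrow> (\<forall>h :: nat \<Rightarrow> 'a.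
      Im (\<Sum>i<k. \<Sum>j<k. hinner (X i j (h j)) (h i)) = 0
    \<and> 0 \<le> Re (\<Sum>i<k. \<Sum>j<k. hinner (X i j (h j)) (h i)))"

definition cp_map :: "(('a::chilbert \<Rightarrow> 'a) \<Rightarrow> ('a \<Rightarrow> 'a)) \<Rightarrow> bool" where
  "cp_map \<psi> \<longleftrightarrow> lin_map \<psi> \<and>
     (\<forall>k X. (\<forall>i<k. \<forall>j<k. bop (X i j)) \<longrightarrow> blockpos k X \<longrightarrow> blockpos k (\<lambda>i j. \<psi> (X i j)))"

text \<open>The w*- (ultraweak, sigma-weak) topology on B(H) is the initial topology of the
  functionals \<open>X \<mapsto> \<Sum>k \<langle>X x_k, y_k\<rangle>\<close> with square-summable sequences \<open>x, y\<close>.\<close>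
definition l2seq :: "(nat \<Rightarrow> 'a::chilbert) \<Rightarrow> bool" where
  "l2seq x \<longleftrightarrow> summable (\<lambda>k. (hnorm (x k))\<^sup>2)"

definition uw :: "(nat \<Rightarrow> 'a::chilbert) \<Rightarrow> (nat \<Rightarrow> 'a) \<Rightarrow> ('a \<Rightarrow> 'a) \<Rightarrow> complex" where
  "uw x y X = (\<Sum>k. hinner (X (x k)) (y k))"

definition wstar_cont :: "(('a::chilbert \<Rightarrow> 'a) \<Rightarrow> ('a \<Rightarrow> 'a)) \<Rightarrow> bool" where
  "wstar_cont \<psi> \<longleftrightarrow> (\<forall>X0 x y e. bop X0 \<and> l2seq x \<and> l2seq y \<and> e > 0 \<longrightarrow>
     (\<exists>F d. finite F \<and> d > 0 \<and> (\<forall>(u, v)\<in>F. l2seq u \<and> l2seq v) \<and>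
        (\<forall>X. bop X \<and> (\<forall>(u, v)\<in>F. cmod (uw u v X - uw u v X0) < d)
             \<longrightarrow> cmod (uw x y (\<psi> X) - uw x y (\<psi> X0)) < e)))"

definition similar :: "(('a::chilbert \<Rightarrow> 'a) \<Rightarrow> ('a \<Rightarrow> 'a)) \<Rightarrow> (('a \<Rightarrow> 'a) \<Rightarrow> ('a \<Rightarrow> 'a)) \<Rightarrow> bool" where
  "similar f g \<longleftrightarrow> (\<exists>R. oinvertible R \<and>
      (\<forall>X. bop X \<longrightarrow> f (R \<circ> X \<circ> adj R) = R \<circ> g X \<circ> adj R))"

definition phiA :: "(nat \<Rightarrow> ('a::chilbert \<Rightarrow> 'a)) \<Rightarrow> nat set \<Rightarrow> ('a \<Rightarrow> 'a) \<Rightarrow> ('a \<Rightarrow> 'a)" where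
  "phiA A I X = (THE T. bop T \<and>
      (\<forall>x y. ((\<lambda>i. hinner (A i (X (adj (A i) x))) y) has_sum hinner (T x) y) I))"

definition ncpoly :: "nat set \<Rightarrow> (nat list \<Rightarrow> complex) \<Rightarrow> bool" where
  "ncpoly I p \<longleftrightarrow> finite {\<alpha>. p \<alpha> \<noteq> 0} \<and> (\<forall>\<alpha>. p \<alpha> \<noteq> 0 \<longrightarrow> set \<alpha> \<subseteq> I)"

text \<open>Full Fock space \<open>F^2(H_n)\<close> = \<open>\<ell>^2\<close> of the free monoid on the letters I.\<close>
definition fock :: "nat set \<Rightarrow> (nat list \<Rightarrow> complex) \<Rightarrow> bool" where
  "fock I \<xi> \<longleftrightarrow> (\<forall>w. \<xi> w \<noteq> 0 \<longrightarrow> set w \<subseteq> I) \<and> (\<lambda>w. (cmod (\<xi> w))\<^sup>2) summable_on UNIV"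

definition fnorm :: "(nat list \<Rightarrow> complex) \<Rightarrow> real" where
  "fnorm \<xi> = sqrt (infsum (\<lambda>w. (cmod (\<xi> w))\<^sup>2) UNIV)"

text \<open>\<open>p(S_1,\<dots>,S_n)\<close> applied to a Fock vector, with \<open>S_\<alpha> e_\<beta> = e_{\<alpha>\<beta>}\<close>.\<close>
definition polyS :: "(nat list \<Rightarrow> complex) \<Rightarrow> (nat list \<Rightarrow> complex) \<Rightarrow> (nat list \<Rightarrow> complex)" where
  "polyS p \<xi> = (\<lambda>w. \<Sum>m\<le>length w. p (take m w) * \<xi> (drop m w))"

definition wordop :: "(nat \<Rightarrow> ('a \<Rightarrow> 'a)) \<Rightarrow> nat list \<Rightarrow> ('a \<Rightarrow> 'a)" where
  "wordop A \<alpha> = foldr (\<lambda>i f. A i \<circ> f) \<alpha> id"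

definition polyA :: "(nat \<Rightarrow> ('a::chilbert \<Rightarrow> 'a)) \<Rightarrow> (nat list \<Rightarrow> complex) \<Rightarrow> ('a \<Rightarrow> 'a)" where
  "polyA A p = (\<lambda>x. \<Sum>\<alpha>\<in>{\<alpha>. p \<alpha> \<noteq> 0}. hscale (p \<alpha>) (wordop A \<alpha> x))"

definition matnormS :: "nat set \<Rightarrow> nat \<Rightarrow> (nat \<Rightarrow> nat \<Rightarrow> (nat list \<Rightarrow> complex)) \<Rightarrow> real" where
  "matnormS I m P = Sup {sqrt (\<Sum>i<m. (fnorm (\<lambda>w. \<Sum>j<m. polyS (P i j) (\<xi> j) w))\<^sup>2) | \<xi>.
       (\<forall>j<m. fock I (\<xi> j)) \<and> (\<Sum>j<m. (fnorm (\<xi> j))\<^sup>2) \<le> 1}"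

definition matnormA :: "(nat \<Rightarrow> ('a::chilbert \<Rightarrow> 'a)) \<Rightarrow> nat \<Rightarrow> (nat \<Rightarrow> nat \<Rightarrow> (nat list \<Rightarrow> complex)) \<Rightarrow> real" where
  "matnormA A m P = Sup {sqrt (\<Sum>i<m. (hnorm (\<Sum>j<m. polyA A (P i j) (h j)))\<^sup>2) | h.
       (\<Sum>j<m. (hnorm (h j))\<^sup>2) \<le> 1}"

definition cb_bound :: "(nat \<Rightarrow> ('a::chilbert \<Rightarrow> 'a)) \<Rightarrow> nat set \<Rightarrow> real \<Rightarrow> bool" where
  "cb_bound A I C \<longleftrightarrow> (\<forall>m P. (\<forall>i<m. \<forall>j<m. ncpoly I (P i j)) \<longrightarrow> matnormA A m P \<le> C * matnormS I m P)"

definition completely_bounded :: "(nat \<Rightarrow> ('a::chilbert \<Rightarrow> 'a)) \<Rightarrow> nat set \<Rightarrow> bool" where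
  "completely_bounded A I \<longleftrightarrow> (\<exists>C. cb_bound A I C)"

definition cond_iii :: "(nat \<Rightarrow> ('a::chilbert \<Rightarrow> 'a)) \<Rightarrow> nat set \<Rightarrow> real \<Rightarrow> real \<Rightarrow> ('a \<Rightarrow> 'a) \<Rightarrow> bool" where
  "cond_iii A I a b D \<longleftrightarrow> 0 < a \<and> a \<le> b \<and> opos D \<and>
     (\<forall>k::nat. k \<ge> 1 \<longrightarrow>
        ople (opscal a) (\<lambda>x. (\<Sum>j<k. (phiA A I ^^ j) D x) + (phiA A I ^^ k) opid x) \<and>
        ople (\<lambda>x. (\<Sum>j<k. (phiA A I ^^ j) D x) + (phiA A I ^^ k) opid x) (opscal b))"

end

theory Submission
  imports Defs
begin

text \<open>Everything is compared with an invertible positive \<open>R\<close> such that \<open>\<phi> R \<le> R\<close>. Conjugation by the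
  square root of \<open>R\<close> turns \<open>\<phi>\<close> into a contractive map and back, and the Cesaro means of the sums in (iii)
  have such an \<open>R\<close> with \<open>a \<le> R \<le> b\<close> as a weak cluster point.

  If even \<open>\<phi> R \<le> q R\<close> with \<open>q < 1\<close>, then the Poisson kernel of the defect \<open>R - \<phi> R\<close> embeds \<open>H\<close>, with the
  norm given by \<open>R\<close>, isometrically into the Fock space with coefficients in \<open>H\<close> and intertwines \<open>A\<^sub>i\<^sup>*\<close> with
  \<open>S\<^sub>i\<^sup>*\<close>. Scaling \<open>A\<close> by \<open>r < 1\<close> and letting \<open>r\<close> tend to \<open>1\<close> gives von Neumann's inequality with the
  constant \<open>sqrt (b / a)\<close>.

  Conversely let \<open>\<Phi>\<close> be completely bounded by \<open>C\<close>. By compactness it suffices to find, for finitely many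
  vectors, a form between \<open>1\<close> and \<open>C\<^sup>2\<close> that the row does not increase. By Farkas' lemma an obstruction consists
  of finite families such that \<open>h, s\<close> and \<open>A\<^sup>*h, p\<close> have the same frame operator. Douglas' factorization then
  provides a finite-dimensional contractive system with the stationary state \<open>h\<close>. Its iterates are matrices of
  polynomials whose norms at the creation operators are controlled, and the resulting bounds at \<open>A\<close> force
  \<open>\<Sum>\<parallel>s\<parallel>\<^sup>2 \<le> C\<^sup>2 \<Sum>\<parallel>p\<parallel>\<^sup>2\<close>, which excludes the obstruction.\<close>

section \<open>Hermitian forms on a Hilbert space\<close>

text \<open>Weak limits are taken of Hermitian forms and tested on finite sections of the row. Such
  sections are finite sums of values of a form, so they pass to pointwise limits at once; for a
  positive form they increase to \<open>\<phi>\<close>, which recovers the full inequality at the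
  end. Averaging in (iii) works because the sums satisfy
  \<open>T (Suc k) = D + \<phi> (T k)\<close>: \<open>\<phi>\<close> moves a mean only by boundary
  terms of size \<open>(b - a) / n\<close>, while the means keep the bounds \<open>a\<close> and
  \<open>b\<close>. Hence the constant \<open>sqrt (b / a)\<close> arises without loss. For
  \<open>q = 1\<close> a part of \<open>R\<close> may survive all powers of \<open>\<phi>\<close>,
  and the kernel is then no isometry; this is why the row is shrunk first. In the converse the bound
  for finite sets of vectors must be uniform, otherwise compactness yields nothing. The obstruction
  gives no control over the state \<open>h\<close>, only over \<open>s\<close> and \<open>p\<close>.
  The way out is a difference in growth: at the creation operators the state after \<open>N\<close>
  steps has norm at most \<open>sqrt N\<close>, the accumulated output at most \<open>N\<close>.
  Dividing by \<open>N\<close> removes \<open>h\<close> and leaves the constant \<open>C\<close>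
  alone.\<close>

lemma hscale_zero_left [simp]: "hscale 0 x = (0::'a::chilbert)"
  using hscale_add_left[of 0 0 x] by simp

lemma hscale_zero_right [simp]: "hscale c 0 = (0::'a::chilbert)"
  using hscale_add_right[of c 0 0] by simp

lemma hscale_minus_left: "hscale (- c) x = - hscale c (x::'a::chilbert)"
  using hscale_add_left[of c "- c" x] by (simp add: eq_neg_iff_add_eq_0 add.commute)

lemma hscale_minus_right: "hscale c (- x) = - hscale c (x::'a::chilbert)"
  using hscale_add_right[of c x "- x"] by (simp add: eq_neg_iff_add_eq_0 add.commute)

lemma hscale_diff_right: "hscale c (x - y) = hscale c x - hscale c (y::'a::chilbert)"
  using hscale_add_right[of c x "- y"] by (simp add: hscale_minus_right)

lemma hscale_diff_left: "hscale (c - d) x = hscale c x - hscale d (x::'a::chilbert)"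
  using hscale_add_left[of c "- d" x] by (simp add: hscale_minus_left)

lemma hscale_sum_right: "hscale c (\<Sum>i\<in>A. f i) = (\<Sum>i\<in>A. hscale c (f i :: 'a::chilbert))"
  by (induction A rule: infinite_finite_induct) (auto simp: hscale_add_right)

lemma hscale_sum_left: "hscale (\<Sum>i\<in>A. f i) x = (\<Sum>i\<in>A. hscale (f i) (x :: 'a::chilbert))"
  by (induction A rule: infinite_finite_induct) (auto simp: hscale_add_left)

lemma hinner_add_right: "hinner x (y + z) = hinner x y + hinner x (z::'a::chilbert)"
  by (metis complex_cnj_add hinner_add_left hinner_commute)

lemma hinner_scale_right: "hinner x (hscale c y) = cnj c * hinner x (y::'a::chilbert)"
  by (metis complex_cnj_mult hinner_scale_left hinner_commute)

lemma hinner_zero_left [simp]: "hinner 0 (x::'a::chilbert) = 0"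
  using hinner_add_left[of 0 0 x] by simp

lemma hinner_zero_right [simp]: "hinner (x::'a::chilbert) 0 = 0"
  using hinner_add_right[of x 0 0] by simp

lemma hinner_minus_left: "hinner (- x) y = - hinner x (y::'a::chilbert)"
  using hinner_add_left[of x "- x" y] by (simp add: eq_neg_iff_add_eq_0 add.commute)

lemma hinner_minus_right: "hinner x (- y) = - hinner x (y::'a::chilbert)"
  using hinner_add_right[of x y "- y"] by (simp add: eq_neg_iff_add_eq_0 add.commute)

lemma hinner_diff_left: "hinner (x - y) z = hinner x z - hinner y (z::'a::chilbert)"
  using hinner_add_left[of x "- y" z] by (simp add: hinner_minus_left)

lemma hinner_diff_right: "hinner x (y - z) = hinner x y - hinner x (z::'a::chilbert)"
  using hinner_add_right[of x y "- z"] by (simp add: hinner_minus_right)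

lemma hinner_sum_left: "hinner (\<Sum>i\<in>A. f i) x = (\<Sum>i\<in>A. hinner (f i) (x :: 'a::chilbert))"
  by (induction A rule: infinite_finite_induct) (auto simp: hinner_add_left)

lemma hinner_sum_right: "hinner x (\<Sum>i\<in>A. f i) = (\<Sum>i\<in>A. hinner (x :: 'a::chilbert) (f i))"
  by (induction A rule: infinite_finite_induct) (auto simp: hinner_add_right)

lemma hinner_self: "hinner x x = complex_of_real ((hnorm (x::'a::chilbert))\<^sup>2)"
proof -
  have "Im (hinner x x) = 0"
    using arg_cong[OF hinner_commute[of x x], of Im] by simp
  then show ?thesis
    by (simp add: hnorm_def complex_eq_iff hinner_nonneg)
qed

lemma hnorm_nonneg [simp]: "0 \<le> hnorm (x::'a::chilbert)"
  by (simp add: hnorm_def hinner_nonneg)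

lemma hnorm_sq: "(hnorm (x::'a::chilbert))\<^sup>2 = Re (hinner x x)"
  by (simp add: hinner_self)

lemma hnorm_eq_zero [simp]: "hnorm x = 0 \<longleftrightarrow> (x::'a::chilbert) = 0"
  using hinner_eq_zero[of x] by (simp add: hinner_self)

lemma hnorm_zero [simp]: "hnorm (0::'a::chilbert) = 0"
  by simp

lemma hnorm_scale: "hnorm (hscale c (x::'a::chilbert)) = cmod c * hnorm x"
proof -
  have "cnj c * (c * hinner x x) = complex_of_real ((cmod c * hnorm x)\<^sup>2)"
    using complex_norm_square[of c] by (simp add: hinner_self power_mult_distrib)
  then have "(hnorm (hscale c x))\<^sup>2 = (cmod c * hnorm x)\<^sup>2"
    by (simp only: hnorm_sq[of "hscale c x"] hinner_scale_left hinner_scale_right Re_complex_of_real)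
  then show ?thesis
    by simp
qed

lemma hnorm_minus [simp]: "hnorm (- x) = hnorm (x::'a::chilbert)"
  by (simp add: hnorm_def hinner_minus_left hinner_minus_right)

lemma hnorm_minus_commute: "hnorm (x - y) = hnorm (y - (x::'a::chilbert))"
  using hnorm_minus[of "x - y"] by simp

lemma hinner_ext: "x = y" if "\<And>z. hinner x z = hinner y (z::'a::chilbert)"
proof -
  have "hinner (x - y) (x - y) = 0"
    using that[of "x - y"] by (simp add: hinner_diff_left)
  then show ?thesis
    by (simp add: hinner_eq_zero)
qed

lemma hinner_eqI: "T = S" if "\<And>x y. hinner (T x) y = hinner (S x) (y::'a::chilbert)"
  using hinner_ext that by blast

section \<open>Sesquilinear and Hermitian forms\<close>

definition sesq :: "('a::chilbert \<Rightarrow> 'a \<Rightarrow> complex) \<Rightarrow> bool" where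
  "sesq B \<longleftrightarrow> (\<forall>x y z. B (x + y) z = B x z + B y z) \<and> (\<forall>c x y. B (hscale c x) y = c * B x y)
     \<and> (\<forall>x y z. B x (y + z) = B x y + B x z) \<and> (\<forall>c x y. B x (hscale c y) = cnj c * B x y)"

definition hform :: "('a::chilbert \<Rightarrow> 'a \<Rightarrow> complex) \<Rightarrow> bool" where
  "hform B \<longleftrightarrow> (\<forall>x y z. B (x + y) z = B x z + B y z) \<and> (\<forall>c x y. B (hscale c x) y = c * B x y)
     \<and> (\<forall>x y. B y x = cnj (B x y))"

lemma hform_add: "hform B \<Longrightarrow> B (x + y) z = B x z + B y z"
  and hform_scale: "hform B \<Longrightarrow> B (hscale c x) y = c * B x y"
  and hform_commute: "hform B \<Longrightarrow> B y x = cnj (B x y)"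
  unfolding hform_def by blast+

lemma hform_add_right: assumes "hform B" shows "B x (y + z) = B x y + B x z"
  using hform_commute[OF assms, of x "y + z"] hform_commute[OF assms, of x y]
    hform_commute[OF assms, of x z] by (simp add: hform_add[OF assms])

lemma hform_scale_right: assumes "hform B" shows "B x (hscale c y) = cnj c * B x y"
  using hform_commute[OF assms, of x "hscale c y"] hform_commute[OF assms, of x y]
  by (simp add: hform_scale[OF assms])

lemma hform_sesq: "hform B \<Longrightarrow> sesq B"
  unfolding sesq_def by (simp add: hform_add hform_scale hform_add_right hform_scale_right)

lemma hform_zero: assumes "hform B" shows "B 0 x = 0" "B x 0 = 0"
  using hform_add[OF assms, of 0 0 x] hform_add_right[OF assms, of x 0 0] by simp_all

lemma hform_minus: assumes "hform B" shows "B (- x) y = - B x y" "B x (- y) = - B x y"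
  using hform_add[OF assms, of x "- x" y] hform_add_right[OF assms, of x y "- y"]
  by (simp_all add: hform_zero[OF assms] eq_neg_iff_add_eq_0 add.commute)

lemma hform_diff: assumes "hform B" shows "B (x - z) y = B x y - B z y" "B x (y - z) = B x y - B x z"
  using hform_add[OF assms, of x "- z" y] hform_add_right[OF assms, of x y "- z"]
  by (simp_all add: hform_minus[OF assms])

lemma hform_Im: "hform B \<Longrightarrow> Im (B x x) = 0"
  using arg_cong[OF hform_commute[of B x x], of Im] by simp

lemma hform_hinner: "hform hinner"
  unfolding hform_def using hinner_add_left hinner_scale_left hinner_commute by blast

lemma hform_Cauchy_Schwarz:
  assumes B: "hform B" and pos: "\<And>x. 0 \<le> Re (B x x)"
  shows "(cmod (B x y))\<^sup>2 \<le> Re (B x x) * Re (B y y)"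
proof -
  define b where "b = B x y"
  \<comment> \<open>With \<open>b = B x y\<close> built into the scalar the cross terms become real
    multiples of the squared modulus of \<open>b\<close>, and only a real parameter \<open>t\<close>
    remains.\<close>
  have key: "0 \<le> Re (B x x) - 2 * t * (cmod b)\<^sup>2 + t\<^sup>2 * (cmod b)\<^sup>2 * Re (B y y)" for t :: real
  proof -
    define c where "c = complex_of_real t * b"
    have "B (x - hscale c y) (x - hscale c y)
        = B x x - cnj c * B x y - c * cnj (B x y) + c * cnj c * B y y"
      using hform_commute[OF B, of y x]
      by (simp add: hform_diff[OF B] hform_scale[OF B] hform_scale_right[OF B] algebra_simps)
    also have "\<dots> = B x x - complex_of_real (2 * t * (cmod b)\<^sup>2) + complex_of_real (t\<^sup>2 * (cmod b)\<^sup>2) * B y y"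
    proof -
      have "cnj c * B x y = complex_of_real t * (b * cnj b)" "c * cnj (B x y) = complex_of_real t * (b * cnj b)"
        "c * cnj c = complex_of_real (t\<^sup>2) * (b * cnj b)"
        by (simp_all add: c_def b_def power2_eq_square)
      then show ?thesis
        by (simp add: power2_eq_square algebra_simps flip: complex_norm_square)
    qed
    also have "Re \<dots> = Re (B x x) - 2 * t * (cmod b)\<^sup>2 + t\<^sup>2 * (cmod b)\<^sup>2 * Re (B y y)"
      by (simp del: of_real_mult of_real_power)
    finally show ?thesis
      using pos[of "x - hscale c y"] by simp
  qed
  show ?thesis
  proof (cases "Re (B y y) = 0")
    \<comment> \<open>\<open>B\<close> is only semidefinite, so this case does not make
      \<open>y\<close> vanish. The estimate is now affine in \<open>t\<close>, which forces
      \<open>b = 0\<close>.\<close>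
    case True
    then have *: "2 * t * (cmod b)\<^sup>2 \<le> Re (B x x)" for t
      using key[of t] by simp
    have "(cmod b)\<^sup>2 = 0"
    proof (rule ccontr)
      assume "(cmod b)\<^sup>2 \<noteq> 0"
      then show False
        using *[of "(Re (B x x) + 1) / (2 * (cmod b)\<^sup>2)"] by (simp add: field_simps)
    qed
    then show ?thesis
      using True by (simp add: b_def)
  next
    case False
    then have y: "Re (B y y) > 0"
      using pos[of y] by simp
    have "0 \<le> Re (B x x) - (cmod b)\<^sup>2 / Re (B y y)"
      using key[of "1 / Re (B y y)"] y by (simp add: power2_eq_square field_simps)
    then show ?thesis
      using y by (simp add: b_def field_simps)
  qed
qed

lemma hinner_Cauchy_Schwarz: "cmod (hinner x y) \<le> hnorm x * hnorm (y::'a::chilbert)"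
proof -
  have "(cmod (hinner x y))\<^sup>2 \<le> (hnorm x * hnorm y)\<^sup>2"
    using hform_Cauchy_Schwarz[OF hform_hinner hinner_nonneg, of x y]
    by (simp add: power_mult_distrib hnorm_sq)
  then show ?thesis
    by (simp add: power_mono_iff)
qed

lemma hnorm_triangle: "hnorm (x + y) \<le> hnorm x + hnorm (y::'a::chilbert)"
proof -
  have "Re (hinner x y) \<le> hnorm x * hnorm y"
    using hinner_Cauchy_Schwarz[of x y] complex_Re_le_cmod[of "hinner x y"] by linarith
  moreover have "Re (hinner y x) = Re (hinner x y)"
    by (subst hinner_commute) simp
  ultimately have "(hnorm (x + y))\<^sup>2 \<le> (hnorm x + hnorm y)\<^sup>2"
    by (simp add: hnorm_sq hinner_add_left hinner_add_right power2_sum)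
  then show ?thesis
    by (simp add: power2_le_iff_abs_le)
qed

lemma hnorm_diff_triangle: "hnorm (x - z) \<le> hnorm (x - y) + hnorm (y - (z::'a::chilbert))"
  using hnorm_triangle[of "x - y" "y - z"] by simp

lemma hnorm_reverse_triangle: "\<bar>hnorm x - hnorm y\<bar> \<le> hnorm (x - (y::'a::chilbert))"
  using hnorm_triangle[of "x - y" y] hnorm_triangle[of "y - x" x] hnorm_minus_commute[of x y] by simp

lemma hnorm_sum: "hnorm (\<Sum>i\<in>A. f i) \<le> (\<Sum>i\<in>A. hnorm (f i :: 'a::chilbert))"
proof (induction A rule: infinite_finite_induct)
  case (insert i A)
  then show ?case
    using hnorm_triangle[of "f i" "sum f A"] by simp
qed auto

lemma hinner_bound_le:
  assumes "0 \<le> K" and "\<And>y. cmod (hinner x y) \<le> K * hnorm y" shows "hnorm (x::'a::chilbert) \<le> K"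
proof (cases "x = 0")
  case False
  then have "hnorm x > 0"
    using hnorm_nonneg[of x] hnorm_eq_zero[of x] by linarith
  moreover have "hnorm x * hnorm x \<le> K * hnorm x"
    using assms(2)[of x] by (simp add: hinner_self power2_eq_square norm_mult)
  ultimately show ?thesis
    by simp
qed (use assms in simp)

text \<open>The only place where the completeness axiom is invoked. The explicit rate matters as
  well: the gliding hump argument uses its constant.\<close>

lemma hcomplete_geometric:
  fixes X :: "nat \<Rightarrow> 'a::chilbert"
  assumes X: "\<And>n. hnorm (X (Suc n) - X n) \<le> c * q ^ n" and q: "0 \<le> q" "q < 1"
  shows "\<exists>L. \<forall>n. hnorm (X n - L) \<le> c * q ^ n / (1 - q)"
proof -
  have c: "0 \<le> c"
    using order_trans[OF hnorm_nonneg X[of 0]] by simp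
  have step: "hnorm (X (n + k) - X n) \<le> c * q ^ n * (1 - q ^ k) / (1 - q)" for n k
  proof (induction k)
    case (Suc k)
    have "hnorm (X (n + Suc k) - X n) \<le> c * q ^ (n + k) + c * q ^ n * (1 - q ^ k) / (1 - q)"
      using hnorm_diff_triangle[of "X (n + Suc k)" "X n" "X (n + k)"] X[of "n + k"] Suc by simp
    also have "\<dots> = c * q ^ n * (1 - q ^ Suc k) / (1 - q)"
      using q by (simp add: field_simps power_add)
    finally show ?case .
  qed simp
  have bound: "hnorm (X m - X n) \<le> c * q ^ n / (1 - q)" if "m \<ge> n" for m n
  proof -
    have "c * q ^ n * (1 - q ^ (m - n)) \<le> c * q ^ n * 1"
      using c q by (intro mult_left_mono) auto
    then have "c * q ^ n * (1 - q ^ (m - n)) / (1 - q) \<le> c * q ^ n / (1 - q)"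
      using q by (intro divide_right_mono) auto
    then show ?thesis
      using step[of n "m - n"] that by simp
  qed
  have lim: "(\<lambda>n. c * q ^ n / (1 - q)) \<longlonglongrightarrow> 0"
    using q by (auto intro!: tendsto_divide_zero tendsto_mult_right_zero LIMSEQ_power_zero)
  have "\<forall>e>0. \<exists>N. \<forall>m\<ge>N. \<forall>n\<ge>N. hnorm (X m - X n) < e"
  proof (intro allI impI)
    fix e :: real assume "e > 0"
    then obtain N where N: "\<And>n. n \<ge> N \<Longrightarrow> c * q ^ n / (1 - q) < e"
      using order_tendstoD(2)[OF lim] unfolding eventually_sequentially by blast
    show "\<exists>N. \<forall>m\<ge>N. \<forall>n\<ge>N. hnorm (X m - X n) < e"
    proof (intro exI[of _ N] allI impI)
      fix m n assume "N \<le> m" "N \<le> n"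
      then show "hnorm (X m - X n) < e"
        using bound[of n m] bound[of m n] N[of m] N[of n] hnorm_minus_commute[of "X m" "X n"]
        by (cases "n \<le> m") auto
    qed
  qed
  then obtain L where L: "(\<lambda>n. hnorm (X n - L)) \<longlonglongrightarrow> 0"
    using hcomplete[of X] unfolding hnorm_def by blast
  have "hnorm (X n - L) \<le> c * q ^ n / (1 - q)" for n
  proof (rule LIMSEQ_le_const)
    show "(\<lambda>m. c * q ^ n / (1 - q) + hnorm (X m - L)) \<longlonglongrightarrow> c * q ^ n / (1 - q)"
      using tendsto_add[OF tendsto_const L, of "c * q ^ n / (1 - q)"] by simp
    show "\<exists>N. \<forall>m\<ge>N. hnorm (X n - L) \<le> c * q ^ n / (1 - q) + hnorm (X m - L)"
    proof (intro exI allI impI)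
      fix m assume "n \<le> m"
      then show "hnorm (X n - L) \<le> c * q ^ n / (1 - q) + hnorm (X m - L)"
        using hnorm_diff_triangle[of "X n" L "X m"] bound[of n m] hnorm_minus_commute[of "X n" "X m"]
        by linarith
    qed
  qed
  then show ?thesis
    by blast
qed

text \<open>Riesz representation for an equivalent inner product \<open>B\<close> (for \<open>B = hinner\<close> the usual one);
  the representing vector is a multiple of the minimiser of \<open>B x x - 2 Re (f x)\<close>.\<close>

lemma riesz_coercive:
  fixes B :: "'a::chilbert \<Rightarrow> 'a \<Rightarrow> complex"
  assumes B: "hform B" and e: "0 < e" and low: "\<And>x. e * (hnorm x)\<^sup>2 \<le> Re (B x x)"
    and up: "\<And>x. Re (B x x) \<le> M * (hnorm x)\<^sup>2"
    and fadd: "\<And>x y. f (x + y) = f x + f y" and fscale: "\<And>c x. f (hscale c x) = c * f x"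
    and fb: "\<And>x. cmod (f x) \<le> K * hnorm x"
  shows "\<exists>z. \<forall>x. f x = B x z"
proof -
  have pos: "0 \<le> Re (B x x)" for x
    using low[of x] e by (smt (verit) mult_nonneg_nonneg zero_le_power2)
  define J where "J x = Re (B x x) - 2 * Re (f x)" for x
  have J_low: "- (K\<^sup>2 / e) \<le> J x" for x
  proof -
    have "0 \<le> (e * hnorm x - K)\<^sup>2"
      by simp
    then have "2 * e * K * hnorm x \<le> e * (e * (hnorm x)\<^sup>2) + K\<^sup>2"
      by (simp add: power2_eq_square algebra_simps)
    then have "2 * K * hnorm x \<le> e * (hnorm x)\<^sup>2 + K\<^sup>2 / e"
      using e by (simp add: field_simps)
    moreover have "Re (f x) \<le> K * hnorm x"
      using fb[of x] complex_Re_le_cmod[of "f x"] by linarith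
    ultimately show ?thesis
      using low[of x] by (simp add: J_def)
  qed
  define j where "j = Inf (range J)"
  have bdd: "bdd_below (range J)"
    using J_low by (auto simp: bdd_below_def)
  have j_le: "j \<le> J x" for x
    unfolding j_def using bdd by (simp add: cInf_lower)
  \<comment> \<open>The tolerance is chosen so that, by the parallelogram identity
    \<open>par\<close>, consecutive near-minimisers differ by at most
    \<open>(1 / 2) ^ n\<close>.\<close>
  have "\<exists>x. J x < j + e / 4 * (1 / 4) ^ n" for n
    using cInf_lessD[of "range J" "j + e / 4 * (1 / 4) ^ n"] e by (force simp: j_def)
  then obtain X where X: "\<And>n. J (X n) < j + e / 4 * (1 / 4) ^ n"
    by metis
  have fmid: "f (hscale (1 / 2) (x + y)) = (f x + f y) / 2" for x y
    by (simp add: fadd fscale)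
  have par: "Re (B (x - y) (x - y)) = 2 * J x + 2 * J y - 4 * J (hscale (1 / 2) (x + y))" for x y
    by (simp add: J_def fmid hform_diff[OF B] hform_add[OF B] hform_add_right[OF B]
        hform_scale[OF B] hform_scale_right[OF B] algebra_simps)
  have J_diff: "e * (hnorm (x - y))\<^sup>2 \<le> 2 * (J x - j) + 2 * (J y - j)" for x y
    using low[of "x - y"] par[of x y] j_le[of "hscale (1 / 2) (x + y)"] by simp
  have "hnorm (X (Suc n) - X n) \<le> 1 * (1 / 2) ^ n" for n
  proof -
    have "e * (hnorm (X (Suc n) - X n))\<^sup>2 \<le> 4 * (e / 4 * (1 / 4) ^ n)"
    proof -
      have "e / 4 * (1 / 4) ^ Suc n \<le> e / 4 * (1 / 4) ^ n"
        using e by (intro mult_left_mono power_decreasing) auto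
      with X[of "Suc n"] have "J (X (Suc n)) < j + e / 4 * (1 / 4) ^ n"
        by (meson add_left_mono less_le_trans)
      moreover have "a \<le> 4 * d" if "x < j + d" "y < j + d" "a \<le> 2 * (x - j) + 2 * (y - j)" for a d x y :: real
        using that by (simp add: algebra_simps)
      ultimately show ?thesis
        using J_diff[of "X (Suc n)" "X n"] X[of n] by blast
    qed
    then have "(hnorm (X (Suc n) - X n))\<^sup>2 \<le> (1 / 4) ^ n"
      using e by simp
    also have "\<dots> = ((1 / 2) ^ n :: real)\<^sup>2"
      by (simp add: power2_eq_square flip: power_mult_distrib)
    finally show ?thesis
      by (simp add: power2_le_iff_abs_le)
  qed
  from hcomplete_geometric[of X 1 "1 / 2", OF this]
  obtain z where z: "\<And>n. hnorm (X n - z) \<le> 1 * (1 / 2) ^ n / (1 - 1 / 2)"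
    by auto
  have key: "0 \<le> 2 * t * (Re (B y z) - Re (f y)) + t\<^sup>2 * Re (B y y)" for y t
  proof -
    have J_shift: "J (x + hscale (complex_of_real t) y)
        = J x + 2 * t * (Re (B y x) - Re (f y)) + t\<^sup>2 * Re (B y y)" for x t y
      using arg_cong[OF hform_commute[OF B, of x y], of Re]
      by (simp add: J_def hform_add[OF B] hform_add_right[OF B] hform_scale[OF B]
          hform_scale_right[OF B] fadd fscale power2_eq_square algebra_simps)
    have "j \<le> J z + 2 * t * (Re (B y z) - Re (f y)) + t\<^sup>2 * Re (B y y)"
      using j_le[of "z + hscale (complex_of_real t) y"] by (simp add: J_shift)
    \<comment> \<open>The limit attains the infimum because the upper bound \<open>up\<close> makes
      \<open>B\<close>, hence \<open>J\<close>, continuous along \<open>X\<close>.\<close>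
    moreover have "J z \<le> j"
    proof (rule LIMSEQ_le_const)
      have "Re (B w w) \<le> \<bar>M\<bar> * (hnorm w)\<^sup>2" for w
        using up[of w] by (meson abs_ge_self mult_right_mono order_trans zero_le_power2)
      note upM = this
      have CS: "cmod (B u w) \<le> \<bar>M\<bar> * hnorm u * hnorm w" for u w
      proof -
        have "(cmod (B u w))\<^sup>2 \<le> Re (B u u) * Re (B w w)"
          by (rule hform_Cauchy_Schwarz[OF B pos])
        also have "\<dots> \<le> (\<bar>M\<bar> * (hnorm u)\<^sup>2) * (\<bar>M\<bar> * (hnorm w)\<^sup>2)"
          by (intro mult_mono upM pos) auto
        also have "\<dots> = (\<bar>M\<bar> * hnorm u * hnorm w)\<^sup>2"
          by (simp add: power2_eq_square)
        finally show ?thesis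
          by (rule power2_le_imp_le) simp
      qed
      define d where "d n = hnorm (X n - z)" for n
      have d0: "d \<longlonglongrightarrow> 0"
      proof (rule tendsto_sandwich[OF _ _ tendsto_const])
        show "(\<lambda>n. 2 * (1 / 2 :: real) ^ n) \<longlonglongrightarrow> 0"
          by (intro tendsto_mult_right_zero LIMSEQ_power_zero) simp
      qed (use z in \<open>auto simp: d_def mult.commute\<close>)
      have "J z \<le> J (X n) + 2 * d n * (\<bar>M\<bar> * hnorm z + K)" for n
      proof -
        define y where "y = X n - z"
        have "J (X n) = J z + 2 * (Re (B y z) - Re (f y)) + Re (B y y)"
          using J_shift[of z 1 y] by (simp add: y_def hscale_one)
        moreover have "0 \<le> Re (B y y)"
          by (rule pos)
        moreover have "- (\<bar>M\<bar> * d n * hnorm z) \<le> Re (B y z)"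
          using CS[of y z] abs_Re_le_cmod[of "B y z"] by (simp add: d_def y_def abs_le_iff)
        moreover have "Re (f y) \<le> K * d n"
          using fb[of y] complex_Re_le_cmod[of "f y"] by (simp add: d_def y_def)
        ultimately show ?thesis
          by (simp add: algebra_simps)
      qed
      then have "J z \<le> j + e / 4 * (1 / 4) ^ n + 2 * d n * (\<bar>M\<bar> * hnorm z + K)" for n
        using X[of n] by (smt (verit))
      then show "\<exists>N. \<forall>n\<ge>N. J z \<le> j + e / 4 * (1 / 4) ^ n + 2 * d n * (\<bar>M\<bar> * hnorm z + K)"
        by blast
      have "(\<lambda>n. j + e / 4 * (1 / 4) ^ n + 2 * d n * (\<bar>M\<bar> * hnorm z + K))
              \<longlonglongrightarrow> j + e / 4 * 0 + 2 * 0 * (\<bar>M\<bar> * hnorm z + K)"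
        by (intro tendsto_intros d0 LIMSEQ_power_zero) simp
      then show "(\<lambda>n. j + e / 4 * (1 / 4) ^ n + 2 * d n * (\<bar>M\<bar> * hnorm z + K)) \<longlonglongrightarrow> j"
        by simp
    qed
    ultimately show ?thesis
      by simp
  qed
  have real_part: "Re (f y) = Re (B y z)" for y
  proof (rule ccontr)
    define g where "g = Re (B y z) - Re (f y)"
    \<comment> \<open>The summand 1 keeps \<open>b\<close> positive when \<open>B y y = 0\<close>;
      at \<open>t = - g / b\<close> the quadratic expression of \<open>key\<close> is negative
      unless \<open>g = 0\<close>.\<close>
    define b where "b = Re (B y y) + 1"
    assume "Re (f y) \<noteq> Re (B y z)"
    then have g: "g \<noteq> 0"
      by (simp add: g_def)
    have b: "b > 0"
      using pos[of y] by (simp add: b_def)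
    have "0 \<le> 2 * (- g / b) * g + (- g / b)\<^sup>2 * Re (B y y)"
      using key[of "- g / b" y] by (simp add: g_def)
    also have "\<dots> \<le> 2 * (- g / b) * g + (- g / b)\<^sup>2 * b"
      by (intro add_left_mono mult_left_mono) (auto simp: b_def)
    also have "\<dots> = - (g\<^sup>2 / b)"
      using b by (simp add: power2_eq_square field_simps)
    finally show False
      using g b by (simp add: field_simps not_le)
  qed
  have "f y = B y z" for y
  proof (rule complex_eqI)
    show "Re (f y) = Re (B y z)"
      by (rule real_part)
    show "Im (f y) = Im (B y z)"
      using real_part[of "hscale \<i> y"] by (simp add: fscale hform_scale[OF B])
  qed
  then show ?thesis
    by blast
qed

section \<open>Bounded operators\<close>

lemma bopI:
  assumes "\<And>x y. T (x + y) = T x + T y" "\<And>c x. T (hscale c x) = hscale c (T x)"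
    and "\<And>x. hnorm (T x) \<le> K * hnorm x"
  shows "bop T"
  using assms unfolding bop_def by blast

lemma bop_add: "bop T \<Longrightarrow> T (x + y) = T x + T y"
  and bop_scale: "bop T \<Longrightarrow> T (hscale c x) = hscale c (T x)"
  unfolding bop_def by blast+

lemma bop_zero: "bop T \<Longrightarrow> T 0 = 0"
  using bop_scale[of T 0 0] by simp

lemma bop_minus: "bop T \<Longrightarrow> T (- x) = - T x"
  using bop_scale[of T "-1" x] by (simp add: hscale_minus_left hscale_one)

lemma bop_diff: "bop T \<Longrightarrow> T (x - y) = T x - T y"
  using bop_add[of T x "- y"] by (simp add: bop_minus)

lemma bop_sum: "bop T \<Longrightarrow> T (\<Sum>i\<in>A. f i) = (\<Sum>i\<in>A. T (f i))"
  by (induction A rule: infinite_finite_induct) (auto simp: bop_add bop_zero)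

lemma bop_bound:
  assumes "bop T" obtains K where "0 \<le> K" "\<And>x. hnorm (T x) \<le> K * hnorm x"
proof -
  obtain K where K: "\<And>x. hnorm (T x) \<le> K * hnorm x"
    using assms unfolding bop_def by blast
  have "hnorm (T x) \<le> \<bar>K\<bar> * hnorm x" for x
    using K[of x] by (meson abs_ge_self hnorm_nonneg mult_right_mono order_trans)
  then show ?thesis
    using that[of "\<bar>K\<bar>"] by simp
qed

lemma bop_id: "bop (\<lambda>x. x)"
  by (rule bopI[where K=1]) simp_all

lemma bop_opid: "bop opid"
  unfolding opid_def by (rule bop_id)

lemma bop_comp: assumes "bop S" "bop T" shows "bop (\<lambda>x. S (T x))"
proof -
  obtain K L where "0 \<le> K" "\<And>x. hnorm (S x) \<le> K * hnorm x" "\<And>x. hnorm (T x) \<le> L * hnorm x"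
    using assms bop_bound by metis
  then have "hnorm (S (T x)) \<le> K * L * hnorm x" for x
    by (metis mult.assoc mult_left_mono order_trans)
  then show ?thesis
    by (intro bopI) (simp_all add: bop_add[OF assms(1)] bop_add[OF assms(2)]
        bop_scale[OF assms(1)] bop_scale[OF assms(2)])
qed

lemma bop_plus: assumes "bop S" "bop T" shows "bop (\<lambda>x. S x + T x)"
proof -
  obtain K L where "\<And>x. hnorm (S x) \<le> K * hnorm x" "\<And>x. hnorm (T x) \<le> L * hnorm x"
    using assms bop_bound by metis
  then have bound: "hnorm (S x + T x) \<le> (K + L) * hnorm x" for x
    using hnorm_triangle[of "S x" "T x"] by (smt (verit) distrib_right)
  show ?thesis
    by (rule bopI[OF _ _ bound]) (simp_all add: bop_add[OF assms(1)] bop_add[OF assms(2)]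
        bop_scale[OF assms(1)] bop_scale[OF assms(2)] hscale_add_right)
qed

lemma bop_hscale: "bop (\<lambda>x. hscale c (x::'a::chilbert))"
  by (rule bopI[where K="cmod c"]) (auto simp: hscale_add_right hscale_hscale mult.commute hnorm_scale)

lemma bop_scaled: "bop T \<Longrightarrow> bop (\<lambda>x. hscale c (T x))"
  using bop_comp[OF bop_hscale] .

lemma bop_minus_op: "bop S \<Longrightarrow> bop T \<Longrightarrow> bop (\<lambda>x. S x - T x)"
  using bop_plus[of S "\<lambda>x. hscale (-1) (T x)"] bop_scaled[of T "-1"]
  by (simp add: hscale_minus_left hscale_one)

lemma bop_zero_op: "bop (\<lambda>x. 0)"
  by (rule bopI[where K=0]) auto

lemma bop_sum_op: "(\<And>i. i \<in> A \<Longrightarrow> bop (T i)) \<Longrightarrow> bop (\<lambda>x. \<Sum>i\<in>A. T i x)"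
  by (induction A rule: infinite_finite_induct) (auto simp: bop_zero_op intro: bop_plus)

text \<open>For fixed \<open>x\<close> the functional \<open>cnj (B x y)\<close> is linear in
  \<open>y\<close>, so Riesz yields the vector \<open>T x\<close>; linearity and the bound are
  inherited from \<open>B\<close>.\<close>

lemma sesq_op:
  fixes B :: "'a::chilbert \<Rightarrow> 'a \<Rightarrow> complex"
  assumes B: "sesq B" and K: "0 \<le> K" and bound: "\<And>x y. cmod (B x y) \<le> K * hnorm x * hnorm y"
  shows "\<exists>T. bop T \<and> (\<forall>x y. hinner (T x) y = B x y)"
proof -
  have "\<exists>z. \<forall>y. cnj (B x y) = hinner y z" for x
    by (rule riesz_coercive[where e=1 and M=1 and K="K * hnorm x"])
      (use B bound[of x] in \<open>auto simp: hform_hinner hnorm_sq sesq_def\<close>)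
  then obtain T where T: "\<And>x y. cnj (B x y) = hinner y (T x)"
    by metis
  have eq: "hinner (T x) y = B x y" for x y
    using T[of x y] hinner_commute[of y "T x"] by simp
  have "bop T"
  proof (rule bopI)
    show "T (x + y) = T x + T y" for x y
      by (rule hinner_ext) (use B in \<open>simp add: eq hinner_add_left sesq_def\<close>)
    show "T (hscale c x) = hscale c (T x)" for c x
      by (rule hinner_ext) (use B in \<open>simp add: eq hinner_scale_left sesq_def\<close>)
    show "hnorm (T x) \<le> K * hnorm x" for x
      by (rule hinner_bound_le) (use K bound in \<open>auto simp: eq\<close>)
  qed
  with eq show ?thesis
    by blast
qed

text \<open>Makes the choice behind \<open>adj\<close> meaningful: the adjoint represents the form
  that sends \<open>x, y\<close> to \<open>hinner x (T y)\<close>.\<close>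

lemma adj_ex:
  assumes "bop T" shows "\<exists>S. bop S \<and> (\<forall>x y. hinner (T x) y = hinner x (S y))"
proof -
  obtain K where K: "0 \<le> K" "\<And>x. hnorm (T x) \<le> K * hnorm x"
    using bop_bound[OF assms] by blast
  define B where "B x y = hinner x (T y)" for x y
  have "sesq B"
    by (simp add: sesq_def B_def hinner_add_left hinner_add_right bop_add[OF assms] bop_scale[OF assms]
        hinner_scale_left hinner_scale_right)
  moreover have "cmod (B x y) \<le> K * hnorm x * hnorm y" for x y
  proof -
    have "cmod (B x y) \<le> hnorm x * (K * hnorm y)"
      using hinner_Cauchy_Schwarz[of x "T y"] K(2)[of y]
      by (metis B_def hnorm_nonneg mult_left_mono order_trans)
    then show ?thesis
      by (simp add: ac_simps)
  qed
  ultimately obtain S where S: "bop S" "\<And>x y. hinner (S x) y = hinner x (T y)"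
    using sesq_op[of B K] K(1) unfolding B_def by blast
  then have "hinner (T x) y = hinner x (S y)" for x y
    using S(2)[of y x] hinner_commute[of x "S y"] hinner_commute[of "T x" y] by simp
  with S(1) show ?thesis
    by blast
qed

lemma bop_adj: "bop T \<Longrightarrow> bop (adj T)"
  and hinner_adj: "bop T \<Longrightarrow> hinner (T x) y = hinner x (adj T y)"
  unfolding adj_def using someI_ex[OF adj_ex] by blast+

lemma hinner_adj': "bop T \<Longrightarrow> hinner (adj T x) y = hinner x (T y)"
  using hinner_adj[of T y x] hinner_commute[of x "T y"] hinner_commute[of "adj T x" y] by simp

lemma adj_unique:
  assumes "bop T" "\<And>x y. hinner (T x) y = hinner x (S y)" shows "adj T = S"
proof (rule hinner_eqI)
  show "hinner (adj T x) y = hinner (S x) y" for x y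
    using hinner_adj'[OF assms(1), of x y] assms(2)[of y x] hinner_commute[of x "T y"]
      hinner_commute[of "S x" y] by simp
qed

lemma adj_comp: "bop S \<Longrightarrow> bop T \<Longrightarrow> adj (\<lambda>x. S (T x)) = (\<lambda>x. adj T (adj S x))"
  by (rule adj_unique) (auto simp: bop_comp hinner_adj)

lemma adj_id: "adj (\<lambda>x. x) = (\<lambda>x. x)"
  by (rule adj_unique) (auto simp: bop_id)

lemma adj_scaled: "bop T \<Longrightarrow> adj (\<lambda>x. hscale c (T x)) = (\<lambda>x. hscale (cnj c) (adj T x))"
  by (rule adj_unique) (auto simp: bop_scaled hinner_scale_left hinner_scale_right hinner_adj)

section \<open>Positive operators\<close>

lemma opos_bop: "opos T \<Longrightarrow> bop T"
  by (simp add: opos_def)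

lemma opos_nonneg: "opos T \<Longrightarrow> 0 \<le> Re (hinner (T x) x)"
  by (simp add: opos_def)

text \<open>Polarization: reality at \<open>x + y\<close> settles the imaginary part of the
  symmetry, reality at \<open>x + hscale \<i> y\<close> the real part.\<close>

lemma hform_bop:
  assumes T: "bop T" and Im: "\<And>x. Im (hinner (T x) x) = 0"
  shows "hform (\<lambda>x y. hinner (T x) y)"
proof -
  have commute: "hinner (T y) x = cnj (hinner (T x) y)" for x y
  proof (rule complex_eqI)
    show "Re (hinner (T y) x) = Re (cnj (hinner (T x) y))"
      using Im[of "x + hscale \<i> y"] Im[of x] Im[of y]
      by (simp add: bop_add[OF T] bop_scale[OF T] hinner_add_left hinner_add_right hinner_scale_left
          hinner_scale_right)
    show "Im (hinner (T y) x) = Im (cnj (hinner (T x) y))"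
      using Im[of "x + y"] Im[of x] Im[of y]
      by (simp add: bop_add[OF T] hinner_add_left hinner_add_right)
  qed
  show ?thesis
    unfolding hform_def
  proof (intro conjI allI)
    show "hinner (T y) x = cnj (hinner (T x) y)" for x y
      by (rule commute)
  qed (simp_all add: bop_add[OF T] bop_scale[OF T] hinner_add_left hinner_scale_left)
qed

lemma opos_hform: "opos T \<Longrightarrow> hform (\<lambda>x y. hinner (T x) y)"
  by (rule hform_bop) (auto simp: opos_def)

lemma opos_selfadj: "opos T \<Longrightarrow> hinner (T x) y = hinner x (T y)"
  using hform_commute[OF opos_hform, of T y x] hinner_commute[of "T y" x] by simp

lemma opos_opid: "opos opid"
  unfolding opos_def using bop_opid by (simp add: opid_def hinner_self)

lemma opos_add: "opos S \<Longrightarrow> opos T \<Longrightarrow> opos (\<lambda>x. S x + T x)"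
  by (simp add: opos_def bop_plus hinner_add_left)

lemma opos_scaled: "opos T \<Longrightarrow> 0 \<le> c \<Longrightarrow> opos (\<lambda>x. hscale (complex_of_real c) (T x))"
  by (simp add: opos_def bop_scaled hinner_scale_left)

lemma opos_opscal: "0 \<le> c \<Longrightarrow> opos (opscal c)"
  using opos_scaled[OF opos_opid] by (simp add: opscal_def opid_def)

lemma opos_sum: "(\<And>i. i \<in> A \<Longrightarrow> opos (T i)) \<Longrightarrow> opos (\<lambda>x. \<Sum>i\<in>A. T i x)"
proof (induction A rule: infinite_finite_induct)
  case (insert i A)
  then show ?case
    using opos_add[of "T i" "\<lambda>x. \<Sum>i\<in>A. T i x"] by simp
qed (simp_all add: opos_def bop_zero_op)

lemma ople_iff:
  "opos S \<Longrightarrow> opos T \<Longrightarrow> ople S T \<longleftrightarrow> (\<forall>x. Re (hinner (S x) x) \<le> Re (hinner (T x) x))"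
  by (auto simp: ople_def opos_def bop_minus_op hinner_diff_left)

text \<open>Cauchy-Schwarz for the form of \<open>T\<close> itself turns the bound on the diagonal
  into one on the norm, with the same constant.\<close>

lemma opos_le_norm:
  assumes T: "opos T" and q: "0 \<le> q" "\<And>x. Re (hinner (T x) x) \<le> q * (hnorm x)\<^sup>2"
  shows "hnorm (T x) \<le> q * hnorm x"
proof (rule hinner_bound_le)
  fix y
  have "(cmod (hinner (T x) y))\<^sup>2 \<le> Re (hinner (T x) x) * Re (hinner (T y) y)"
    using hform_Cauchy_Schwarz[OF opos_hform[OF T] opos_nonneg[OF T]] .
  also have "\<dots> \<le> (q * (hnorm x)\<^sup>2) * (q * (hnorm y)\<^sup>2)"
    by (intro mult_mono q opos_nonneg[OF T] mult_nonneg_nonneg) auto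
  also have "\<dots> = (q * hnorm x * hnorm y)\<^sup>2"
    by (simp add: power2_eq_square)
  finally show "cmod (hinner (T x) y) \<le> q * hnorm x * hnorm y"
    by (rule power2_le_imp_le) (simp add: q)
qed (simp add: q)

lemma bop_Re_bound:
  assumes "bop T" obtains K where "0 < K" "\<And>x. Re (hinner (T x) x) \<le> K * (hnorm x)\<^sup>2"
proof -
  obtain K where K: "0 \<le> K" "\<And>x. hnorm (T x) \<le> K * hnorm x"
    using bop_bound[OF assms] by blast
  have "Re (hinner (T x) x) \<le> (K + 1) * (hnorm x)\<^sup>2" for x
  proof -
    have "Re (hinner (T x) x) \<le> hnorm (T x) * hnorm x"
      using hinner_Cauchy_Schwarz[of "T x" x] complex_Re_le_cmod[of "hinner (T x) x"] by linarith
    also have "\<dots> \<le> K * hnorm x * hnorm x"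
      by (intro mult_right_mono K) simp
    also have "\<dots> \<le> (K + 1) * (hnorm x)\<^sup>2"
      by (simp add: power2_eq_square algebra_simps)
    finally show ?thesis .
  qed
  then show ?thesis
    using that[of "K + 1"] K(1) by simp
qed

text \<open>With \<open>S\<close> inverse to \<open>R\<close>, Cauchy-Schwarz for the form of
  \<open>R\<close> at \<open>x\<close> and \<open>S x\<close> bounds the fourth power of the norm of
  \<open>x\<close> by \<open>hinner (R x) x\<close> times \<open>hinner (S x) x\<close>; the second
  factor is at most \<open>K\<close> times the squared norm.\<close>

lemma opos_invertible_coercive:
  assumes R: "opos R" and "oinvertible R"
  obtains e where "0 < e" "\<And>x. e * (hnorm x)\<^sup>2 \<le> Re (hinner (R x) x)"
proof -
  obtain S where S: "bop S" "\<And>x. R (S x) = x"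
    using assms(2) unfolding oinvertible_def by (metis comp_apply id_apply)
  obtain K where K: "0 < K" "\<And>x. Re (hinner (S x) x) \<le> K * (hnorm x)\<^sup>2"
    using bop_Re_bound[OF S(1)] by blast
  have "1 / K * (hnorm x)\<^sup>2 \<le> Re (hinner (R x) x)" for x
  proof -
    have "hinner (R x) (S x) = complex_of_real ((hnorm x)\<^sup>2)"
      by (simp add: opos_selfadj[OF R] S(2) hinner_self)
    then have "((hnorm x)\<^sup>2)\<^sup>2 = (cmod (hinner (R x) (S x)))\<^sup>2"
      by (simp add: norm_power)
    also have "\<dots> \<le> Re (hinner (R x) x) * Re (hinner (R (S x)) (S x))"
      by (rule hform_Cauchy_Schwarz[OF opos_hform[OF R] opos_nonneg[OF R]])
    also have "Re (hinner (R (S x)) (S x)) = Re (hinner (S x) x)"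
      unfolding S(2) by (subst hinner_commute) simp
    also have "Re (hinner (R x) x) * Re (hinner (S x) x) \<le> Re (hinner (R x) x) * (K * (hnorm x)\<^sup>2)"
      by (intro mult_left_mono K opos_nonneg[OF R])
    finally have "(hnorm x)\<^sup>2 * (hnorm x)\<^sup>2 \<le> (Re (hinner (R x) x) * K) * (hnorm x)\<^sup>2"
      by (simp add: power2_eq_square ac_simps)
    then have "(hnorm x)\<^sup>2 \<le> Re (hinner (R x) x) * K"
    proof (cases "hnorm x = 0")
      case False
      then have "0 < (hnorm x)\<^sup>2"
        by simp
      then show ?thesis
        using \<open>(hnorm x)\<^sup>2 * (hnorm x)\<^sup>2 \<le> (Re (hinner (R x) x) * K) * (hnorm x)\<^sup>2\<close>
        by (rule mult_right_le_imp_le[rotated])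
    qed (use opos_nonneg[OF R, of x] K(1) in auto)
    then show ?thesis
      using K(1) by (simp add: field_simps)
  qed
  then show ?thesis
    using that[of "1 / K"] K(1) by simp
qed

text \<open>Lax-Milgram: \<open>riesz_coercive\<close> for the form of \<open>R\<close> solves
  \<open>R z = y\<close>, and coercivity bounds the solution by \<open>1 / e\<close> times
  \<open>y\<close>.\<close>

lemma coercive_invertible:
  assumes R: "opos R" and e: "0 < e" and low: "\<And>x. e * (hnorm x)\<^sup>2 \<le> Re (hinner (R x) x)"
  shows "oinvertible R"
proof -
  obtain K where K: "\<And>x. Re (hinner (R x) x) \<le> K * (hnorm x)\<^sup>2"
    using bop_Re_bound[OF opos_bop[OF R]] by blast
  have "\<exists>z. \<forall>x. hinner x y = hinner (R x) z" for y
    by (rule riesz_coercive[OF opos_hform[OF R] e low K, where K="hnorm y"])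
      (use hinner_Cauchy_Schwarz[of _ y] in \<open>auto simp: hinner_add_left hinner_scale_left mult.commute\<close>)
  then obtain S where S: "\<And>x y. hinner x y = hinner (R x) (S y)"
    by metis
  have "hinner (R (S y)) x = hinner y x" for x y
    using opos_selfadj[OF R, of "S y" x] hinner_commute[of "S y" "R x"] hinner_commute[of y x] S[of x y]
    by simp
  then have RS: "R (S y) = y" for y
    by (rule hinner_ext)
  have inj: "x = y" if "R x = R y" for x y
  proof -
    have "R (x - y) = 0"
      using that by (simp add: bop_diff[OF opos_bop[OF R]])
    then have "hnorm (x - y) = 0"
      using low[of "x - y"] e by (simp add: mult_le_0_iff)
    then show ?thesis
      by simp
  qed
  have SR: "S (R x) = x" for x
    by (rule inj) (rule RS)
  have "bop S"
  proof (rule bopI)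
    show "S (x + y) = S x + S y" for x y
      by (rule inj) (simp add: RS bop_add[OF opos_bop[OF R]])
    show "S (hscale c x) = hscale c (S x)" for c x
      by (rule inj) (simp add: RS bop_scale[OF opos_bop[OF R]])
    show "hnorm (S x) \<le> 1 / e * hnorm x" for x
    proof (cases "hnorm (S x) = 0")
      case True
      then show ?thesis
        using e by simp
    next
      case False
      have "e * (hnorm (S x))\<^sup>2 \<le> Re (hinner x (S x))"
        using low[of "S x"] by (simp add: RS)
      also have "\<dots> \<le> hnorm x * hnorm (S x)"
        using hinner_Cauchy_Schwarz[of x "S x"] complex_Re_le_cmod[of "hinner x (S x)"] by linarith
      finally have "(e * hnorm (S x)) * hnorm (S x) \<le> hnorm x * hnorm (S x)"
        by (simp add: power2_eq_square)
      then have "e * hnorm (S x) \<le> hnorm x"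
        using False hnorm_nonneg[of "S x"] by simp
      then show ?thesis
        using e by (simp add: field_simps)
    qed
  qed
  then show ?thesis
    unfolding oinvertible_def using opos_bop[OF R] by (intro conjI exI[of _ S]) (auto simp: fun_eq_iff RS SR)
qed

lemma bop_limit:
  fixes T :: "nat \<Rightarrow> 'a::chilbert \<Rightarrow> 'a"
  assumes T: "\<And>n. bop (T n)" and K: "\<And>n x. hnorm (T n x) \<le> K * hnorm x"
    and step: "\<And>n x. hnorm (T (Suc n) x - T n x) \<le> C * hnorm x * q ^ n" and q: "0 \<le> q" "q < 1"
  obtains L where "bop L" "\<And>x. hnorm (L x) \<le> K * hnorm x" "\<And>x. (\<lambda>n. hnorm (T n x - L x)) \<longlonglongrightarrow> 0"
proof -
  have "\<exists>L. \<forall>n. hnorm (T n x - L) \<le> C * hnorm x * q ^ n / (1 - q)" for x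
    by (rule hcomplete_geometric[OF step q])
  then obtain L where L: "\<And>x n. hnorm (T n x - L x) \<le> C * hnorm x * q ^ n / (1 - q)"
    by metis
  have lim: "(\<lambda>n. hnorm (T n x - L x)) \<longlonglongrightarrow> 0" for x
  proof (rule tendsto_sandwich[OF _ _ tendsto_const])
    show "(\<lambda>n. C * hnorm x * q ^ n / (1 - q)) \<longlonglongrightarrow> 0"
      using q by (auto intro!: tendsto_divide_zero tendsto_mult_right_zero LIMSEQ_power_zero)
  qed (use L in auto)
  have eqI: "u = v" if "\<And>n. hnorm (u - v) \<le> f n" "f \<longlonglongrightarrow> 0" for u v :: 'a and f
  proof -
    have "hnorm (u - v) \<le> 0"
      using LIMSEQ_le_const[OF that(2)] that(1) by blast
    then have "hnorm (u - v) = 0"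
      using hnorm_nonneg by (rule antisym)
    then show ?thesis
      by simp
  qed
  have bound: "hnorm (L x) \<le> K * hnorm x" for x
  proof (rule LIMSEQ_le_const)
    show "(\<lambda>n. K * hnorm x + hnorm (T n x - L x)) \<longlonglongrightarrow> K * hnorm x"
      using tendsto_add[OF tendsto_const lim, of "K * hnorm x" x] by simp
    have "hnorm (L x) \<le> K * hnorm x + hnorm (T n x - L x)" for n
      using hnorm_reverse_triangle[of "T n x" "L x"] K[of n x] by linarith
    then show "\<exists>N. \<forall>n\<ge>N. hnorm (L x) \<le> K * hnorm x + hnorm (T n x - L x)"
      by blast
  qed
  have "bop L"
  proof (rule bopI)
    show "L (x + y) = L x + L y" for x y
    proof (rule eqI)
      fix n
      have "L (x + y) - (L x + L y) = (L (x + y) - T n (x + y)) + ((T n x - L x) + (T n y - L y))"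
        by (simp add: bop_add[OF T])
      then show "hnorm (L (x + y) - (L x + L y))
          \<le> hnorm (T n (x + y) - L (x + y)) + (hnorm (T n x - L x) + hnorm (T n y - L y))"
        by (smt (verit) hnorm_minus_commute hnorm_triangle)
      show "(\<lambda>n. hnorm (T n (x + y) - L (x + y)) + (hnorm (T n x - L x) + hnorm (T n y - L y))) \<longlonglongrightarrow> 0"
        by (intro tendsto_add_zero lim)
    qed
    show "L (hscale c x) = hscale c (L x)" for c x
    proof (rule eqI)
      fix n
      have "L (hscale c x) - hscale c (L x)
          = (L (hscale c x) - T n (hscale c x)) + hscale c (T n x - L x)"
        by (simp add: bop_scale[OF T] hscale_diff_right)
      then show "hnorm (L (hscale c x) - hscale c (L x))
          \<le> hnorm (T n (hscale c x) - L (hscale c x)) + cmod c * hnorm (T n x - L x)"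
        by (metis hnorm_minus_commute hnorm_triangle hnorm_scale)
      show "(\<lambda>n. hnorm (T n (hscale c x) - L (hscale c x)) + cmod c * hnorm (T n x - L x)) \<longlonglongrightarrow> 0"
        by (intro tendsto_add_zero tendsto_mult_right_zero lim)
    qed
  qed (rule bound)
  then show ?thesis
    using that bound lim by blast
qed

section \<open>Square roots of coercive operators\<close>

text \<open>With \<open>B = 1 - R\<close> of norm at most \<open>q < 1\<close>, the contraction \<open>Y \<mapsto> (B + Y\<^sup>2) / 2\<close> of the
  ball of radius \<open>q\<close> has a fixed point, and \<open>(1 - Y)\<^sup>2 = R\<close>.\<close>

lemma sqrt_contractive:
  assumes R: "opos R" and a: "0 < a" "a \<le> 1" and low: "\<And>x. a * (hnorm x)\<^sup>2 \<le> Re (hinner (R x) x)"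
    and up: "\<And>x. Re (hinner (R x) x) \<le> (hnorm x)\<^sup>2"
  obtains S where "bop S" "\<And>x y. hinner (S x) y = hinner x (S y)" "\<And>x. S (S x) = R x"
proof -
  define q where "q = 1 - a"
  have q: "0 \<le> q" "q < 1"
    using a by (auto simp: q_def)
  define B where "B x = x - R x" for x
  note bR = opos_bop[OF R]
  have bB: "bop B"
    unfolding B_def by (intro bop_minus_op bop_id bR)
  have "opos B"
    unfolding opos_def using bB R up
    by (simp add: B_def opos_def hinner_diff_left hinner_self)
  then have nB: "hnorm (B x) \<le> q * hnorm x" for x
    by (rule opos_le_norm) (use q low in \<open>auto simp: B_def hinner_diff_left hinner_self q_def algebra_simps\<close>)
  have sB: "hinner (B x) y = hinner x (B y)" for x y
    by (rule opos_selfadj[OF \<open>opos B\<close>])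
  define h where "h = complex_of_real (1 / 2)"
  define Y where "Y = rec_nat (\<lambda>x. 0 :: 'a) (\<lambda>_ Z x. hscale h (B x + Z (Z x)))"
  have Y0: "Y 0 = (\<lambda>x. 0)" and YS: "Y (Suc n) = (\<lambda>x. hscale h (B x + Y n (Y n x)))" for n
    by (simp_all add: Y_def)
  have bY: "bop (Y n)" for n
  proof (induction n)
    case (Suc n)
    then show ?case
      unfolding YS by (intro bop_scaled bop_plus[OF bB] bop_comp[OF Suc Suc])
  qed (simp add: Y0 bop_zero_op)
  have nY: "hnorm (Y n x) \<le> q * hnorm x" for n x
  proof (induction n arbitrary: x)
    case (Suc n)
    have "hnorm (Y n (Y n x)) \<le> q * (q * hnorm x)"
      using Suc by (meson mult_left_mono order_trans q(1))
    also have "\<dots> \<le> 1 * (q * hnorm x)"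
      using q by (intro mult_right_mono) auto
    finally have "hnorm (B x + Y n (Y n x)) \<le> 2 * (q * hnorm x)"
      using hnorm_triangle[of "B x" "Y n (Y n x)"] nB[of x] by linarith
    then show ?case
      by (simp add: YS hnorm_scale h_def norm_divide)
  qed (simp add: Y0 q)
  have dY: "hnorm (Y (Suc n) x - Y n x) \<le> 1 * hnorm x * q ^ n" for n x
  proof (induction n arbitrary: x)
    case 0
    have "q * hnorm x \<le> 1 * hnorm x"
      using q by (intro mult_right_mono) auto
    then show ?case
      using nY[of 1 x] by (simp add: Y0)
  next
    case (Suc n)
    let ?Z = "Y (Suc n)"
    let ?Y = "Y n"
    have "Y (Suc (Suc n)) x = hscale h (B x + ?Z (?Z x))" "?Z x = hscale h (B x + ?Y (?Y x))"
      by (subst YS, rule refl)+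
    then have "Y (Suc (Suc n)) x - ?Z x = hscale h (B x + ?Z (?Z x)) - hscale h (B x + ?Y (?Y x))"
      by (rule arg_cong2)
    also have "\<dots> = hscale h (?Z (?Z x) - ?Y (?Y x))"
      by (simp flip: hscale_diff_right)
    \<comment> \<open>Both summands gain a factor \<open>q\<close>: the first since
      \<open>?Z\<close> is bounded by \<open>q\<close>, the second since the difference is taken at
      \<open>?Y x\<close>. The half in front makes the total factor \<open>q\<close>.\<close>
    also have "?Z (?Z x) - ?Y (?Y x) = ?Z (?Z x - ?Y x) + (?Z (?Y x) - ?Y (?Y x))"
      by (simp add: bop_diff[OF bY])
    finally have "hnorm (Y (Suc (Suc n)) x - ?Z x)
        \<le> 1 / 2 * (hnorm (?Z (?Z x - ?Y x)) + hnorm (?Z (?Y x) - ?Y (?Y x)))"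
      using hnorm_triangle by (simp add: hnorm_scale h_def norm_divide)
    moreover have "hnorm (?Z (?Z x - ?Y x)) \<le> q * (1 * hnorm x * q ^ n)"
      by (rule order_trans[OF nY mult_left_mono[OF Suc q(1)]])
    moreover have "hnorm (?Z (?Y x) - ?Y (?Y x)) \<le> 1 * (q * hnorm x) * q ^ n"
      by (rule order_trans[OF Suc]) (intro mult_right_mono mult_left_mono nY, use q in auto)
    ultimately show ?case
      by (simp add: mult.commute mult.left_commute)
  qed
  obtain L where L: "bop L" "\<And>x. hnorm (L x) \<le> q * hnorm x" "\<And>x. (\<lambda>n. hnorm (Y n x - L x)) \<longlonglongrightarrow> 0"
    using bop_limit[OF bY nY dY q] by blast
  have fix_eq: "L x = hscale h (B x + L (L x))" for x
  proof -
    have "hnorm (L x - hscale h (B x + L (L x))) \<le> 0"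
    proof (rule LIMSEQ_le_const)
      let ?b = "\<lambda>n. hnorm (Y (Suc n) x - L x) + (1 / 2) * (q * hnorm (Y n x - L x) + hnorm (Y n (L x) - L (L x)))"
      show "?b \<longlonglongrightarrow> 0"
        by (intro tendsto_add_zero tendsto_mult_right_zero L LIMSEQ_Suc)
      have "hnorm (L x - hscale h (B x + L (L x))) \<le> ?b n" for n
      proof -
        have "hnorm (Y (Suc n) x - hscale h (B x + L (L x))) = 1 / 2 * hnorm (Y n (Y n x) - L (L x))"
          by (simp add: YS hnorm_scale h_def norm_divide flip: hscale_diff_right)
        moreover have "hnorm (Y n (Y n x) - L (L x)) \<le> hnorm (Y n (Y n x - L x)) + hnorm (Y n (L x) - L (L x))"
          using hnorm_diff_triangle[of "Y n (Y n x)" "L (L x)" "Y n (L x)"] by (simp add: bop_diff[OF bY])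
        moreover have "hnorm (Y n (Y n x - L x)) \<le> q * hnorm (Y n x - L x)"
          by (rule nY)
        ultimately show ?thesis
          using hnorm_diff_triangle[of "L x" "hscale h (B x + L (L x))" "Y (Suc n) x"]
            hnorm_minus_commute[of "L x" "Y (Suc n) x"] by argo
      qed
      then show "\<exists>N. \<forall>n\<ge>N. hnorm (L x - hscale h (B x + L (L x))) \<le> ?b n"
        by blast
    qed
    then have "hnorm (L x - hscale h (B x + L (L x))) = 0"
      using hnorm_nonneg by (rule antisym)
    then show ?thesis
      by simp
  qed
  have sY: "hinner (Y n x) y = hinner x (Y n y)" for n x y
    by (induction n arbitrary: x y)
      (simp_all add: Y0 YS hinner_scale_left hinner_scale_right hinner_add_left hinner_add_right sB h_def)
  have sL: "hinner (L x) y = hinner x (L y)" for x y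
  proof -
    have lim: "(\<lambda>n. hinner (Y n u) v) \<longlonglongrightarrow> hinner (L u) v" for u v
    proof -
      have "(\<lambda>n. hnorm (Y n u - L u) * hnorm v) \<longlonglongrightarrow> 0"
        by (rule tendsto_mult_left_zero[OF L(3)])
      then have "(\<lambda>n. hinner (Y n u) v - hinner (L u) v) \<longlonglongrightarrow> 0"
        by (rule Lim_null_comparison[rotated])
          (simp add: hinner_Cauchy_Schwarz flip: hinner_diff_left)
      then show ?thesis
        by (simp add: LIM_zero_iff)
    qed
    have "(\<lambda>n. hinner (Y n x) y) \<longlonglongrightarrow> hinner x (L y)"
    proof -
      have "(\<lambda>n. cnj (hinner (Y n y) x)) \<longlonglongrightarrow> cnj (hinner (L y) x)"
        by (rule tendsto_cnj[OF lim])
      moreover have "cnj (hinner (Y n y) x) = hinner (Y n x) y" for n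
        unfolding sY[of n x y] by (rule hinner_commute[symmetric])
      moreover have "cnj (hinner (L y) x) = hinner x (L y)"
        by (rule hinner_commute[symmetric])
      ultimately show ?thesis
        by simp
    qed
    then show ?thesis
      using lim LIMSEQ_unique by blast
  qed
  show ?thesis
  proof (rule that[of "\<lambda>x. x - L x"])
    show "bop (\<lambda>x. x - L x)"
      by (intro bop_minus_op bop_id L)
    show "hinner (x - L x) y = hinner x (y - L y)" for x y
      by (simp add: hinner_diff_left hinner_diff_right sL)
    show "x - L x - L (x - L x) = R x" for x
    proof -
      have "L x + L x = B x + L (L x)"
        using arg_cong[OF fix_eq[of x], of "hscale 2"]
          hscale_add_left[of 1 1 "L x"] by (simp add: hscale_hscale h_def hscale_one)
      then have "B x = L x + L x - L (L x)"
        by simp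
      then show ?thesis
        by (simp add: bop_diff[OF L(1)] B_def algebra_simps)
    qed
  qed
qed

text \<open>\<open>S\<close> commutes with its square \<open>R\<close>, hence with the inverse
  \<open>Q\<close> of \<open>R\<close>; so \<open>S\<close> after \<open>Q\<close> is a two-sided
  inverse of \<open>S\<close>.\<close>

lemma oinvertible_sqrt:
  assumes S: "bop S" "\<And>x. S (S x) = R x" and "oinvertible R"
  shows "oinvertible S"
proof -
  obtain Q where Q: "bop Q" "\<And>x. R (Q x) = x" "\<And>x. Q (R x) = x"
    using assms(3) unfolding oinvertible_def by (metis comp_apply id_apply)
  have comm: "S (Q x) = Q (S x)" for x
  proof -
    have "R (S (Q x)) = S (R (Q x))"
      by (simp flip: S(2))
    then have "R (S (Q x)) = S x"
      by (simp add: Q(2))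
    then show ?thesis
      using Q(3)[of "S (Q x)"] by simp
  qed
  have "S \<circ> (\<lambda>x. S (Q x)) = id" "(\<lambda>x. S (Q x)) \<circ> S = id"
    by (simp_all add: fun_eq_iff S Q comm)
  then show ?thesis
    unfolding oinvertible_def using S(1) bop_comp[OF S(1) Q(1)] by blast
qed

lemma sqrt_coercive:
  assumes R: "opos R" and a: "0 < a" and low: "\<And>x. a * (hnorm x)\<^sup>2 \<le> Re (hinner (R x) x)"
  obtains S where "bop S" "\<And>x y. hinner (S x) y = hinner x (S y)" "\<And>x. S (S x) = R x" "oinvertible S"
proof -
  obtain b0 where b0: "0 < b0" "\<And>x. Re (hinner (R x) x) \<le> b0 * (hnorm x)\<^sup>2"
    using bop_Re_bound[OF opos_bop[OF R]] by blast
  \<comment> \<open>The maximum with \<open>a\<close> guarantees \<open>a / b \<le> 1\<close>, as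
    \<open>sqrt_contractive\<close> demands of its lower bound.\<close>
  define b where "b = max a b0"
  have b: "0 < b" "a \<le> b" and up: "Re (hinner (R x) x) \<le> b * (hnorm x)\<^sup>2" for x
    using a order_trans[OF b0(2)[of x], of "b * (hnorm x)\<^sup>2"] by (auto simp: b_def mult_right_mono)
  define R1 where "R1 x = hscale (complex_of_real (1 / b)) (R x)" for x
  have "opos R1"
    unfolding R1_def using opos_scaled[OF R, of "1 / b"] b by simp
  then obtain S where S: "bop S" "\<And>x y. hinner (S x) y = hinner x (S y)" "\<And>x. S (S x) = R1 x"
  proof (rule sqrt_contractive[of R1 "a / b"])
    show "a / b * (hnorm x)\<^sup>2 \<le> Re (hinner (R1 x) x)" "Re (hinner (R1 x) x) \<le> (hnorm x)\<^sup>2" for x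
      using low[of x] up[of x] b by (simp_all add: R1_def hinner_scale_left field_simps)
  qed (use a b in auto)
  define c where "c = complex_of_real (sqrt b)"
  have cc: "c * c * complex_of_real (1 / b) = 1"
    using b by (simp add: c_def flip: of_real_mult)
  define S1 where "S1 x = hscale c (S x)" for x
  have 1: "bop S1"
    unfolding S1_def by (rule bop_scaled[OF S(1)])
  have 2: "hinner (S1 x) y = hinner x (S1 y)" for x y
    by (simp add: S1_def hinner_scale_left hinner_scale_right S(2) c_def)
  have 3: "S1 (S1 x) = R x" for x
  proof -
    have "S1 (S1 x) = hscale (c * c * complex_of_real (1 / b)) (R x)"
      by (simp add: S1_def bop_scale[OF S(1)] hscale_hscale S(3) R1_def)
    then show ?thesis
      by (simp only: cc hscale_one)
  qed
  show ?thesis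
    by (rule that[OF 1 2 3 oinvertible_sqrt[OF 1 3 coercive_invertible[OF R a low]]])
qed

section \<open>Operator norm and uniform boundedness\<close>

lemma bdd_above_opnorm: assumes "bop T" shows "bdd_above ((\<lambda>x. hnorm (T x)) ` {x. hnorm x \<le> 1})"
proof -
  obtain K where K: "0 \<le> K" "\<And>x. hnorm (T x) \<le> K * hnorm x"
    using bop_bound[OF assms] by blast
  show ?thesis
  proof (rule bdd_aboveI2)
    fix x :: 'a assume "x \<in> {x. hnorm x \<le> 1}"
    then have "K * hnorm x \<le> K"
      using K(1) by (simp add: mult_left_le)
    then show "hnorm (T x) \<le> K"
      using K(2)[of x] by linarith
  qed
qed

lemma opnorm_nonneg: assumes "bop T" shows "0 \<le> opnorm T"
proof -
  have "hnorm (T 0) \<le> opnorm T"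
    unfolding opnorm_def by (rule cSup_upper[OF _ bdd_above_opnorm[OF assms]]) auto
  then show ?thesis
    by (simp add: bop_zero[OF assms])
qed

lemma hnorm_le_opnorm: assumes "bop T" shows "hnorm (T x) \<le> opnorm T * hnorm x"
proof (cases "x = 0")
  case False
  define c where "c = complex_of_real (1 / hnorm x)"
  have x: "hnorm x > 0"
    using False hnorm_nonneg[of x] hnorm_eq_zero[of x] by linarith
  have "hnorm (T (hscale c x)) \<le> opnorm T"
    unfolding opnorm_def using x
    by (intro cSup_upper[OF _ bdd_above_opnorm[OF assms]]) (auto simp: hnorm_scale c_def norm_divide)
  then show ?thesis
    using x by (simp add: bop_scale[OF assms] hnorm_scale c_def norm_divide field_simps)
qed (simp add: bop_zero[OF assms])

lemma opnorm_le:
  assumes "0 \<le> K" "\<And>x. hnorm (T x) \<le> K * hnorm x" shows "opnorm T \<le> K"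
  unfolding opnorm_def
proof (rule cSup_least)
  show "(\<lambda>x. hnorm (T x)) ` {x. hnorm x \<le> 1} \<noteq> {}"
    using hnorm_zero by (auto intro!: exI[of _ 0])
next
  fix r assume "r \<in> (\<lambda>x. hnorm (T x)) ` {x. hnorm x \<le> 1}"
  then obtain x where x: "hnorm x \<le> 1" "r = hnorm (T x)"
    by blast
  then have "K * hnorm x \<le> K"
    using assms(1) by (simp add: mult_left_le)
  then show "r \<le> K"
    using assms(2)[of x] x(2) by linarith
qed

text \<open>Sokal's gliding hump proof.\<close>

lemma uniform_boundedness:
  fixes p :: "'i \<Rightarrow> 'a::chilbert \<Rightarrow> real"
  assumes tri: "\<And>i x y. p i (x + y) \<le> p i x + p i y"
    and scale: "\<And>i c x. p i (hscale c x) = cmod c * p i x"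
    and bnd: "\<And>i. \<exists>K. \<forall>x. p i x \<le> K * hnorm x"
    and pt: "\<And>x. \<exists>K. \<forall>i. p i x \<le> K"
  shows "\<exists>K. \<forall>i x. p i x \<le> K * hnorm x"
proof (rule ccontr)
  assume neg: "\<nexists>K. \<forall>i x. p i x \<le> K * hnorm x"
  have zero: "p i 0 = 0" for i
    using scale[of i 0 0] by simp
  have minus: "p i (- x) = p i x" for i x
    using scale[of i "-1" x] by (simp add: hscale_minus_left hscale_one)
  have nonneg: "0 \<le> p i x" for i x
    using tri[of i x "- x"] by (simp add: zero minus)
  \<comment> \<open>Take \<open>w\<close> of length at most \<open>r\<close> on which
    \<open>p i\<close> nearly attains its norm \<open>N\<close>. One of \<open>x + w\<close> and
    \<open>x - w\<close> does equally well, because their difference is \<open>2 w\<close>.\<close>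
  have hump: "\<exists>i N y. M \<le> N \<and> (\<forall>z. p i z \<le> N * hnorm z) \<and> hnorm (y - x) \<le> r \<and> 2 / 3 * N * r \<le> p i y"
    if "r > 0" "M > 0" for x M r
  proof -
    obtain i u0 where u0: "p i u0 > M * hnorm u0"
      using neg by (meson not_le)
    obtain K where K: "\<And>z. p i z \<le> K * hnorm z"
      using bnd by blast
    define N where "N = Sup (p i ` {z. hnorm z \<le> 1})"
    have bdd: "bdd_above (p i ` {z. hnorm z \<le> 1})"
    proof (rule bdd_aboveI2[where M="\<bar>K\<bar>"])
      fix z :: 'a assume "z \<in> {z. hnorm z \<le> 1}"
      then have "K * hnorm z \<le> \<bar>K\<bar> * 1"
        by (intro mult_mono) auto
      then show "p i z \<le> \<bar>K\<bar>"
        using K[of z] by simp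
    qed
    have N: "p i z \<le> N * hnorm z" for z
    proof (cases "z = 0")
      case False
      then have z: "hnorm z > 0"
        using hnorm_nonneg[of z] hnorm_eq_zero[of z] by linarith
      have "p i (hscale (complex_of_real (1 / hnorm z)) z) \<le> N"
        unfolding N_def using z by (intro cSup_upper[OF _ bdd]) (auto simp: hnorm_scale norm_divide)
      then show ?thesis
        using z by (simp add: scale norm_divide field_simps)
    qed (simp add: zero)
    have "M < N"
    proof (rule ccontr)
      assume "\<not> M < N"
      then have "N * hnorm u0 \<le> M * hnorm u0"
        by (intro mult_right_mono) auto
      then show False
        using u0 N[of u0] by simp
    qed
    then obtain u where u: "hnorm u \<le> 1" "2 / 3 * N < p i u"
    proof -
      have "p i ` {z. hnorm z \<le> 1} \<noteq> {}"
        using hnorm_zero by (auto intro!: exI[of _ 0])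
      moreover have "2 / 3 * N < Sup (p i ` {z. hnorm z \<le> 1})"
        using \<open>M < N\<close> \<open>M > 0\<close> unfolding N_def[symmetric] by simp
      ultimately show ?thesis
        using less_cSup_iff[OF _ bdd] that by blast
    qed
    define w where "w = hscale (complex_of_real r) u"
    have hw: "hnorm w \<le> r"
      using u(1) that(1) by (simp add: w_def hnorm_scale mult_left_le)
    have "p i w = r * p i u"
      using that(1) by (simp add: w_def scale)
    then have pw: "2 / 3 * N * r \<le> p i w"
      using u(2) that(1) by (simp add: mult.commute)
    have "2 * p i w \<le> p i (x + w) + p i (x - w)"
    proof -
      have "hscale 2 w = (x + w) + (- (x - w))"
        using hscale_add_left[of 1 1 w] by (simp add: hscale_one)
      then show ?thesis
        using tri[of i "x + w" "- (x - w)"] scale[of i 2 w] minus[of i "x - w"] by simp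
    qed
    then consider "2 / 3 * N * r \<le> p i (x + w)" | "2 / 3 * N * r \<le> p i (x - w)"
      using pw by linarith
    then obtain y where "hnorm (y - x) \<le> r" "2 / 3 * N * r \<le> p i y"
    proof cases
      case 1
      then show ?thesis
        using that[of "x + w"] hw by simp
    next
      case 2
      then show ?thesis
        using that[of "x - w"] hw by simp
    qed
    then show ?thesis
      using N \<open>M < N\<close> by (meson less_imp_le)
  qed
  define r where "r n = (1 / 3 :: real) ^ n" for n
  have "\<forall>n x. \<exists>i N y. 6 ^ n \<le> N \<and> (\<forall>z. p i z \<le> N * hnorm z) \<and> hnorm (y - x) \<le> r n \<and> 2 / 3 * N * r n \<le> p i y"
    using hump by (simp add: r_def)
  then obtain J N Z where
    N: "\<And>n x. 6 ^ n \<le> N n x" "\<And>n x z. p (J n x) z \<le> N n x * hnorm z"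
    and Z: "\<And>n x. hnorm (Z n x - x) \<le> r n" "\<And>n x. 2 / 3 * N n x * r n \<le> p (J n x) (Z n x)"
    by metis
  define X where "X = rec_nat (0 :: 'a) Z"
  have XS: "X (Suc n) = Z n (X n)" for n
    by (simp add: X_def)
  have "hnorm (X (Suc n) - X n) \<le> 1 * (1 / 3) ^ n" for n
    using Z(1)[of n "X n"] by (simp add: XS r_def)
  from hcomplete_geometric[of X 1 "1 / 3", OF this] obtain L
    where L: "\<And>n. hnorm (X n - L) \<le> 1 * (1 / 3) ^ n / (1 - 1 / 3)"
    by auto
  obtain K where K: "\<And>i. p i L \<le> K"
    using pt by blast
  \<comment> \<open>The norms grow at least like \<open>6 ^ n\<close> and the radii are
    \<open>(1 / 3) ^ n\<close>. The later steps move the point by at most \<open>r n / 2\<close>, so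
    a share \<open>2 / 3 - 1 / 2 = 1 / 6\<close> of the hump survives at the limit.\<close>
  have "2 ^ n \<le> 6 * K" for n
  proof -
    let ?i = "J n (X n)" and ?N = "N n (X n)"
    have "2 / 3 * ?N * r n \<le> p ?i (X (Suc n))"
      using Z(2)[of n "X n"] by (simp add: XS)
    also have "\<dots> \<le> p ?i L + p ?i (X (Suc n) - L)"
      using tri[of ?i L "X (Suc n) - L"] by simp
    also have "p ?i (X (Suc n) - L) \<le> ?N * hnorm (X (Suc n) - L)"
      by (rule N)
    also have "?N * hnorm (X (Suc n) - L) \<le> ?N * (r n / 2)"
      using L[of "Suc n"] order_trans[OF _ N(1)[of n "X n"], of 0]
      by (intro mult_left_mono) (auto simp: r_def)
    finally have "?N * r n \<le> 6 * K"
      using K[of ?i] by (simp add: field_simps)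
    moreover have "6 ^ n * r n \<le> ?N * r n"
      by (intro mult_right_mono N) (simp add: r_def)
    moreover have "6 ^ n * r n = 2 ^ n"
      by (simp add: r_def flip: power_mult_distrib)
    ultimately show ?thesis
      by simp
  qed
  then show False
    by (metis linorder_not_le real_arch_pow one_less_numeral_iff semiring_norm(76))
qed

section \<open>The map of a row operator\<close>

abbreviation qform :: "('a::chilbert \<Rightarrow> 'a) \<Rightarrow> 'a \<Rightarrow> real" where
  "qform T x \<equiv> Re (hinner (T x) x)"

lemma sum_mult_le_sqrt:
  fixes u v :: "'i \<Rightarrow> real"
  assumes "(\<Sum>i\<in>J. (u i)\<^sup>2) \<le> U" "(\<Sum>i\<in>J. (v i)\<^sup>2) \<le> V"
  shows "(\<Sum>i\<in>J. \<bar>u i\<bar> * \<bar>v i\<bar>) \<le> sqrt U * sqrt V"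
proof -
  have "(\<Sum>i\<in>J. \<bar>u i\<bar> * \<bar>v i\<bar>) \<le> L2_set u J * L2_set v J"
    by (rule L2_set_mult_ineq)
  also have "\<dots> \<le> sqrt U * sqrt V"
    unfolding L2_set_def
    by (intro mult_mono real_sqrt_le_mono assms real_sqrt_ge_zero sum_nonneg order_trans[OF sum_nonneg assms(1)])
      simp_all
  finally show ?thesis .
qed

lemma summable_Cauchy_Schwarz:
  fixes f :: "'i \<Rightarrow> complex"
  assumes f: "\<And>i. i \<in> I \<Longrightarrow> cmod (f i) \<le> c * (u i * v i)" and c: "0 \<le> c"
    and u: "\<And>i. i \<in> I \<Longrightarrow> 0 \<le> u i" "\<And>J. finite J \<Longrightarrow> J \<subseteq> I \<Longrightarrow> (\<Sum>i\<in>J. (u i)\<^sup>2) \<le> U"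
    and v: "\<And>i. i \<in> I \<Longrightarrow> 0 \<le> v i" "\<And>J. finite J \<Longrightarrow> J \<subseteq> I \<Longrightarrow> (\<Sum>i\<in>J. (v i)\<^sup>2) \<le> V"
  shows "f summable_on I" "cmod (infsum f I) \<le> c * (sqrt U * sqrt V)"
proof -
  have le: "(\<Sum>i\<in>J. cmod (f i)) \<le> c * (sqrt U * sqrt V)" if J: "finite J" "J \<subseteq> I" for J
  proof -
    have "(\<Sum>i\<in>J. cmod (f i)) \<le> (\<Sum>i\<in>J. c * (\<bar>u i\<bar> * \<bar>v i\<bar>))"
      using J u(1) v(1) f by (intro sum_mono) (force simp: subset_iff)
    also have "\<dots> = c * (\<Sum>i\<in>J. \<bar>u i\<bar> * \<bar>v i\<bar>)"
      by (simp add: sum_distrib_left)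
    also have "\<dots> \<le> c * (sqrt U * sqrt V)"
      by (intro mult_left_mono sum_mult_le_sqrt u v J c)
    finally show ?thesis .
  qed
  have abs: "(\<lambda>i. cmod (f i)) summable_on I"
    by (rule nonneg_bdd_above_summable_on) (use le in \<open>auto simp: bdd_above_def\<close>)
  then show "f summable_on I"
    by (rule abs_summable_summable)
  have "cmod (infsum f I) \<le> infsum (\<lambda>i. cmod (f i)) I"
    by (rule norm_infsum_bound[OF abs])
  also have "\<dots> \<le> c * (sqrt U * sqrt V)"
    by (rule infsum_le_finite_sums[OF abs le])
  finally show "cmod (infsum f I) \<le> c * (sqrt U * sqrt V)" .
qed

text \<open>\<open>K\<close> bounds \<open>\<phi>\<close> at the identity. It is stated through
  finite sections, so that it makes sense before the infinite sum is known to define an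
  operator.\<close>

locale row_operator =
  fixes A :: "nat \<Rightarrow> 'a::chilbert \<Rightarrow> 'a" and I :: "nat set" and K :: real
  assumes bop_A: "i \<in> I \<Longrightarrow> bop (A i)"
    and K_nonneg: "0 \<le> K"
    and row_bound: "finite J \<Longrightarrow> J \<subseteq> I \<Longrightarrow> (\<Sum>i\<in>J. (hnorm (adj (A i) x))\<^sup>2) \<le> K * (hnorm x)\<^sup>2"
begin

abbreviation "\<phi> \<equiv> phiA A I"

lemma bop_adjA: "i \<in> I \<Longrightarrow> bop (adj (A i))"
  by (rule bop_adj[OF bop_A])

lemma phi_summable:
  assumes "bop X"
  shows "(\<lambda>i. hinner (X (adj (A i) x)) (adj (A i) y)) summable_on I"
    and "cmod (\<Sum>\<^sub>\<infinity>i\<in>I. hinner (X (adj (A i) x)) (adj (A i) y)) \<le> opnorm X * K * hnorm x * hnorm y"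
proof -
  have "cmod (hinner (X (adj (A i) x)) (adj (A i) y)) \<le> opnorm X * (hnorm (adj (A i) x) * hnorm (adj (A i) y))" for i
    using order_trans[OF hinner_Cauchy_Schwarz mult_right_mono[OF hnorm_le_opnorm[OF assms] hnorm_nonneg]]
    by (simp add: mult.assoc)
  note * = summable_Cauchy_Schwarz[OF this opnorm_nonneg[OF assms] hnorm_nonneg row_bound hnorm_nonneg row_bound]
  show "(\<lambda>i. hinner (X (adj (A i) x)) (adj (A i) y)) summable_on I"
    by (rule *(1))
  have "opnorm X * (sqrt (K * (hnorm x)\<^sup>2) * sqrt (K * (hnorm y)\<^sup>2)) = opnorm X * K * hnorm x * hnorm y"
    using K_nonneg by (simp add: real_sqrt_mult)
  moreover have "cmod (\<Sum>\<^sub>\<infinity>i\<in>I. hinner (X (adj (A i) x)) (adj (A i) y))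
      \<le> opnorm X * (sqrt (K * (hnorm x)\<^sup>2) * sqrt (K * (hnorm y)\<^sup>2))"
    by (rule *(2))
  ultimately show "cmod (\<Sum>\<^sub>\<infinity>i\<in>I. hinner (X (adj (A i) x)) (adj (A i) y)) \<le> opnorm X * K * hnorm x * hnorm y"
    by (simp only:)
qed

lemma phi_ex:
  assumes "bop X"
  shows "\<exists>T. bop T \<and> (\<forall>x y. ((\<lambda>i. hinner (A i (X (adj (A i) x))) y) has_sum hinner (T x) y) I)"
proof -
  define B where "B x y = (\<Sum>\<^sub>\<infinity>i\<in>I. hinner (X (adj (A i) x)) (adj (A i) y))" for x y
  have sum: "((\<lambda>i. hinner (X (adj (A i) x)) (adj (A i) y)) has_sum B x y) I" for x y
    unfolding B_def by (rule has_sum_infsum[OF phi_summable(1)[OF assms]])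
  have uniq: "B x y = s" if "(f has_sum s) I" "\<And>i. i \<in> I \<Longrightarrow> f i = hinner (X (adj (A i) x)) (adj (A i) y)" for x y s f
    by (rule has_sum_unique[OF sum has_sum_cong[THEN iffD1, OF _ that(1)]]) (rule that(2))
  have "sesq B"
    unfolding sesq_def
  proof (intro conjI allI)
    show "B (x + y) z = B x z + B y z" for x y z
      by (rule uniq[OF has_sum_add[OF sum sum]])
        (simp add: bop_add[OF bop_adjA] bop_add[OF assms] hinner_add_left)
    show "B x (y + z) = B x y + B x z" for x y z
      by (rule uniq[OF has_sum_add[OF sum sum]]) (simp add: bop_add[OF bop_adjA] hinner_add_right)
    show "B (hscale c x) y = c * B x y" for c x y
      by (rule uniq[OF has_sum_cmult_right[OF sum]])
        (simp add: bop_scale[OF bop_adjA] bop_scale[OF assms] hinner_scale_left)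
    show "B x (hscale c y) = cnj c * B x y" for c x y
      by (rule uniq[OF has_sum_cmult_right[OF sum]])
        (simp add: bop_scale[OF bop_adjA] hinner_scale_right)
  qed
  moreover have "0 \<le> opnorm X * K"
    using opnorm_nonneg[OF assms] K_nonneg by simp
  moreover have "cmod (B x y) \<le> opnorm X * K * hnorm x * hnorm y" for x y
    unfolding B_def by (rule phi_summable(2)[OF assms])
  ultimately obtain T where T: "bop T" "\<And>x y. hinner (T x) y = B x y"
    using sesq_op by blast
  have "((\<lambda>i. hinner (A i (X (adj (A i) x))) y) has_sum hinner (T x) y) I" for x y
    unfolding T(2) by (rule has_sum_cong[THEN iffD1, OF _ sum]) (simp add: hinner_adj[OF bop_A])
  with T(1) show ?thesis
    by blast
qed

lemma phi_unique:
  assumes "\<And>x y. ((\<lambda>i. hinner (A i (X (adj (A i) x))) y) has_sum hinner (S x) y) I"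
    and "\<And>x y. ((\<lambda>i. hinner (A i (X (adj (A i) x))) y) has_sum hinner (T x) y) I"
  shows "S = T"
  by (rule hinner_eqI) (rule has_sum_unique[OF assms])

text \<open>Unlocks the definite description in \<open>phiA\<close>: the weak sums determine the
  operator, and the bounded form they define provides it.\<close>

lemma phi_spec:
  assumes "bop X"
  shows "bop (\<phi> X) \<and> (\<forall>x y. ((\<lambda>i. hinner (A i (X (adj (A i) x))) y) has_sum hinner (\<phi> X x) y) I)"
proof -
  have "\<exists>!T. bop T \<and> (\<forall>x y. ((\<lambda>i. hinner (A i (X (adj (A i) x))) y) has_sum hinner (T x) y) I)"
    using phi_ex[OF assms] phi_unique by blast
  from theI'[OF this] show ?thesis
    unfolding phiA_def .
qed

lemma bop_phi: "bop X \<Longrightarrow> bop (\<phi> X)"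
  using phi_spec by blast

lemma phi_has_sum:
  assumes "bop X"
  shows "((\<lambda>i. hinner (X (adj (A i) x)) (adj (A i) y)) has_sum hinner (\<phi> X x) y) I"
proof -
  have "((\<lambda>i. hinner (A i (X (adj (A i) x))) y) has_sum hinner (\<phi> X x) y) I"
    using phi_spec[OF assms] by blast
  then show ?thesis
    by (rule has_sum_cong[THEN iffD1, rotated]) (simp add: hinner_adj[OF bop_A])
qed

lemma phi_eqI:
  assumes "bop X" and T: "\<And>x y. ((\<lambda>i. hinner (X (adj (A i) x)) (adj (A i) y)) has_sum hinner (T x) y) I"
  shows "\<phi> X = T"
  by (rule hinner_eqI) (rule has_sum_unique[OF phi_has_sum[OF assms(1)] T])

lemma phi_add:
  assumes "bop X" "bop Y" shows "\<phi> (\<lambda>x. X x + Y x) = (\<lambda>x. \<phi> X x + \<phi> Y x)"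
  by (rule phi_eqI[OF bop_plus[OF assms]])
    (simp add: hinner_add_left has_sum_add[OF phi_has_sum phi_has_sum] assms)

lemma phi_scale:
  assumes "bop X" shows "\<phi> (\<lambda>x. hscale c (X x)) = (\<lambda>x. hscale c (\<phi> X x))"
  by (rule phi_eqI[OF bop_scaled[OF assms]])
    (simp add: hinner_scale_left has_sum_cmult_right[OF phi_has_sum] assms)

lemma phi_diff:
  assumes "bop X" "bop Y" shows "\<phi> (\<lambda>x. X x - Y x) = (\<lambda>x. \<phi> X x - \<phi> Y x)"
  using phi_add[OF assms(1) bop_scaled[OF assms(2)], of "-1"] phi_scale[OF assms(2), of "-1"]
  by (simp add: hscale_minus_left hscale_one)

lemma phi_zero: "\<phi> (\<lambda>x. 0) = (\<lambda>x. 0)"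
  by (rule phi_eqI[OF bop_zero_op]) simp

lemma phi_sum:
  "(\<And>j. j \<in> J \<Longrightarrow> bop (X j)) \<Longrightarrow> \<phi> (\<lambda>x. \<Sum>j\<in>J. X j x) = (\<lambda>x. \<Sum>j\<in>J. \<phi> (X j) x)"
proof (induction J rule: infinite_finite_induct)
  case (insert j J)
  then show ?case
    using phi_add[of "X j" "\<lambda>x. \<Sum>j\<in>J. X j x"] by (simp add: bop_sum_op)
qed (simp_all add: phi_zero)

lemma qform_phi_has_sum:
  "bop X \<Longrightarrow> ((\<lambda>i. qform X (adj (A i) x)) has_sum qform (\<phi> X) x) I"
  by (rule has_sum_Re[OF phi_has_sum])

lemma opos_phi: assumes "opos X" shows "opos (\<phi> X)"
  unfolding opos_def
proof (intro conjI allI)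
  show "bop (\<phi> X)"
    using assms by (simp add: bop_phi opos_def)
  fix x
  have "((\<lambda>i. Im (hinner (X (adj (A i) x)) (adj (A i) x))) has_sum Im (hinner (\<phi> X x) x)) I"
    by (rule has_sum_Im[OF phi_has_sum[OF opos_bop[OF assms]]])
  moreover have "Im (hinner (X u) u) = 0" for u
    using assms unfolding opos_def by blast
  ultimately have "((\<lambda>i. 0) has_sum Im (hinner (\<phi> X x) x)) I"
    by (simp only:)
  then show "Im (hinner (\<phi> X x) x) = 0"
    by (rule has_sum_unique) (rule has_sum_0, rule refl)
  show "0 \<le> qform (\<phi> X) x"
    by (rule has_sum_nonneg[OF qform_phi_has_sum[OF opos_bop[OF assms]] opos_nonneg[OF assms]])
qed

lemma qform_phi_ge:
  assumes "opos X" "finite J" "J \<subseteq> I"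
  shows "(\<Sum>i\<in>J. qform X (adj (A i) x)) \<le> qform (\<phi> X) x"
  by (rule finite_sum_le_has_sum[OF qform_phi_has_sum]) (use assms in \<open>auto simp: opos_def\<close>)

lemma qform_phi_le:
  assumes "bop X" "\<And>J. finite J \<Longrightarrow> J \<subseteq> I \<Longrightarrow> (\<Sum>i\<in>J. qform X (adj (A i) x)) \<le> r"
  shows "qform (\<phi> X) x \<le> r"
  by (rule has_sum_le_finite_sums[OF qform_phi_has_sum]) (use assms in auto)

lemma qform_phi_mono:
  assumes "bop X" "bop Y" "\<And>x. qform X x \<le> qform Y x" shows "qform (\<phi> X) x \<le> qform (\<phi> Y) x"
  by (rule has_sum_mono[OF qform_phi_has_sum qform_phi_has_sum]) (use assms in auto)

lemma bop_phi_pow: "bop X \<Longrightarrow> bop ((\<phi> ^^ k) X)"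
  by (induction k) (auto simp: bop_phi)

lemma opos_phi_pow: "opos X \<Longrightarrow> opos ((\<phi> ^^ k) X)"
  by (induction k) (auto simp: opos_phi)

lemma phi_pow_scale:
  "bop X \<Longrightarrow> (\<phi> ^^ k) (\<lambda>x. hscale c (X x)) = (\<lambda>x. hscale c ((\<phi> ^^ k) X x))"
  by (induction k) (auto simp: phi_scale bop_phi_pow)

lemma phi_pow_diff:
  "bop X \<Longrightarrow> bop Y \<Longrightarrow> (\<phi> ^^ k) (\<lambda>x. X x - Y x) = (\<lambda>x. (\<phi> ^^ k) X x - (\<phi> ^^ k) Y x)"
  by (induction k) (auto simp: phi_diff bop_phi_pow)

lemma qform_phi_pow_mono:
  "bop X \<Longrightarrow> bop Y \<Longrightarrow> (\<And>x. qform X x \<le> qform Y x) \<Longrightarrow> qform ((\<phi> ^^ k) X) x \<le> qform ((\<phi> ^^ k) Y) x"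
  by (induction k arbitrary: x) (simp_all add: qform_phi_mono bop_phi_pow)

text \<open>Serves twice: with \<open>q < 1\<close> it makes the powers die out, with
  \<open>q = 1\<close> it keeps them below \<open>R\<close>.\<close>

lemma qform_phi_pow_geometric:
  assumes R: "bop R" and q: "0 \<le> q" "\<And>x. qform (\<phi> R) x \<le> q * qform R x"
  shows "qform ((\<phi> ^^ k) R) x \<le> q ^ k * qform R x"
proof (induction k arbitrary: x)
  case (Suc k)
  have "qform (\<phi> ((\<phi> ^^ k) R)) x \<le> q ^ k * qform (\<phi> R) x"
    by (rule has_sum_mono[OF qform_phi_has_sum has_sum_cmult_right[OF qform_phi_has_sum]])
      (use Suc R in \<open>auto simp: bop_phi_pow\<close>)
  also have "\<dots> \<le> q ^ k * (q * qform R x)"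
    using q by (intro mult_left_mono) auto
  finally show ?case
    by (simp add: mult.left_commute mult.assoc)
qed simp

end

text \<open>The uniform boundedness principle is applied to the norms of the finite sections of the row.\<close>

lemma row_operator_ex:
  fixes A :: "nat \<Rightarrow> 'a::chilbert \<Rightarrow> 'a"
  assumes A: "\<And>i. i \<in> I \<Longrightarrow> bop (A i)"
    and sum: "\<And>x. (\<lambda>i. (hnorm (adj (A i) x))\<^sup>2) summable_on I"
  shows "\<exists>K. row_operator A I K"
proof -
  \<comment> \<open>The empty section is the default for inadmissible index sets, which lets the
    family in the boundedness principle range over a whole type.\<close>
  define F where "F J = (if finite J \<and> J \<subseteq> I then J else {})" for J
  define p where "p J x = L2_set (\<lambda>i. hnorm (adj (A i) x)) (F J)" for J x
  have F: "finite (F J)" "F J \<subseteq> I" for J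
    by (auto simp: F_def)
  have adjA: "bop (adj (A i))" if "i \<in> F J" for i J
    using that F A bop_adj by blast
  have "\<exists>K. \<forall>J x. p J x \<le> K * hnorm x"
  proof (rule uniform_boundedness)
    show "p J (x + y) \<le> p J x + p J y" for J x y
    proof -
      have "p J (x + y) \<le> L2_set (\<lambda>i. hnorm (adj (A i) x) + hnorm (adj (A i) y)) (F J)"
        unfolding p_def by (intro L2_set_mono) (simp_all add: bop_add[OF adjA[of _ J]] hnorm_triangle)
      also have "\<dots> \<le> p J x + p J y"
        unfolding p_def by (rule L2_set_triangle_ineq)
      finally show ?thesis .
    qed
    show "p J (hscale c x) = cmod c * p J x" for J c x
      unfolding p_def by (simp add: bop_scale[OF adjA[of _ J]] hnorm_scale L2_set_right_distrib cong: L2_set_cong_simp)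
    show "\<exists>K. \<forall>x. p J x \<le> K * hnorm x" for J
    proof -
      have "p J x \<le> (\<Sum>i\<in>F J. opnorm (adj (A i))) * hnorm x" for x
      proof -
        have "p J x \<le> (\<Sum>i\<in>F J. hnorm (adj (A i) x))"
          unfolding p_def by (rule L2_set_le_sum) simp
        also have "\<dots> \<le> (\<Sum>i\<in>F J. opnorm (adj (A i)) * hnorm x)"
          by (intro sum_mono hnorm_le_opnorm adjA)
        finally show ?thesis
          by (simp add: sum_distrib_right)
      qed
      then show ?thesis
        by blast
    qed
    show "\<exists>K. \<forall>J. p J x \<le> K" for x
    proof -
      have "p J x \<le> sqrt (\<Sum>\<^sub>\<infinity>i\<in>I. (hnorm (adj (A i) x))\<^sup>2)" for J
        unfolding p_def L2_set_def by (intro real_sqrt_le_mono finite_sum_le_infsum sum F) simp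
      then show ?thesis
        by blast
    qed
  qed
  then obtain K where K: "\<And>J x. p J x \<le> K * hnorm x"
    by blast
  have "row_operator A I (K\<^sup>2)"
  proof
    show "(\<Sum>i\<in>J. (hnorm (adj (A i) x))\<^sup>2) \<le> K\<^sup>2 * (hnorm x)\<^sup>2" if "finite J" "J \<subseteq> I" for J x
    proof -
      have "(p J x)\<^sup>2 \<le> (K * hnorm x)\<^sup>2"
        by (intro power_mono K) (simp add: p_def)
      then show ?thesis
        using that by (simp add: p_def F_def L2_set_def sum_nonneg power_mult_distrib)
    qed
  qed (use A in auto)
  then show ?thesis
    by blast
qed

section \<open>Weak cluster points of forms\<close>

text \<open>Tychonoff's theorem for the product of the discs of radius \<open>B b\<close>.\<close>

lemma pointwise_bounded_cluster:
  fixes f :: "'i \<Rightarrow> 'b \<Rightarrow> complex"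
  assumes F: "F \<noteq> bot" and bound: "\<And>b. eventually (\<lambda>i. norm (f i b) \<le> B b) F"
  shows "\<exists>G g. G \<le> F \<and> G \<noteq> bot \<and> (\<forall>b. ((\<lambda>i. f i b) \<longlongrightarrow> g b) G)"
proof -
  \<comment> \<open>The bounds hold only eventually. Overwriting violations by 0 keeps every
    \<open>h i\<close> in the compact product, and at each coordinate \<open>h\<close> eventually
    agrees with \<open>f\<close>.\<close>
  define h where "h i b = (if norm (f i b) \<le> B b then f i b else 0)" for i b
  define C where "C = PiE UNIV (\<lambda>b. cball (0::complex) \<bar>B b\<bar>)"
  have "compactin (product_topology (\<lambda>_. euclidean) UNIV) C"
    unfolding C_def compactin_PiE by simp
  then have "compact C"
    by (simp add: euclidean_product_topology)
  moreover have "filtermap h F \<noteq> bot"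
    using F by (simp add: filtermap_bot_iff)
  moreover have "eventually (\<lambda>x. x \<in> C) (filtermap h F)"
    unfolding eventually_filtermap
    by (intro always_eventually allI) (auto simp: C_def h_def intro: order_trans[OF _ abs_ge_self])
  ultimately obtain g where g: "inf (nhds g) (filtermap h F) \<noteq> bot"
    using compact_filter[THEN iffD1, rule_format, of C "filtermap h F"] by blast
  \<comment> \<open>Intersecting \<open>F\<close> with the preimages of neighbourhoods of the
    cluster point turns clustering into convergence.\<close>
  define G where "G = inf F (filtercomap h (nhds g))"
  have "G \<le> F"
    by (simp add: G_def)
  have "G \<noteq> bot"
  proof
    assume "G = bot"
    then have "eventually (\<lambda>_. False) G"
      by simp
    then obtain P Q where PQ: "eventually P F" "eventually Q (filtercomap h (nhds g))" "\<And>x. P x \<Longrightarrow> Q x \<Longrightarrow> False"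
      unfolding G_def eventually_inf by auto
    obtain Q' where Q': "eventually Q' (nhds g)" "\<And>x. Q' (h x) \<Longrightarrow> Q x"
      using PQ(2) unfolding eventually_filtercomap by blast
    have "eventually (\<lambda>y. \<not> Q' y) (filtermap h F)"
      unfolding eventually_filtermap using PQ(1) by (rule eventually_mono) (use PQ(3) Q'(2) in blast)
    with Q'(1) have "eventually (\<lambda>_. False) (inf (nhds g) (filtermap h F))"
      unfolding eventually_inf by (intro exI[of _ Q'] exI[of _ "\<lambda>y. \<not> Q' y"]) auto
    with g show False
      by (simp add: trivial_limit_def)
  qed
  have lim: "filterlim h (nhds g) G"
    unfolding G_def by (rule filterlim_mono[OF filterlim_filtercomap order_refl]) simp
  have "((\<lambda>i. f i b) \<longlongrightarrow> g b) G" for b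
  proof -
    have "continuous_on UNIV (\<lambda>x :: 'b \<Rightarrow> complex. x b)"
      by (rule continuous_on_product_coordinates)
    then have "((\<lambda>i. h i b) \<longlongrightarrow> g b) G"
      by (rule continuous_on_tendsto_compose[OF _ lim]) auto
    moreover have "eventually (\<lambda>i. h i b = f i b) G"
      using filter_leD[OF \<open>G \<le> F\<close> bound[of b]] by eventually_elim (simp add: h_def)
    ultimately show ?thesis
      by (rule Lim_transform_eventually)
  qed
  with \<open>G \<le> F\<close> \<open>G \<noteq> bot\<close> show ?thesis
    by blast
qed

text \<open>The condition \<open>\<phi> R \<le> R\<close> in a shape that survives pointwise limits:
  a form instead of an operator, finite sections of the row instead of \<open>phiA\<close>.\<close>

definition dominating_form ::
    "(nat \<Rightarrow> 'a::chilbert \<Rightarrow> 'a) \<Rightarrow> nat set \<Rightarrow> real \<Rightarrow> real \<Rightarrow> ('a \<Rightarrow> 'a \<Rightarrow> complex) \<Rightarrow> bool" where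
  "dominating_form A I a b M \<longleftrightarrow> hform M
     \<and> (\<forall>x. a * (hnorm x)\<^sup>2 \<le> Re (M x x) \<and> Re (M x x) \<le> b * (hnorm x)\<^sup>2)
     \<and> (\<forall>J x. finite J \<longrightarrow> J \<subseteq> I \<longrightarrow> (\<Sum>i\<in>J. Re (M (adj (A i) x) (adj (A i) x))) \<le> Re (M x x))"

text \<open>Compactness needs bounds on all pairs of vectors, while only the diagonal is controlled;
  polarization supplies the rest.\<close>

lemma hform_polarization_bound:
  assumes B: "hform B" and c: "\<And>z. z \<in> {x, y, x + y, x + hscale \<i> y} \<Longrightarrow> \<bar>Re (B z z)\<bar> \<le> c z"
  shows "cmod (B x y) \<le> c (x + y) + c (x + hscale \<i> y) + c x + c y"
proof -
  have "Re (B y x) = Re (B x y)" "Im (B y x) = - Im (B x y)"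
    using hform_commute[OF B, of y x] by auto
  then have "2 * Re (B x y) = Re (B (x + y) (x + y)) - Re (B x x) - Re (B y y)"
    "2 * Im (B x y) = Re (B (x + hscale \<i> y) (x + hscale \<i> y)) - Re (B x x) - Re (B y y)"
    by (simp_all add: hform_add[OF B] hform_add_right[OF B] hform_scale[OF B] hform_scale_right[OF B])
  then have "2 * \<bar>Re (B x y)\<bar> \<le> c (x + y) + c x + c y" "2 * \<bar>Im (B x y)\<bar> \<le> c (x + hscale \<i> y) + c x + c y"
    using c[of x] c[of y] c[of "x + y"] c[of "x + hscale \<i> y"] by (auto simp: abs_le_iff)
  then show ?thesis
    using cmod_le[of "B x y"] c[of x] c[of y] c[of "x + y"] c[of "x + hscale \<i> y"] by simp
qed

text \<open>The limiting step shared by both directions: once for Cesaro means, with a domination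
  error tending to 0, and once for forms that meet finitely many constraints, with bounds valid only
  eventually.\<close>

lemma dominating_form_cluster:
  fixes m :: "'i \<Rightarrow> 'a::chilbert \<Rightarrow> 'a \<Rightarrow> complex"
  assumes F: "F \<noteq> bot" and m: "\<And>i. hform (m i)"
    and bound: "\<And>x. eventually (\<lambda>i. a * (hnorm x)\<^sup>2 \<le> Re (m i x x) \<and> Re (m i x x) \<le> b * (hnorm x)\<^sup>2) F"
    and dom: "\<And>J x. finite J \<Longrightarrow> J \<subseteq> I \<Longrightarrow>
      \<exists>e. (e \<longlongrightarrow> 0) F \<and> eventually (\<lambda>i. (\<Sum>j\<in>J. Re (m i (adj (A j) x) (adj (A j) x))) \<le> Re (m i x x) + e i) F"
  shows "\<exists>M. dominating_form A I a b M"
proof -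
  define c where "c x = max \<bar>a\<bar> \<bar>b\<bar> * (hnorm (x :: 'a))\<^sup>2" for x
  have c: "eventually (\<lambda>i. \<bar>Re (m i x x)\<bar> \<le> c x) F" for x
    using bound[of x]
  proof eventually_elim
    case (elim i)
    have "- \<bar>a\<bar> * (hnorm x)\<^sup>2 \<le> a * (hnorm x)\<^sup>2" "b * (hnorm x)\<^sup>2 \<le> \<bar>b\<bar> * (hnorm x)\<^sup>2"
      "\<bar>a\<bar> * (hnorm x)\<^sup>2 \<le> c x" "\<bar>b\<bar> * (hnorm x)\<^sup>2 \<le> c x"
      unfolding c_def by (intro mult_right_mono; simp)+
    with elim show ?case
      by (simp add: abs_le_iff)
  qed
  define B where "B p = (case p of (x, y) \<Rightarrow> c (x + y) + c (x + hscale \<i> y) + c x + c y)" for p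
  have "eventually (\<lambda>i. norm (case_prod (m i) p) \<le> B p) F" for p
  proof -
    obtain x y where p: "p = (x, y)"
      by force
    from c[of x] c[of y] c[of "x + y"] c[of "x + hscale \<i> y"] show ?thesis
    proof eventually_elim
      case (elim i)
      then have "cmod (m i x y) \<le> c (x + y) + c (x + hscale \<i> y) + c x + c y"
        by (intro hform_polarization_bound[OF m]) auto
      then show ?case
        by (simp add: p B_def)
    qed
  qed
  from pointwise_bounded_cluster[of F "\<lambda>i. case_prod (m i)" B, OF F this] obtain G g
    where G: "G \<le> F" "G \<noteq> bot" "\<And>p. ((\<lambda>i. case_prod (m i) p) \<longlongrightarrow> g p) G"
    by blast
  define M where "M x y = g (x, y)" for x y
  have lim: "((\<lambda>i. m i x y) \<longlongrightarrow> M x y) G" for x y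
    using G(3)[of "(x, y)"] by (simp add: M_def)
  have hM: "hform M"
    unfolding hform_def
  proof (intro conjI allI)
    show "M (x + y) z = M x z + M y z" for x y z
      using tendsto_add[OF lim[of x z] lim[of y z]] lim[of "x + y" z]
      by (simp add: hform_add[OF m] tendsto_unique[OF G(2)])
    show "M (hscale c x) y = c * M x y" for c x y
      using tendsto_mult_left[OF lim[of x y], of c] lim[of "hscale c x" y]
      by (simp add: hform_scale[OF m] tendsto_unique[OF G(2)])
    show "M y x = cnj (M x y)" for x y
    proof (rule tendsto_unique[OF G(2) lim])
      show "((\<lambda>i. m i y x) \<longlongrightarrow> cnj (M x y)) G"
        using tendsto_cnj[OF lim[of x y]] hform_commute[OF m, of _ y x] by (simp only:)
    qed
  qed
  have limRe: "((\<lambda>i. Re (m i x x)) \<longlongrightarrow> Re (M x x)) G" for x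
    by (rule tendsto_Re[OF lim])
  have ev: "eventually P G" if "eventually P F" for P
    by (rule filter_leD[OF G(1) that])
  have "a * (hnorm x)\<^sup>2 \<le> Re (M x x)" for x
    by (rule tendsto_lowerbound[OF limRe _ G(2)]) (use ev[OF bound[of x]] in \<open>auto elim: eventually_mono\<close>)
  moreover have "Re (M x x) \<le> b * (hnorm x)\<^sup>2" for x
    by (rule tendsto_upperbound[OF limRe _ G(2)]) (use ev[OF bound[of x]] in \<open>auto elim: eventually_mono\<close>)
  moreover have "(\<Sum>j\<in>J. Re (M (adj (A j) x) (adj (A j) x))) \<le> Re (M x x)" if J: "finite J" "J \<subseteq> I" for J x
  proof -
    obtain e where e: "(e \<longlongrightarrow> 0) F"
      "eventually (\<lambda>i. (\<Sum>j\<in>J. Re (m i (adj (A j) x) (adj (A j) x))) \<le> Re (m i x x) + e i) F"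
      using dom[OF J] by blast
    have "((\<lambda>i. Re (m i x x) + e i) \<longlongrightarrow> Re (M x x) + 0) G"
      by (intro tendsto_add limRe tendsto_mono[OF G(1) e(1)])
    moreover have "((\<lambda>i. \<Sum>j\<in>J. Re (m i (adj (A j) x) (adj (A j) x))) \<longlongrightarrow> (\<Sum>j\<in>J. Re (M (adj (A j) x) (adj (A j) x)))) G"
      by (intro tendsto_sum limRe)
    ultimately have "(\<Sum>j\<in>J. Re (M (adj (A j) x) (adj (A j) x))) \<le> Re (M x x) + 0"
      by (rule tendsto_le[OF G(2) _ _ ev[OF e(2)]])
    then show ?thesis
      by simp
  qed
  ultimately show ?thesis
    unfolding dominating_form_def using hM by blast
qed

context row_operator
begin

text \<open>A bound on all finite sections is a bound on the infinite sum, so the sectionwise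
  domination becomes \<open>\<phi> R \<le> R\<close>; the lower bound \<open>a\<close> makes
  \<open>R\<close> invertible.\<close>

lemma dominating_form_operator:
  assumes M: "dominating_form A I a b M" and a: "0 < a"
  obtains R where "opos R" "\<And>x. a * (hnorm x)\<^sup>2 \<le> qform R x" "\<And>x. qform R x \<le> b * (hnorm x)\<^sup>2"
    "oinvertible R" "ople (\<phi> R) R"
proof -
  have hM: "hform M" and low: "a * (hnorm x)\<^sup>2 \<le> Re (M x x)" and up: "Re (M x x) \<le> b * (hnorm x)\<^sup>2"
    and dom: "finite J \<Longrightarrow> J \<subseteq> I \<Longrightarrow> (\<Sum>i\<in>J. Re (M (adj (A i) x) (adj (A i) x))) \<le> Re (M x x)" for x J
    using M unfolding dominating_form_def by blast+
  have pos: "0 \<le> Re (M x x)" for x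
    using low[of x] a by (smt (verit) mult_nonneg_nonneg zero_le_power2)
  have up': "Re (M x x) \<le> \<bar>b\<bar> * (hnorm x)\<^sup>2" for x
    by (rule order_trans[OF up]) (simp add: mult_right_mono)
  have "cmod (M x y) \<le> \<bar>b\<bar> * hnorm x * hnorm y" for x y
  proof -
    have "(cmod (M x y))\<^sup>2 \<le> Re (M x x) * Re (M y y)"
      by (rule hform_Cauchy_Schwarz[OF hM pos])
    also have "\<dots> \<le> (\<bar>b\<bar> * (hnorm x)\<^sup>2) * (\<bar>b\<bar> * (hnorm y)\<^sup>2)"
      by (intro mult_mono up' pos mult_nonneg_nonneg) auto
    also have "\<dots> = (\<bar>b\<bar> * hnorm x * hnorm y)\<^sup>2"
      by (simp add: power2_eq_square)
    finally show ?thesis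
      by (rule power2_le_imp_le) simp
  qed
  then obtain R where R: "bop R" "\<And>x y. hinner (R x) y = M x y"
    using sesq_op[OF hform_sesq[OF hM]] by (metis abs_ge_zero)
  have oR: "opos R"
    unfolding opos_def using R pos hform_Im[OF hM] by simp
  have low': "a * (hnorm x)\<^sup>2 \<le> qform R x" for x
    using low by (simp add: R)
  have "qform (\<phi> R) x \<le> qform R x" for x
    by (rule qform_phi_le[OF R(1)]) (use dom in \<open>simp add: R\<close>)
  then have "ople (\<phi> R) R"
    using ople_iff[OF opos_phi[OF oR] oR] by blast
  moreover have "qform R x \<le> b * (hnorm x)\<^sup>2" for x
    using up by (simp add: R)
  ultimately show ?thesis
    using that[OF oR low'] coercive_invertible[OF oR a low'] by blast
qed

lemma cond_iii_dominating_form: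
  assumes "cond_iii A I a b D"
  shows "\<exists>M. dominating_form A I a b M"
proof -
  have D: "opos D"
    using assms by (simp add: cond_iii_def)
  define T where "T k x = (\<Sum>j<k. (\<phi> ^^ j) D x) + (\<phi> ^^ k) opid x" for k x
  have oT: "opos (T k)" for k
    unfolding T_def by (intro opos_add opos_sum opos_phi_pow D opos_opid)
  have qT: "a * (hnorm x)\<^sup>2 \<le> qform (T k) x" "qform (T k) x \<le> b * (hnorm x)\<^sup>2" if "k \<ge> 1" for k x
  proof -
    have ab: "0 \<le> a" "0 \<le> b"
      using assms by (auto simp: cond_iii_def)
    have "ople (opscal a) (T k)" "ople (T k) (opscal b)"
      using assms that unfolding cond_iii_def T_def by blast+
    then show "a * (hnorm x)\<^sup>2 \<le> qform (T k) x" "qform (T k) x \<le> b * (hnorm x)\<^sup>2"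
      using ople_iff[OF opos_opscal[OF ab(1)] oT] ople_iff[OF oT opos_opscal[OF ab(2)]]
      by (auto simp: opscal_def hinner_scale_left hinner_self)
  qed
  \<comment> \<open>The recursion \<open>T (Suc k) = D + \<phi> (T k)\<close>, read on the
    diagonal.\<close>
  have phiT: "qform (\<phi> (T k)) x = qform (T (Suc k)) x - qform D x" for k x
  proof -
    have "\<phi> (T k) = (\<lambda>x. (\<Sum>j<k. (\<phi> ^^ Suc j) D x) + (\<phi> ^^ Suc k) opid x)"
      unfolding T_def
      by (subst phi_add)
        (simp_all add: bop_sum_op bop_phi_pow bop_opid opos_bop[OF D] phi_sum[OF bop_phi_pow[OF opos_bop[OF D]]])
    moreover have "T (Suc k) x = D x + ((\<Sum>j<k. (\<phi> ^^ Suc j) D x) + (\<phi> ^^ Suc k) opid x)"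
      unfolding T_def sum.lessThan_Suc_shift by (simp add: add.assoc)
    ultimately show ?thesis
      by (simp add: hinner_add_left)
  qed
  \<comment> \<open>The means begin at \<open>T 1\<close>, since the bounds in (iii) are asked for
    \<open>k \<ge> 1\<close> only.\<close>
  define m where "m n x = hscale (complex_of_real (1 / real (Suc n))) (\<Sum>k<Suc n. T (Suc k) x)" for n x
  have om: "opos (m n)" for n
    unfolding m_def by (intro opos_scaled opos_sum oT) simp
  have qm: "qform (m n) x = (\<Sum>k<Suc n. qform (T (Suc k)) x) / real (Suc n)" for n x
    by (simp add: m_def hinner_scale_left hinner_sum_left del: sum.lessThan_Suc of_nat_Suc)
  show ?thesis
  proof (rule dominating_form_cluster[where F=sequentially and m="\<lambda>n x y. hinner (m n x) y"])
    show "hform (\<lambda>x y. hinner (m n x) y)" for n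
      by (rule opos_hform[OF om])
    show "eventually (\<lambda>n. a * (hnorm x)\<^sup>2 \<le> qform (m n) x \<and> qform (m n) x \<le> b * (hnorm x)\<^sup>2) sequentially" for x
    proof (intro always_eventually allI conjI)
      fix n
      have "(\<Sum>k<Suc n. a * (hnorm x)\<^sup>2) \<le> (\<Sum>k<Suc n. qform (T (Suc k)) x)"
        "(\<Sum>k<Suc n. qform (T (Suc k)) x) \<le> (\<Sum>k<Suc n. b * (hnorm x)\<^sup>2)"
        by (intro sum_mono qT; simp)+
      then show "a * (hnorm x)\<^sup>2 \<le> qform (m n) x" "qform (m n) x \<le> b * (hnorm x)\<^sup>2"
        by (simp_all add: qm pos_le_divide_eq pos_divide_le_eq mult.commute del: sum.lessThan_Suc of_nat_Suc)
    qed
    show "\<exists>e. e \<longlonglongrightarrow> 0 \<and> eventually (\<lambda>n. (\<Sum>j\<in>J. qform (m n) (adj (A j) x)) \<le> qform (m n) x + e n) sequentially"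
      if J: "finite J" "J \<subseteq> I" for J x
    proof (intro exI conjI always_eventually allI)
      show "(\<lambda>n. (b - a) * (hnorm x)\<^sup>2 / real (Suc n)) \<longlonglongrightarrow> 0"
        by (rule LIMSEQ_Suc[OF lim_const_over_n])
      fix n
      have "(\<Sum>j\<in>J. qform (m n) (adj (A j) x)) \<le> qform (\<phi> (m n)) x"
        by (rule qform_phi_ge[OF om J])
      also have "qform (\<phi> (m n)) x = qform (\<lambda>x. hscale (complex_of_real (1 / real (Suc n))) (\<Sum>k<Suc n. \<phi> (T (Suc k)) x)) x"
        unfolding m_def
        by (subst phi_scale)
          (simp_all add: bop_sum_op opos_bop[OF oT] phi_sum[OF opos_bop[OF oT]] del: sum.lessThan_Suc)
      also have "qform (\<lambda>x. hscale (complex_of_real (1 / real (Suc n))) (\<Sum>k<Suc n. \<phi> (T (Suc k)) x)) x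
          = (\<Sum>k<Suc n. qform (T (Suc (Suc k))) x - qform D x) / real (Suc n)"
        by (simp add: hinner_scale_left hinner_sum_left phiT del: sum.lessThan_Suc of_nat_Suc)
      also have "\<dots> \<le> ((\<Sum>k<Suc n. qform (T (Suc k)) x) + (b - a) * (hnorm x)\<^sup>2) / real (Suc n)"
      proof (rule divide_right_mono)
        have "(\<Sum>k<Suc n. qform (T (Suc (Suc k))) x - qform D x) \<le> (\<Sum>k<Suc n. qform (T (Suc (Suc k))) x)"
          by (intro sum_mono) (use opos_nonneg[OF D] in auto)
        \<comment> \<open>\<open>\<phi>\<close> shifts the window of the average by one. Only the
          two end terms differ, and both lie between \<open>a\<close> and \<open>b\<close>; this is
          the origin of the error \<open>b - a\<close>.\<close>
        moreover have "(\<Sum>k<Suc n. qform (T (Suc (Suc k))) x)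
            = (\<Sum>k<Suc n. qform (T (Suc k)) x) + (qform (T (Suc (Suc n))) x - qform (T 1) x)"
          using sum_lessThan_telescope[of "\<lambda>k. qform (T (Suc k)) x" "Suc n"]
          by (simp add: sum_subtractf del: sum.lessThan_Suc)
        ultimately show "(\<Sum>k<Suc n. qform (T (Suc (Suc k))) x - qform D x)
            \<le> (\<Sum>k<Suc n. qform (T (Suc k)) x) + (b - a) * (hnorm x)\<^sup>2"
          using qT(2)[of "Suc (Suc n)" x] qT(1)[of 1 x] by (simp add: left_diff_distrib del: sum.lessThan_Suc)
      qed simp
      finally show "(\<Sum>j\<in>J. qform (m n) (adj (A j) x)) \<le> qform (m n) x + (b - a) * (hnorm x)\<^sup>2 / real (Suc n)"
        by (simp add: qm add_divide_distrib del: sum.lessThan_Suc of_nat_Suc)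
    qed
  qed simp
qed

end

section \<open>Similarity\<close>

lemma l2seq_bop: assumes "bop T" "l2seq x" shows "l2seq (\<lambda>k. T (x k))"
proof -
  have "summable (\<lambda>k. (opnorm T)\<^sup>2 * (hnorm (x k))\<^sup>2)"
    using assms(2) unfolding l2seq_def by (rule summable_mult)
  moreover have "norm ((hnorm (T (x k)))\<^sup>2) \<le> (opnorm T)\<^sup>2 * (hnorm (x k))\<^sup>2" for k
    using power_mono[OF hnorm_le_opnorm[OF assms(1), of "x k"] hnorm_nonneg, of 2]
    by (simp add: power_mult_distrib)
  ultimately show ?thesis
    unfolding l2seq_def by (rule summable_comparison_test')
qed

text \<open>Conjugation can be moved onto the sequences of the functionals: \<open>Q\<close> acts on
  those of the target, \<open>S\<close> on those of the finitely many test functionals. Bounded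
  operators preserve square summability.\<close>

lemma wstar_cont_conj:
  assumes f: "wstar_cont f" and S: "bop S" and Q: "bop Q"
  shows "wstar_cont (\<lambda>X x. adj Q (f (\<lambda>y. adj S (X (S y))) (Q x)))"
  unfolding wstar_cont_def
proof (intro allI impI, elim conjE)
  fix X0 :: "'a \<Rightarrow> 'a" and x y :: "nat \<Rightarrow> 'a" and e :: real
  assume X0: "bop X0" and xy: "l2seq x" "l2seq y" and e: "e > 0"
  define C where "C X = (\<lambda>z. adj S (X (S z)))" for X :: "'a \<Rightarrow> 'a"
  have bC: "bop X \<Longrightarrow> bop (C X)" for X
    unfolding C_def by (rule bop_comp[OF bop_adj[OF S] bop_comp[OF _ S]])
  have uwC: "uw u v (C X) = uw (\<lambda>k. S (u k)) (\<lambda>k. S (v k)) X" for u v X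
    by (simp add: uw_def C_def hinner_adj'[OF S])
  have uwQ: "uw x y (\<lambda>z. adj Q (f Y (Q z))) = uw (\<lambda>k. Q (x k)) (\<lambda>k. Q (y k)) (f Y)" for Y
    by (simp add: uw_def hinner_adj'[OF Q])
  obtain F d where F: "finite F" "d > 0" "\<forall>(u, v)\<in>F. l2seq u \<and> l2seq v"
    and cont: "\<And>X. bop X \<Longrightarrow> \<forall>(u, v)\<in>F. cmod (uw u v X - uw u v (C X0)) < d \<Longrightarrow>
      cmod (uw (\<lambda>k. Q (x k)) (\<lambda>k. Q (y k)) (f X) - uw (\<lambda>k. Q (x k)) (\<lambda>k. Q (y k)) (f (C X0))) < e"
  proof -
    have "bop (C X0) \<and> l2seq (\<lambda>k. Q (x k)) \<and> l2seq (\<lambda>k. Q (y k)) \<and> e > 0"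
      using bC[OF X0] l2seq_bop[OF Q xy(1)] l2seq_bop[OF Q xy(2)] e by simp
    from f[unfolded wstar_cont_def, THEN spec, THEN spec, THEN spec, THEN spec, THEN mp, OF this]
    show ?thesis
      by (elim exE conjE) (rule that, assumption+, drule spec, erule mp, rule conjI)
  qed
  define F' where "F' = (\<lambda>(u, v). (\<lambda>k. S (u k), \<lambda>k. S (v k))) ` F"
  show "\<exists>F d. finite F \<and> d > 0 \<and> (\<forall>(u, v)\<in>F. l2seq u \<and> l2seq v) \<and>
      (\<forall>X. bop X \<and> (\<forall>(u, v)\<in>F. cmod (uw u v X - uw u v X0) < d) \<longrightarrow>
        cmod (uw x y (\<lambda>x. adj Q (f (\<lambda>y. adj S (X (S y))) (Q x)))
          - uw x y (\<lambda>x. adj Q (f (\<lambda>y. adj S (X0 (S y))) (Q x)))) < e)"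
  proof (intro exI[of _ F'] exI[of _ d] conjI allI impI)
    show "finite F'" "d > 0"
      using F by (auto simp: F'_def)
    show "\<forall>(u, v)\<in>F'. l2seq u \<and> l2seq v"
      using F(3) by (auto simp: F'_def intro: l2seq_bop[OF S])
    fix X assume "bop X \<and> (\<forall>(u, v)\<in>F'. cmod (uw u v X - uw u v X0) < d)"
    then have X: "bop (C X)" "\<forall>(u, v)\<in>F. cmod (uw u v (C X) - uw u v (C X0)) < d"
      by (auto simp: F'_def uwC bC)
    show "cmod (uw x y (\<lambda>x. adj Q (f (\<lambda>y. adj S (X (S y))) (Q x)))
          - uw x y (\<lambda>x. adj Q (f (\<lambda>y. adj S (X0 (S y))) (Q x)))) < e"
      using cont[OF X] unfolding uwQ[symmetric] C_def .
  qed
qed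

lemma blockpos_conj:
  assumes "bop S" "blockpos k X" shows "blockpos k (\<lambda>i j x. adj S (X i j (S x)))"
  unfolding blockpos_def
proof (rule allI)
  fix h :: "nat \<Rightarrow> 'a"
  have "(\<Sum>i<k. \<Sum>j<k. hinner (adj S (X i j (S (h j)))) (h i)) = (\<Sum>i<k. \<Sum>j<k. hinner (X i j (S (h j))) (S (h i)))"
    by (simp add: hinner_adj'[OF assms(1)])
  then show "Im (\<Sum>i<k. \<Sum>j<k. hinner (adj S (X i j (S (h j)))) (h i)) = 0 \<and>
      0 \<le> Re (\<Sum>i<k. \<Sum>j<k. hinner (adj S (X i j (S (h j)))) (h i))"
    using assms(2)[unfolded blockpos_def, THEN spec, of "\<lambda>i. S (h i)"] by (simp only:)
qed

lemma cp_map_bop: "cp_map f \<Longrightarrow> bop X \<Longrightarrow> bop (f X)"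
  and cp_map_add: "cp_map f \<Longrightarrow> bop X \<Longrightarrow> bop Y \<Longrightarrow> f (\<lambda>x. X x + Y x) = (\<lambda>x. f X x + f Y x)"
  and cp_map_scale: "cp_map f \<Longrightarrow> bop X \<Longrightarrow> f (\<lambda>x. hscale c (X x)) = (\<lambda>x. hscale c (f X x))"
  and cp_map_blockpos: "cp_map f \<Longrightarrow> (\<And>i j. i < k \<Longrightarrow> j < k \<Longrightarrow> bop (Z i j)) \<Longrightarrow> blockpos k Z \<Longrightarrow>
    blockpos k (\<lambda>i j. f (Z i j))"
  unfolding cp_map_def lin_map_def by simp_all

lemma cp_map_conj:
  assumes f: "cp_map f" and S: "bop S" and Q: "bop Q"
  shows "cp_map (\<lambda>X x. adj Q (f (\<lambda>y. adj S (X (S y))) (Q x)))"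
proof -
  define C where "C X = (\<lambda>z. adj S (X (S z)))" for X :: "'a \<Rightarrow> 'a"
  have bC: "bop X \<Longrightarrow> bop (C X)" for X
    unfolding C_def by (rule bop_comp[OF bop_adj[OF S] bop_comp[OF _ S]])
  have Cadd: "C (\<lambda>x. X x + Y x) = (\<lambda>x. C X x + C Y x)" for X Y
    by (simp add: C_def bop_add[OF bop_adj[OF S]])
  have Cscale: "C (\<lambda>x. hscale c (X x)) = (\<lambda>x. hscale c (C X x))" for c X
    by (simp add: C_def bop_scale[OF bop_adj[OF S]])
  have "lin_map (\<lambda>X x. adj Q (f (C X) (Q x)))"
    unfolding lin_map_def
  proof (intro conjI allI impI)
    show "bop (\<lambda>x. adj Q (f (C X) (Q x)))" if "bop X" for X
      by (rule bop_comp[OF bop_adj[OF Q] bop_comp[OF cp_map_bop[OF f bC[OF that]] Q]])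
    show "(\<lambda>x. adj Q (f (C (\<lambda>x. X x + Y x)) (Q x))) = (\<lambda>x. adj Q (f (C X) (Q x)) + adj Q (f (C Y) (Q x)))"
      if "bop X" "bop Y" for X Y
      using that by (simp add: Cadd cp_map_add[OF f] bC bop_add[OF bop_adj[OF Q]])
    show "(\<lambda>x. adj Q (f (C (\<lambda>x. hscale c (X x))) (Q x))) = (\<lambda>x. hscale c (adj Q (f (C X) (Q x))))"
      if "bop X" for X c
      using that by (simp add: Cscale cp_map_scale[OF f] bC bop_scale[OF bop_adj[OF Q]])
  qed
  moreover have "blockpos k (\<lambda>i j x. adj Q (f (C (X i j)) (Q x)))"
    if "\<forall>i<k. \<forall>j<k. bop (X i j)" "blockpos k X" for k X
  proof -
    have "blockpos k (\<lambda>i j. C (X i j))"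
      unfolding C_def by (rule blockpos_conj[OF S that(2)])
    then have "blockpos k (\<lambda>i j. f (C (X i j)))"
      by (rule cp_map_blockpos[OF f, rotated]) (use that(1) bC in blast)
    then show ?thesis
      by (rule blockpos_conj[OF Q])
  qed
  ultimately show ?thesis
    unfolding cp_map_def C_def by blast
qed

lemma cp_map_opos: assumes "cp_map f" "opos X" shows "opos (f X)"
proof -
  have "blockpos 1 (\<lambda>i j. X)"
    using assms(2) by (simp add: blockpos_def opos_def)
  then have "blockpos 1 (\<lambda>i j. f X)" "bop (f X)"
    using cp_map_blockpos[OF assms(1), of 1 "\<lambda>i j. X"] cp_map_bop[OF assms(1)] opos_bop[OF assms(2)] by simp_all
  then show ?thesis
    unfolding opos_def
  proof (intro conjI allI)
    show "Im (hinner (f X x) x) = 0" "0 \<le> qform (f X) x" for x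
      using \<open>blockpos 1 (\<lambda>i j. f X)\<close>[unfolded blockpos_def, rule_format, of "\<lambda>_. x"] by simp_all
  qed
qed

context row_operator
begin

text \<open>If \<open>V\<close> implements the similarity, take \<open>R x = V (adj V x)\<close>.
  Then \<open>\<phi> R\<close> is \<open>\<psi> opid\<close> conjugated by \<open>V\<close>, and the
  positive operator \<open>\<psi> opid\<close> of norm at most 1 lies below the identity.\<close>

lemma similar_imp_superharmonic:
  assumes cp: "cp_map \<psi>" and contr: "\<And>X. bop X \<Longrightarrow> opnorm (\<psi> X) \<le> opnorm X" and sim: "similar \<phi> \<psi>"
  shows "\<exists>R. opos R \<and> oinvertible R \<and> ople (\<phi> R) R"
proof -
  obtain V where "oinvertible V" and V: "\<And>X. bop X \<Longrightarrow> \<phi> (V \<circ> X \<circ> adj V) = V \<circ> \<psi> X \<circ> adj V"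
    using sim unfolding similar_def by blast
  then obtain W where W: "bop V" "bop W" "\<And>x. V (W x) = x" "\<And>x. W (V x) = x"
    unfolding oinvertible_def by (metis comp_apply id_apply)
  define R where "R x = V (adj V x)" for x
  have bR: "bop R"
    unfolding R_def by (rule bop_comp[OF W(1) bop_adj[OF W(1)]])
  have qR: "hinner (R x) x = complex_of_real ((hnorm (adj V x))\<^sup>2)" for x
    by (simp add: R_def hinner_adj[OF W(1)] hinner_self)
  have oR: "opos R"
    unfolding opos_def using bR by (simp add: qR)
  have adjVW: "adj V (adj W x) = x" "adj W (adj V x) = x" for x
    using fun_cong[OF adj_comp[OF W(2,1)], of x] fun_cong[OF adj_comp[OF W(1,2)], of x] by (simp_all add: W adj_id)
  have "oinvertible R"
    unfolding oinvertible_def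
    by (intro conjI exI[of _ "\<lambda>x. adj W (W x)"] bop_comp[OF bop_adj[OF W(2)] W(2)] bR)
      (simp_all add: fun_eq_iff R_def adjVW W)
  moreover have "ople (\<phi> R) R"
  proof -
    define P where "P = \<psi> opid"
    have oP: "opos P"
      unfolding P_def by (rule cp_map_opos[OF cp opos_opid])
    have "opnorm P \<le> 1"
      unfolding P_def by (rule order_trans[OF contr[OF bop_opid] opnorm_le]) (simp_all add: opid_def)
    then have P: "qform P z \<le> (hnorm z)\<^sup>2" for z
    proof -
      have "qform P z \<le> hnorm (P z) * hnorm z"
        using hinner_Cauchy_Schwarz[of "P z" z] complex_Re_le_cmod[of "hinner (P z) z"] by linarith
      also have "\<dots> \<le> (opnorm P * hnorm z) * hnorm z"
        by (intro mult_right_mono hnorm_le_opnorm opos_bop[OF oP]) simp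
      also have "\<dots> \<le> (1 * hnorm z) * hnorm z"
        using \<open>opnorm P \<le> 1\<close> by (intro mult_right_mono) auto
      finally show ?thesis
        by (simp add: power2_eq_square)
    qed
    have "V \<circ> opid \<circ> adj V = R"
      by (simp add: fun_eq_iff R_def opid_def)
    then have "\<phi> R = V \<circ> P \<circ> adj V"
      using V[OF bop_opid] by (simp add: P_def)
    then have "qform (\<phi> R) x \<le> qform R x" for x
      using P[of "adj V x"] by (simp add: qR hinner_adj[OF W(1)])
    then show ?thesis
      using ople_iff[OF opos_phi[OF oR] oR] by blast
  qed
  ultimately show ?thesis
    using oR by blast
qed

text \<open>\<open>\<psi>\<close> is \<open>\<phi>\<close> conjugated by the root \<open>S\<close>
  of \<open>R\<close> and its inverse \<open>Q\<close>. The inequality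
  \<open>\<phi> R \<le> R\<close> says that the operators taking \<open>z\<close> to
  \<open>S (adj (A i) (Q z))\<close> form a contractive column, and Cauchy-Schwarz over
  \<open>i\<close> bounds \<open>\<psi> X\<close> by the norm of \<open>X\<close>.\<close>

lemma superharmonic_imp_similar:
  assumes cp: "cp_map \<phi>" and cont: "wstar_cont \<phi>"
    and R: "opos R" "oinvertible R" "ople (\<phi> R) R"
  shows "\<exists>\<psi>. cp_map \<psi> \<and> wstar_cont \<psi> \<and> (\<forall>X. bop X \<longrightarrow> opnorm (\<psi> X) \<le> opnorm X) \<and> similar \<phi> \<psi>"
proof -
  obtain e where e: "0 < e" "\<And>x. e * (hnorm x)\<^sup>2 \<le> qform R x"
    using opos_invertible_coercive[OF R(1,2)] by blast
  obtain S where S: "bop S" "\<And>x y. hinner (S x) y = hinner x (S y)" "\<And>x. S (S x) = R x" "oinvertible S"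
    using sqrt_coercive[OF R(1) e] by blast
  obtain Q where Q: "bop Q" "\<And>x. S (Q x) = x" "\<And>x. Q (S x) = x"
    using S(4) unfolding oinvertible_def by (metis comp_apply id_apply)
  have adjS: "adj S = S"
    by (rule adj_unique[OF S(1,2)])
  have adjQ: "adj Q = Q"
  proof (rule adj_unique[OF Q(1)])
    show "hinner (Q x) y = hinner x (Q y)" for x y
      using S(2)[of "Q x" "Q y"] by (simp add: Q)
  qed
  define \<psi> where "\<psi> X x = adj Q (\<phi> (\<lambda>y. adj S (X (S y))) (Q x))" for X x
  have le: "qform (\<phi> R) x \<le> qform R x" for x
    using R(3) ople_iff[OF opos_phi[OF R(1)] R(1)] by blast
  have "opnorm (\<psi> X) \<le> opnorm X" if X: "bop X" for X
  proof (rule opnorm_le[OF opnorm_nonneg[OF X] hinner_bound_le])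
    show "0 \<le> opnorm X * hnorm x" for x
      using opnorm_nonneg[OF X] by simp
    fix x y
    have bSXS: "bop (\<lambda>y. S (X (S y)))"
      by (rule bop_comp[OF S(1) bop_comp[OF X S(1)]])
    let ?f = "\<lambda>i. hinner (S (X (S (adj (A i) (Q x))))) (adj (A i) (Q y))"
    have sum: "(?f has_sum hinner (\<phi> (\<lambda>y. S (X (S y))) (Q x)) (Q y)) I"
      by (rule phi_has_sum[OF bSXS])
    have bound: "(\<Sum>i\<in>J. (hnorm (S (adj (A i) (Q z))))\<^sup>2) \<le> (hnorm z)\<^sup>2" if "finite J" "J \<subseteq> I" for J z
    proof -
      have "(\<Sum>i\<in>J. (hnorm (S (adj (A i) (Q z))))\<^sup>2) = (\<Sum>i\<in>J. qform R (adj (A i) (Q z)))"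
        by (simp add: hnorm_sq S(2)) (simp add: S(3) opos_selfadj[OF R(1)])
      also have "\<dots> \<le> qform R (Q z)"
        using qform_phi_ge[OF R(1) that] le by (rule order_trans)
      also have "\<dots> = (hnorm z)\<^sup>2"
        by (simp add: hnorm_sq S(2)[of _ "Q z"] Q flip: S(3))
      finally show ?thesis .
    qed
    have "cmod (?f i) \<le> opnorm X * (hnorm (S (adj (A i) (Q x))) * hnorm (S (adj (A i) (Q y))))" for i
      using order_trans[OF hinner_Cauchy_Schwarz mult_right_mono[OF hnorm_le_opnorm[OF X] hnorm_nonneg]]
      by (simp add: mult.assoc S(2)[of "X _"])
    from summable_Cauchy_Schwarz(2)[OF this opnorm_nonneg[OF X] hnorm_nonneg bound hnorm_nonneg bound, of I]
    have "cmod (infsum ?f I) \<le> opnorm X * (hnorm x * hnorm y)"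
      by simp
    then show "cmod (hinner (\<psi> X x) y) \<le> opnorm X * hnorm x * hnorm y"
      using infsumI[OF sum] hinner_adj'[OF Q(1)] by (simp add: \<psi>_def adjS mult.assoc)
  qed
  moreover have "similar \<phi> \<psi>"
    unfolding similar_def
    by (intro exI[of _ S] conjI S(4)) (simp add: fun_eq_iff \<psi>_def adjQ adjS Q comp_def)
  moreover have "cp_map \<psi>"
    unfolding \<psi>_def by (rule cp_map_conj[OF cp S(1) Q(1)])
  moreover have "wstar_cont \<psi>"
    unfolding \<psi>_def by (rule wstar_cont_conj[OF cont S(1) Q(1)])
  ultimately show ?thesis
    by blast
qed

text \<open>For the defect \<open>D = R - \<phi> R\<close> the sums in (iii) telescope to
  \<open>R - (\<phi> ^^ k) R + (\<phi> ^^ k) opid\<close>; comparing \<open>R\<close> with multiples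
  of the identity bounds this from both sides.\<close>

lemma superharmonic_imp_cond_iii:
  assumes R: "opos R" "oinvertible R" "ople (\<phi> R) R"
  shows "\<exists>a b D. cond_iii A I a b D"
proof -
  obtain e0 where e0: "0 < e0" "\<And>x. e0 * (hnorm x)\<^sup>2 \<le> qform R x"
    using opos_invertible_coercive[OF R(1,2)] by blast
  obtain M0 where M0: "0 < M0" "\<And>x. qform R x \<le> M0 * (hnorm x)\<^sup>2"
    using bop_Re_bound[OF opos_bop[OF R(1)]] by blast
  \<comment> \<open>The normalisation \<open>e \<le> 1 \<le> M\<close> ensures
    \<open>e / M \<le> M + M / e\<close>; moreover \<open>M \<ge> 1\<close> enters the lower
    estimate.\<close>
  define e where "e = min e0 1"
  define M where "M = max M0 1"
  have e: "0 < e" "e \<le> 1" and low: "e * (hnorm x)\<^sup>2 \<le> qform R x" for x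
    using e0 order_trans[OF mult_right_mono[of e e0 "(hnorm x)\<^sup>2"] e0(2)[of x]] by (auto simp: e_def)
  have M: "1 \<le> M" and up: "qform R x \<le> M * (hnorm x)\<^sup>2" for x
    using M0 order_trans[OF M0(2)[of x] mult_right_mono[of M0 M "(hnorm x)\<^sup>2"]] by (auto simp: M_def)
  note bR = opos_bop[OF R(1)]
  have le: "qform (\<phi> R) x \<le> qform R x" for x
    using R(3) ople_iff[OF opos_phi[OF R(1)] R(1)] by blast
  define D where "D x = R x - \<phi> R x" for x
  have oD: "opos D"
    using R(3) unfolding ople_def D_def by blast
  define T where "T k x = (\<Sum>j<k. (\<phi> ^^ j) D x) + (\<phi> ^^ k) opid x" for k x
  have oT: "opos (T k)" for k
    unfolding T_def by (intro opos_add opos_sum opos_phi_pow oD opos_opid)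
  have "(\<phi> ^^ j) D = (\<lambda>x. (\<phi> ^^ j) R x - (\<phi> ^^ Suc j) R x)" for j
    unfolding D_def funpow_Suc_right comp_def by (rule phi_pow_diff[OF bR bop_phi[OF bR]])
  then have "(\<Sum>j<k. (\<phi> ^^ j) D x) = R x - (\<phi> ^^ k) R x" for k x
    using sum_lessThan_telescope'[of "\<lambda>j. (\<phi> ^^ j) R x" k] by simp
  then have qT: "qform (T k) x = qform R x - qform ((\<phi> ^^ k) R) x + qform ((\<phi> ^^ k) opid) x" for k x
    by (simp add: T_def hinner_add_left hinner_diff_left)
  have pow: "c * qform ((\<phi> ^^ k) opid) x = qform ((\<phi> ^^ k) (\<lambda>x. hscale (complex_of_real c) (opid x))) x" for c k x
    by (simp add: phi_pow_scale[OF bop_opid] hinner_scale_left)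
  have lowk: "e * qform ((\<phi> ^^ k) opid) x \<le> qform ((\<phi> ^^ k) R) x" for k x
    unfolding pow
    by (rule qform_phi_pow_mono[OF bop_scaled[OF bop_opid] bR])
      (use low in \<open>simp add: hinner_scale_left hinner_self opid_def\<close>)
  have upk: "qform ((\<phi> ^^ k) R) x \<le> M * qform ((\<phi> ^^ k) opid) x" for k x
    unfolding pow
    by (rule qform_phi_pow_mono[OF bR bop_scaled[OF bop_opid]])
      (use up in \<open>simp add: hinner_scale_left hinner_self opid_def\<close>)
  have dec: "qform ((\<phi> ^^ k) R) x \<le> qform R x" for k x
    using qform_phi_pow_geometric[OF bR, of 1 k x] le by simp
  \<comment> \<open>\<open>M\<close> times the sum dominates \<open>(r - s) + s = r\<close>: the
    estimate \<open>s \<le> M * t\<close> lets the power at the identity make up for what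
    \<open>R\<close> loses.\<close>
  have lowT: "e / M * (hnorm x)\<^sup>2 \<le> qform (T k) x" for k x
  proof -
    define r s t where "r = qform R x" and "s = qform ((\<phi> ^^ k) R) x" and "t = qform ((\<phi> ^^ k) opid) x"
    have "e * (hnorm x)\<^sup>2 \<le> r" "s \<le> M * t" "s \<le> r"
      using low[of x] upk[of k x] dec[of k x] by (simp_all add: r_def s_def t_def)
    moreover have "(r - s) * 1 \<le> (r - s) * M"
      using \<open>s \<le> r\<close> M by (intro mult_left_mono) auto
    ultimately have "e * (hnorm x)\<^sup>2 \<le> (r - s + t) * M"
      by (simp add: algebra_simps)
    then show ?thesis
      using M by (simp add: qT r_def s_def t_def field_simps)
  qed
  have upT: "qform (T k) x \<le> (M + M / e) * (hnorm x)\<^sup>2" for k x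
  proof -
    define r s t where "r = qform R x" and "s = qform ((\<phi> ^^ k) R) x" and "t = qform ((\<phi> ^^ k) opid) x"
    have "r \<le> M * (hnorm x)\<^sup>2" "e * t \<le> s" "s \<le> r" "0 \<le> s"
      using up[of x] lowk[of k x] dec[of k x] opos_nonneg[OF opos_phi_pow[OF R(1)]]
      by (simp_all add: r_def s_def t_def)
    then have "r - s + t \<le> M * (hnorm x)\<^sup>2 + M * (hnorm x)\<^sup>2 / e"
      using e by (intro add_mono) (auto simp: field_simps)
    then show ?thesis
      by (simp add: qT r_def s_def t_def algebra_simps)
  qed
  have ab: "0 < e / M" "e / M \<le> M + M / e"
  proof -
    show "0 < e / M"
      using e M by simp
    have "e / M \<le> 1"
      using e M by simp
    also have "\<dots> \<le> M + M / e"
      using e M by (simp add: add_increasing2)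
    finally show "e / M \<le> M + M / e" .
  qed
  have "ople (opscal (e / M)) (T k)" "ople (T k) (opscal (M + M / e))" for k
  proof -
    have "0 \<le> e / M" "0 \<le> M + M / e"
      using ab by auto
    then show "ople (opscal (e / M)) (T k)" "ople (T k) (opscal (M + M / e))"
      using lowT upT by (simp_all add: ople_iff opos_opscal oT) (simp_all add: opscal_def hinner_scale_left hinner_self)
  qed
  then have "cond_iii A I (e / M) (M + M / e) D"
    unfolding cond_iii_def T_def using ab oD by blast
  then show ?thesis
    by blast
qed

end

section \<open>Polynomials on the Fock space\<close>

abbreviation l2fun :: "(nat list \<Rightarrow> complex) \<Rightarrow> bool" where
  "l2fun \<xi> \<equiv> (\<lambda>w. (cmod (\<xi> w))\<^sup>2) summable_on UNIV"

lemma fnorm_sq: "(fnorm \<xi>)\<^sup>2 = (\<Sum>\<^sub>\<infinity>w. (cmod (\<xi> w))\<^sup>2)"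
  by (simp add: fnorm_def infsum_nonneg)

lemma fnorm_nonneg [simp]: "0 \<le> fnorm \<xi>"
  by (simp add: fnorm_def infsum_nonneg)

lemma fnorm_zero [simp]: "fnorm (\<lambda>_. 0) = 0"
  by (simp add: fnorm_def)

lemma fnorm_sq_scale: "(fnorm (\<lambda>w. c * \<xi> w))\<^sup>2 = (cmod c)\<^sup>2 * (fnorm \<xi>)\<^sup>2"
  by (simp add: fnorm_sq norm_mult power_mult_distrib infsum_cmult_right')

lemma l2fun_scale: "l2fun \<xi> \<Longrightarrow> l2fun (\<lambda>w. c * \<xi> w)"
  by (simp add: norm_mult power_mult_distrib summable_on_cmult_right)

lemma has_sum_finite_sum:
  fixes f :: "'k \<Rightarrow> 'a \<Rightarrow> 'b::topological_comm_monoid_add"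
  assumes "finite K" "\<And>k. k \<in> K \<Longrightarrow> (f k has_sum s k) A"
  shows "((\<lambda>x. \<Sum>k\<in>K. f k x) has_sum (\<Sum>k\<in>K. s k)) A"
  using assms by (induction K rule: finite_induct) (auto intro: has_sum_add)

lemma l2fun_sum:
  assumes "finite K" and z: "\<And>k. k \<in> K \<Longrightarrow> l2fun (z k)"
  shows "l2fun (\<lambda>w. \<Sum>k\<in>K. z k w)" (is ?th1)
    and "(fnorm (\<lambda>w. \<Sum>k\<in>K. z k w))\<^sup>2 \<le> real (card K) * (\<Sum>k\<in>K. (fnorm (z k))\<^sup>2)" (is ?th2)
proof -
  have le: "(cmod (\<Sum>k\<in>K. z k w))\<^sup>2 \<le> real (card K) * (\<Sum>k\<in>K. (cmod (z k w))\<^sup>2)" for w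
  proof -
    have "(cmod (\<Sum>k\<in>K. z k w))\<^sup>2 \<le> (\<Sum>k\<in>K. cmod (z k w))\<^sup>2"
      by (intro power_mono norm_sum) simp
    also have "\<dots> \<le> (\<Sum>k\<in>K. (cmod (z k w))\<^sup>2) * real (card K)"
      by (rule sum_squared_le_sum_of_squares)
    finally show ?thesis
      by (simp add: mult.commute)
  qed
  have sum: "(\<lambda>w. real (card K) * (\<Sum>k\<in>K. (cmod (z k w))\<^sup>2)) summable_on UNIV"
    by (intro summable_on_cmult_right has_sum_imp_summable[OF has_sum_finite_sum[OF \<open>finite K\<close> has_sum_infsum]] z)
  show ?th1
    by (rule summable_on_comparison_test[OF sum]) (use le in auto)
  then have "(fnorm (\<lambda>w. \<Sum>k\<in>K. z k w))\<^sup>2 \<le> (\<Sum>\<^sub>\<infinity>w. real (card K) * (\<Sum>k\<in>K. (cmod (z k w))\<^sup>2))"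
    unfolding fnorm_sq by (rule infsum_mono[OF _ sum]) (rule le)
  also have "\<dots> = real (card K) * (\<Sum>k\<in>K. (fnorm (z k))\<^sup>2)"
    unfolding fnorm_sq infsum_cmult_right'
    by (simp add: infsumI[OF has_sum_finite_sum[OF \<open>finite K\<close> has_sum_infsum[OF z]]])
  finally show ?th2 .
qed

text \<open>The isometry \<open>S_\<alpha>\<close> of the word \<open>\<alpha>\<close>, written in
  coordinates.\<close>

definition shift_by :: "nat list \<Rightarrow> (nat list \<Rightarrow> complex) \<Rightarrow> nat list \<Rightarrow> complex" where
  "shift_by \<alpha> \<xi> w = (if take (length \<alpha>) w = \<alpha> then \<xi> (drop (length \<alpha>) w) else 0)"

lemma shift_by_isometry:
  assumes "l2fun \<xi>" shows "l2fun (shift_by \<alpha> \<xi>)" "fnorm (shift_by \<alpha> \<xi>) = fnorm \<xi>"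
proof -
  have "((\<lambda>v. (cmod (\<xi> v))\<^sup>2) has_sum (fnorm \<xi>)\<^sup>2) UNIV"
    unfolding fnorm_sq using assms by (rule has_sum_infsum)
  also have "(\<lambda>v. (cmod (\<xi> v))\<^sup>2) = (\<lambda>w. (cmod (shift_by \<alpha> \<xi> w))\<^sup>2) \<circ> (@) \<alpha>"
    by (simp add: fun_eq_iff shift_by_def)
  finally have "((\<lambda>w. (cmod (shift_by \<alpha> \<xi> w))\<^sup>2) has_sum (fnorm \<xi>)\<^sup>2) (range ((@) \<alpha>))"
    by (rule has_sum_reindex[THEN iffD2, rotated]) (auto intro: injI)
  moreover have "cmod (shift_by \<alpha> \<xi> w) = 0" if "w \<notin> range ((@) \<alpha>)" for w
  proof -
    have "take (length \<alpha>) w \<noteq> \<alpha>"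
    proof
      assume "take (length \<alpha>) w = \<alpha>"
      then have "w = \<alpha> @ drop (length \<alpha>) w"
        using append_take_drop_id[of "length \<alpha>" w] by simp
      then show False
        using that by blast
    qed
    then show ?thesis
      by (simp add: shift_by_def)
  qed
  ultimately have *: "((\<lambda>w. (cmod (shift_by \<alpha> \<xi> w))\<^sup>2) has_sum (fnorm \<xi>)\<^sup>2) UNIV"
    by (subst (asm) has_sum_cong_neutral[where T=UNIV and g="\<lambda>w. (cmod (shift_by \<alpha> \<xi> w))\<^sup>2"]) auto
  then show "l2fun (shift_by \<alpha> \<xi>)"
    by (rule has_sum_imp_summable)
  have "(fnorm (shift_by \<alpha> \<xi>))\<^sup>2 = (fnorm \<xi>)\<^sup>2"
    using infsumI[OF *] by (simp add: fnorm_sq)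
  then show "fnorm (shift_by \<alpha> \<xi>) = fnorm \<xi>"
    by simp
qed

text \<open>\<open>polyS\<close> sums over the splittings of \<open>w\<close>, the right side over
  the words of \<open>p\<close>; only prefixes of \<open>w\<close> contribute to either.\<close>

lemma polyS_eq_sum_shift:
  assumes "finite {\<alpha>. p \<alpha> \<noteq> 0}"
  shows "polyS p \<xi> w = (\<Sum>\<alpha>\<in>{\<alpha>. p \<alpha> \<noteq> 0}. p \<alpha> * shift_by \<alpha> \<xi> w)"
proof -
  have inj: "inj_on (\<lambda>m. take m w) {..length w}"
    by (rule inj_on_inverseI[where g=length]) simp
  have "polyS p \<xi> w = (\<Sum>m\<le>length w. p (take m w) * shift_by (take m w) \<xi> w)"
    unfolding polyS_def by (rule sum.cong) (auto simp: shift_by_def min_def)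
  also have "\<dots> = (\<Sum>\<alpha>\<in>(\<lambda>m. take m w) ` {..length w}. p \<alpha> * shift_by \<alpha> \<xi> w)"
    by (simp add: sum.reindex[OF inj])
  also have "\<dots> = (\<Sum>\<alpha>\<in>{\<alpha>. p \<alpha> \<noteq> 0}. p \<alpha> * shift_by \<alpha> \<xi> w)"
  proof (rule sum.mono_neutral_cong)
    fix \<alpha> assume \<alpha>: "\<alpha> \<in> {\<alpha>. p \<alpha> \<noteq> 0} - (\<lambda>m. take m w) ` {..length w}"
    have "take (length \<alpha>) w \<noteq> \<alpha>"
    proof
      assume "take (length \<alpha>) w = \<alpha>"
      then have "\<alpha> = take (length \<alpha>) w" "length \<alpha> \<le> length w"
        using length_take[of "length \<alpha>" w] by auto
      then show False
        using \<alpha> by blast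
    qed
    then show "p \<alpha> * shift_by \<alpha> \<xi> w = 0"
      by (simp add: shift_by_def)
  qed (use assms in auto)
  finally show ?thesis .
qed

text \<open>A crude bound whose size does not matter: it makes the set behind
  \<open>matnormS\<close> bounded and keeps the images square summable.\<close>

lemma polyS_bounded:
  assumes "finite {\<alpha>. p \<alpha> \<noteq> 0}"
  shows "\<exists>B\<ge>0. \<forall>\<xi>. l2fun \<xi> \<longrightarrow> l2fun (polyS p \<xi>) \<and> (fnorm (polyS p \<xi>))\<^sup>2 \<le> B * (fnorm \<xi>)\<^sup>2"
proof (intro exI conjI allI impI)
  let ?K = "{\<alpha>. p \<alpha> \<noteq> 0}"
  let ?B = "real (card ?K) * (\<Sum>\<alpha>\<in>?K. (cmod (p \<alpha>))\<^sup>2)"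
  show "0 \<le> ?B"
    by (simp add: sum_nonneg)
  fix \<xi> :: "nat list \<Rightarrow> complex" assume \<xi>: "l2fun \<xi>"
  have eq: "polyS p \<xi> = (\<lambda>w. \<Sum>\<alpha>\<in>?K. p \<alpha> * shift_by \<alpha> \<xi> w)"
    by (rule ext) (rule polyS_eq_sum_shift[OF assms])
  have l2: "l2fun (\<lambda>w. p \<alpha> * shift_by \<alpha> \<xi> w)" for \<alpha>
    by (rule l2fun_scale[OF shift_by_isometry(1)[OF \<xi>]])
  show "l2fun (polyS p \<xi>)"
    unfolding eq by (rule l2fun_sum(1)[OF assms l2])
  have "(fnorm (polyS p \<xi>))\<^sup>2 \<le> real (card ?K) * (\<Sum>\<alpha>\<in>?K. (fnorm (\<lambda>w. p \<alpha> * shift_by \<alpha> \<xi> w))\<^sup>2)"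
    unfolding eq by (rule l2fun_sum(2)[OF assms l2])
  then show "(fnorm (polyS p \<xi>))\<^sup>2 \<le> ?B * (fnorm \<xi>)\<^sup>2"
    by (simp add: fnorm_sq_scale shift_by_isometry(2)[OF \<xi>] sum_distrib_right mult.assoc)
qed

definition matS :: "nat \<Rightarrow> (nat \<Rightarrow> nat \<Rightarrow> nat list \<Rightarrow> complex) \<Rightarrow> (nat \<Rightarrow> nat list \<Rightarrow> complex) \<Rightarrow> nat \<Rightarrow> nat list \<Rightarrow> complex" where
  "matS m P \<xi> i w = (\<Sum>j<m. polyS (P i j) (\<xi> j) w)"

lemma matS_bounded:
  assumes P: "\<And>i j. i < m \<Longrightarrow> j < m \<Longrightarrow> ncpoly I (P i j)"
  obtains B where "0 \<le> B" "\<forall>\<xi>. (\<forall>j<m. l2fun (\<xi> j)) \<longrightarrow>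
    (\<Sum>i<m. (fnorm (matS m P \<xi> i))\<^sup>2) \<le> B * (\<Sum>j<m. (fnorm (\<xi> j))\<^sup>2)"
proof -
  define Q where "Q i j B \<longleftrightarrow> 0 \<le> B \<and> (\<forall>\<xi>. l2fun \<xi> \<longrightarrow> l2fun (polyS (P i j) \<xi>) \<and>
      (fnorm (polyS (P i j) \<xi>))\<^sup>2 \<le> B * (fnorm \<xi>)\<^sup>2)" for i j and B :: real
  have "\<exists>B. Q i j B" if "i < m" "j < m" for i j
    using polyS_bounded[of "P i j"] P[OF that] unfolding ncpoly_def Q_def by simp
  then obtain b where "\<And>i j. i < m \<Longrightarrow> j < m \<Longrightarrow> Q i j (b i j)"
    by metis
  then have b: "\<And>i j. i < m \<Longrightarrow> j < m \<Longrightarrow> 0 \<le> b i j"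
    "\<And>i j \<xi>. i < m \<Longrightarrow> j < m \<Longrightarrow> l2fun \<xi> \<Longrightarrow> l2fun (polyS (P i j) \<xi>)"
    "\<And>i j \<xi>. i < m \<Longrightarrow> j < m \<Longrightarrow> l2fun \<xi> \<Longrightarrow> (fnorm (polyS (P i j) \<xi>))\<^sup>2 \<le> b i j * (fnorm \<xi>)\<^sup>2"
    unfolding Q_def by simp_all
  show ?thesis
  proof (rule that; (intro allI impI)?)
    show "0 \<le> (\<Sum>i<m. real m * (\<Sum>j<m. b i j))"
      by (intro sum_nonneg mult_nonneg_nonneg) (auto intro: b)
    fix \<xi> :: "nat \<Rightarrow> nat list \<Rightarrow> complex" assume \<xi>: "\<forall>j<m. l2fun (\<xi> j)"
    have "(fnorm (matS m P \<xi> i))\<^sup>2 \<le> real m * (\<Sum>j<m. b i j) * (\<Sum>j<m. (fnorm (\<xi> j))\<^sup>2)" if i: "i < m" for i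
    proof -
      have "(fnorm (matS m P \<xi> i))\<^sup>2 \<le> real (card {..<m}) * (\<Sum>j<m. (fnorm (polyS (P i j) (\<xi> j)))\<^sup>2)"
        unfolding matS_def by (rule l2fun_sum(2)) (use b(2) i \<xi> in auto)
      also have "\<dots> \<le> real m * (\<Sum>j<m. (\<Sum>j'<m. b i j') * (fnorm (\<xi> j))\<^sup>2)"
      proof (simp only: card_lessThan, intro mult_left_mono sum_mono)
        fix j assume j: "j \<in> {..<m}"
        have "(fnorm (polyS (P i j) (\<xi> j)))\<^sup>2 \<le> b i j * (fnorm (\<xi> j))\<^sup>2"
          using b(3) i j \<xi> by simp
        also have "b i j \<le> (\<Sum>j'<m. b i j')"
          by (rule member_le_sum) (use b(1) i j in auto)
        then have "b i j * (fnorm (\<xi> j))\<^sup>2 \<le> (\<Sum>j'<m. b i j') * (fnorm (\<xi> j))\<^sup>2"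
          by (rule mult_right_mono) simp
        finally show "(fnorm (polyS (P i j) (\<xi> j)))\<^sup>2 \<le> (\<Sum>j'<m. b i j') * (fnorm (\<xi> j))\<^sup>2" .
      qed simp
      finally show ?thesis
        by (simp only: mult.assoc sum_distrib_left[symmetric])
    qed
    then show "(\<Sum>i<m. (fnorm (matS m P \<xi> i))\<^sup>2) \<le> (\<Sum>i<m. real m * (\<Sum>j<m. b i j)) * (\<Sum>j<m. (fnorm (\<xi> j))\<^sup>2)"
      unfolding sum_distrib_right[of _ "{..<m}" "\<Sum>j<m. (fnorm (\<xi> j))\<^sup>2"] by (intro sum_mono) simp
  qed
qed

lemma matnormS_eq:
  "matnormS I m P = Sup ((\<lambda>\<xi>. sqrt (\<Sum>i<m. (fnorm (matS m P \<xi> i))\<^sup>2)) `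
      {\<xi>. (\<forall>j<m. fock I (\<xi> j)) \<and> (\<Sum>j<m. (fnorm (\<xi> j))\<^sup>2) \<le> 1})"
  unfolding matnormS_def matS_def by (rule arg_cong[of _ _ Sup]) auto

lemma matnormS_le:
  assumes "\<And>\<xi>. (\<And>j. j < m \<Longrightarrow> fock I (\<xi> j)) \<Longrightarrow> (\<Sum>j<m. (fnorm (\<xi> j))\<^sup>2) \<le> 1 \<Longrightarrow>
      (\<Sum>i<m. (fnorm (matS m P \<xi> i))\<^sup>2) \<le> C\<^sup>2" and "0 \<le> C"
  shows "matnormS I m P \<le> C"
  unfolding matnormS_eq
proof (rule cSup_least)
  have "(\<lambda>_ _. 0) \<in> {\<xi>. (\<forall>j<m. fock I (\<xi> j)) \<and> (\<Sum>j<m. (fnorm (\<xi> j))\<^sup>2) \<le> 1}"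
    by (simp add: fock_def)
  then show "(\<lambda>\<xi>. sqrt (\<Sum>i<m. (fnorm (matS m P \<xi> i))\<^sup>2)) `
      {\<xi>. (\<forall>j<m. fock I (\<xi> j)) \<and> (\<Sum>j<m. (fnorm (\<xi> j))\<^sup>2) \<le> 1} \<noteq> {}"
    unfolding image_is_empty by (intro notI) (simp only: empty_iff)
next
  fix r assume "r \<in> (\<lambda>\<xi>. sqrt (\<Sum>i<m. (fnorm (matS m P \<xi> i))\<^sup>2)) `
      {\<xi>. (\<forall>j<m. fock I (\<xi> j)) \<and> (\<Sum>j<m. (fnorm (\<xi> j))\<^sup>2) \<le> 1}"
  then obtain \<xi> where "\<xi> \<in> {\<xi>. (\<forall>j<m. fock I (\<xi> j)) \<and> (\<Sum>j<m. (fnorm (\<xi> j))\<^sup>2) \<le> 1}"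
    and r: "r = sqrt (\<Sum>i<m. (fnorm (matS m P \<xi> i))\<^sup>2)"
    by (elim imageE)
  then have \<xi>: "\<forall>j<m. fock I (\<xi> j)" "(\<Sum>j<m. (fnorm (\<xi> j))\<^sup>2) \<le> 1"
    by simp_all
  show "r \<le> C"
  proof -
    have "(\<Sum>i<m. (fnorm (matS m P \<xi> i))\<^sup>2) \<le> C\<^sup>2"
      by (rule assms(1)[of \<xi>]) (use \<xi> in simp_all)
    then show ?thesis
      unfolding r by (rule real_le_lsqrt[OF assms(2)])
  qed
qed

lemma bdd_above_matnormS:
  assumes P: "\<And>i j. i < m \<Longrightarrow> j < m \<Longrightarrow> ncpoly I (P i j)"
  shows "bdd_above ((\<lambda>\<xi>. sqrt (\<Sum>i<m. (fnorm (matS m P \<xi> i))\<^sup>2)) `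
      {\<xi>. (\<forall>j<m. fock I (\<xi> j)) \<and> (\<Sum>j<m. (fnorm (\<xi> j))\<^sup>2) \<le> 1})"
proof -
  obtain B where B: "0 \<le> B" "\<forall>\<xi>. (\<forall>j<m. l2fun (\<xi> j)) \<longrightarrow>
      (\<Sum>i<m. (fnorm (matS m P \<xi> i))\<^sup>2) \<le> B * (\<Sum>j<m. (fnorm (\<xi> j))\<^sup>2)"
    by (rule matS_bounded[where P=P, OF P])
  show ?thesis
  proof (rule bdd_aboveI2)
    fix \<xi> assume \<xi>: "\<xi> \<in> {\<xi>. (\<forall>j<m. fock I (\<xi> j)) \<and> (\<Sum>j<m. (fnorm (\<xi> j))\<^sup>2) \<le> 1}"
    then have "(\<Sum>i<m. (fnorm (matS m P \<xi> i))\<^sup>2) \<le> B * (\<Sum>j<m. (fnorm (\<xi> j))\<^sup>2)"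
      by (intro B(2)[rule_format]) (simp add: fock_def)
    also have "\<dots> \<le> B"
      using \<xi> B(1) by (simp add: mult_left_le)
    finally show "sqrt (\<Sum>i<m. (fnorm (matS m P \<xi> i))\<^sup>2) \<le> sqrt B"
      by simp
  qed
qed

lemma matS_scale: "matS m P (\<lambda>j w. c * \<xi> j w) i = (\<lambda>w. c * matS m P \<xi> i w)"
  by (simp add: matS_def polyS_def sum_distrib_left mult.left_commute fun_eq_iff)

lemma matS_le_matnormS:
  assumes P: "\<And>i j. i < m \<Longrightarrow> j < m \<Longrightarrow> ncpoly I (P i j)" and \<xi>: "\<And>j. j < m \<Longrightarrow> fock I (\<xi> j)"
  shows "(\<Sum>i<m. (fnorm (matS m P \<xi> i))\<^sup>2) \<le> (matnormS I m P)\<^sup>2 * (\<Sum>j<m. (fnorm (\<xi> j))\<^sup>2)"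
proof -
  obtain B where B: "0 \<le> B" "\<forall>\<xi>. (\<forall>j<m. l2fun (\<xi> j)) \<longrightarrow>
      (\<Sum>i<m. (fnorm (matS m P \<xi> i))\<^sup>2) \<le> B * (\<Sum>j<m. (fnorm (\<xi> j))\<^sup>2)"
    by (rule matS_bounded[where P=P, OF P])
  define s where "s = (\<Sum>j<m. (fnorm (\<xi> j))\<^sup>2)"
  have s: "0 \<le> s"
    by (simp add: s_def sum_nonneg)
  show ?thesis
  proof (cases "s = 0")
    \<comment> \<open>Normalising is impossible here; the crude bound shows that the left side
      vanishes too.\<close>
    case True
    then show ?thesis
      using B(2)[rule_format, of \<xi>] \<xi> by (simp add: s_def fock_def)
  next
    case False
    with s have s: "s > 0"
      by simp
    define c where "c = complex_of_real (1 / sqrt s)"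
    have c: "c \<noteq> 0" "(cmod c)\<^sup>2 = 1 / s"
      using s by (auto simp: c_def norm_divide power_divide)
    define \<eta> where "\<eta> = (\<lambda>j w. c * \<xi> j w)"
    have \<eta>1: "(\<Sum>j<m. (fnorm (\<eta> j))\<^sup>2) = 1"
    proof -
      have "(\<Sum>j<m. (fnorm (\<eta> j))\<^sup>2) = 1 / s * s"
        unfolding \<eta>_def fnorm_sq_scale c(2) s_def[symmetric] sum_distrib_left[symmetric] ..
      then show ?thesis
        using s by simp
    qed
    have \<eta>2: "fock I (\<eta> j)" if "j < m" for j
      using \<xi>[OF that] by (auto simp: \<eta>_def fock_def intro: l2fun_scale)
    have "sqrt (\<Sum>i<m. (fnorm (matS m P \<eta> i))\<^sup>2) \<le> matnormS I m P"
      unfolding matnormS_eq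
    proof (rule cSup_upper)
      show "bdd_above ((\<lambda>\<xi>. sqrt (\<Sum>i<m. (fnorm (matS m P \<xi> i))\<^sup>2)) `
          {\<xi>. (\<forall>j<m. fock I (\<xi> j)) \<and> (\<Sum>j<m. (fnorm (\<xi> j))\<^sup>2) \<le> 1})"
        by (rule bdd_above_matnormS[where P=P, OF P])
    qed (use \<eta>1 \<eta>2 in auto)
    then have "(\<Sum>i<m. (fnorm (matS m P \<eta> i))\<^sup>2) \<le> (matnormS I m P)\<^sup>2"
      by (rule sqrt_le_D)
    then have "(\<Sum>i<m. (fnorm (matS m P \<xi> i))\<^sup>2) / s \<le> (matnormS I m P)\<^sup>2"
      unfolding \<eta>_def matS_scale fnorm_sq_scale c(2) by (simp add: sum_divide_distrib)
    then show ?thesis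
      using s by (simp add: pos_divide_le_eq flip: s_def)
  qed
qed

lemma matnormS_nonneg:
  assumes P: "\<And>i j. i < m \<Longrightarrow> j < m \<Longrightarrow> ncpoly I (P i j)"
  shows "0 \<le> matnormS I m P"
proof -
  have "sqrt (\<Sum>i<m. (fnorm (matS m P (\<lambda>_ _. 0) i))\<^sup>2) \<le> matnormS I m P"
    unfolding matnormS_eq by (rule cSup_upper[OF _ bdd_above_matnormS[where P=P, OF P]]) (auto simp: fock_def)
  moreover have "0 \<le> sqrt (\<Sum>i<m. (fnorm (matS m P (\<lambda>_ _. 0) i))\<^sup>2)"
    by (simp add: sum_nonneg)
  ultimately show ?thesis
    by (rule order_trans[rotated])
qed

section \<open>The Poisson kernel and von Neumann's inequality\<close>

lemma wordop_Nil: "wordop A [] = (\<lambda>x. x)"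
  by (simp add: wordop_def id_def)

lemma wordop_Cons: "wordop A (i # \<alpha>) = (\<lambda>x. A i (wordop A \<alpha> x))"
  by (simp add: wordop_def comp_def)

lemma wordop_append: "wordop A (\<alpha> @ \<beta>) = (\<lambda>x. wordop A \<alpha> (wordop A \<beta> x))"
  by (induction \<alpha>) (simp_all add: wordop_Nil wordop_Cons)

lemma polyA_eq_sum:
  assumes "finite K" "{\<alpha>. p \<alpha> \<noteq> 0} \<subseteq> K"
  shows "polyA A p x = (\<Sum>\<alpha>\<in>K. hscale (p \<alpha>) (wordop A \<alpha> x))"
  unfolding polyA_def by (rule sum.mono_neutral_left) (use assms in auto)

definition matA :: "(nat \<Rightarrow> 'a::chilbert \<Rightarrow> 'a) \<Rightarrow> nat \<Rightarrow> (nat \<Rightarrow> nat \<Rightarrow> nat list \<Rightarrow> complex) \<Rightarrow> (nat \<Rightarrow> 'a) \<Rightarrow> nat \<Rightarrow> 'a" where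
  "matA A m P h i = (\<Sum>j<m. polyA A (P i j) (h j))"

section \<open>Duality and ampliation for matrices of operators\<close>

lemma sum_hinner_le:
  assumes "(\<Sum>k\<in>J. (hnorm (a k))\<^sup>2) \<le> U" "(\<Sum>k\<in>J. (hnorm (b k))\<^sup>2) \<le> V"
  shows "cmod (\<Sum>k\<in>J. hinner (a k) (b k)) \<le> sqrt U * sqrt V"
proof -
  have "cmod (\<Sum>k\<in>J. hinner (a k) (b k)) \<le> (\<Sum>k\<in>J. \<bar>hnorm (a k)\<bar> * \<bar>hnorm (b k)\<bar>)"
    by (rule sum_norm_le) (simp add: hinner_Cauchy_Schwarz)
  also have "\<dots> \<le> sqrt U * sqrt V"
    by (rule sum_mult_le_sqrt[OF assms])
  finally show ?thesis .
qed

text \<open>Pairing a vector with itself leads to an estimate with the unknown on both sides; this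
  resolves it at the end of every duality argument below.\<close>

lemma le_of_le_sqrt_mult:
  fixes s :: real
  assumes "s \<le> sqrt p * sqrt (k * s)" "0 \<le> s" "0 \<le> p" "0 \<le> k"
  shows "s \<le> k * p"
proof (cases "s = 0")
  case False
  have "s\<^sup>2 \<le> (sqrt p * sqrt (k * s))\<^sup>2"
    using assms by (intro power_mono) auto
  also have "\<dots> = (k * p) * s"
    using assms by (simp add: power_mult_distrib)
  finally have "s * s \<le> (k * p) * s"
    by (simp add: power2_eq_square)
  then show ?thesis
    using False assms(2) by simp
qed (use assms in simp)

text \<open>An operator matrix is bounded by its adjoint: pair the output \<open>y\<close> with
  itself and move the entries to the other side.\<close>

lemma matrix_norm_dual:
  fixes T :: "nat \<Rightarrow> nat \<Rightarrow> 'a::chilbert \<Rightarrow> 'a"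
  assumes T: "\<And>i j. i < m \<Longrightarrow> j < m \<Longrightarrow> bop (T i j)" and k: "0 \<le> k"
    and dual: "\<And>y. (\<Sum>j<m. (hnorm (\<Sum>i<m. adj (T i j) (y i)))\<^sup>2) \<le> k * (\<Sum>i<m. (hnorm (y i))\<^sup>2)"
  shows "(\<Sum>i<m. (hnorm (\<Sum>j<m. T i j (h j)))\<^sup>2) \<le> k * (\<Sum>j<m. (hnorm (h j))\<^sup>2)"
proof -
  define y where "y i = (\<Sum>j<m. T i j (h j))" for i
  define s where "s = (\<Sum>i<m. (hnorm (y i))\<^sup>2)"
  have "complex_of_real s = (\<Sum>i<m. hinner (y i) (y i))"
    by (simp add: s_def hinner_self)
  also have "\<dots> = (\<Sum>i<m. \<Sum>j<m. hinner (T i j (h j)) (y i))"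
    by (rule sum.cong[OF refl]) (subst (1) y_def, rule hinner_sum_left)
  also have "\<dots> = (\<Sum>i<m. \<Sum>j<m. hinner (h j) (adj (T i j) (y i)))"
    by (intro sum.cong refl) (simp add: hinner_adj[OF T])
  also have "\<dots> = (\<Sum>j<m. hinner (h j) (\<Sum>i<m. adj (T i j) (y i)))"
    by (subst sum.swap) (simp add: hinner_sum_right)
  finally have "s = cmod (\<Sum>j<m. hinner (h j) (\<Sum>i<m. adj (T i j) (y i)))"
    using norm_of_real[of s, where 'a=complex] by (simp add: s_def sum_nonneg)
  also have "\<dots> \<le> sqrt (\<Sum>j<m. (hnorm (h j))\<^sup>2) * sqrt (k * s)"
    unfolding s_def by (rule sum_hinner_le[OF order_refl dual])
  finally have "s \<le> k * (\<Sum>j<m. (hnorm (h j))\<^sup>2)"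
    by (rule le_of_le_sqrt_mult) (use k in \<open>simp_all add: s_def sum_nonneg\<close>)
  then show ?thesis
    by (simp add: s_def y_def)
qed

text \<open>A scalar matrix keeps its norm when it acts on Hilbert space vectors: split off, one at a
  time, the components along the direction of a nonzero vector.\<close>

lemma scalar_matrix_ampliation:
  fixes F :: "'v \<Rightarrow> 'a::chilbert" and L :: "'u \<Rightarrow> 'v \<Rightarrow> complex"
  assumes V: "finite V"
    and L: "\<And>c. (\<Sum>u\<in>U. (cmod (\<Sum>v\<in>V. L u v * c v))\<^sup>2) \<le> C * (\<Sum>v\<in>V. (cmod (c v))\<^sup>2)"
  shows "(\<Sum>u\<in>U. (hnorm (\<Sum>v\<in>V. hscale (L u v) (F v)))\<^sup>2) \<le> C * (\<Sum>v\<in>V. (hnorm (F v))\<^sup>2)"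
proof (induction "card {v\<in>V. F v \<noteq> 0}" arbitrary: F rule: less_induct)
  case less
  show ?case
  proof (cases "\<forall>v\<in>V. F v = 0")
    case True
    then show ?thesis
      by simp
  next
    case False
    then obtain v0 where v0: "v0 \<in> V" "F v0 \<noteq> 0"
      by blast
    then have n0: "hnorm (F v0) > 0"
      using hnorm_nonneg[of "F v0"] hnorm_eq_zero[of "F v0"] by linarith
    define e where "e = hscale (complex_of_real (1 / hnorm (F v0))) (F v0)"
    have ee: "hinner e e = 1"
      using n0 v0(2) by (simp add: e_def hinner_self hnorm_scale norm_divide)
    define c where "c v = hinner (F v) e" for v
    define G where "G v = F v - hscale (c v) e" for v
    have Ge: "hinner (G v) e = 0" for v
      by (simp add: G_def c_def hinner_diff_left hinner_scale_left ee)
    have pyth: "(hnorm (y + hscale z e))\<^sup>2 = (hnorm y)\<^sup>2 + (cmod z)\<^sup>2" if "hinner y e = 0" for y z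
    proof -
      have "hinner e y = 0"
        using that hinner_commute[of e y] by simp
      then have "hinner (y + hscale z e) (y + hscale z e) = hinner y y + z * cnj z"
        using that by (simp add: hinner_add_left hinner_add_right hinner_scale_left hinner_scale_right ee)
      then have "Re (hinner (y + hscale z e) (y + hscale z e)) = Re (hinner y y + z * cnj z)"
        by simp
      then show ?thesis
        unfolding hnorm_sq cmod_power2 by (simp add: power2_eq_square)
    qed
    have F: "F v = G v + hscale (c v) e" for v
      by (simp add: G_def)
    have Gv0: "G v0 = 0"
      using n0 by (simp add: G_def c_def e_def hinner_scale_right hinner_self hscale_hscale hscale_one
          power2_eq_square)
    have G0: "G v = 0" if "F v = 0" for v
      using that by (simp add: G_def c_def)
    \<comment> \<open>Removing the direction of \<open>F v0\<close> kills that vector and keeps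
      zeros zero, so the number of nonzero vectors drops.\<close>
    have "{v\<in>V. G v \<noteq> 0} \<subset> {v\<in>V. F v \<noteq> 0}"
      using v0 Gv0 G0 by auto
    then have "card {v\<in>V. G v \<noteq> 0} < card {v\<in>V. F v \<noteq> 0}"
      using V by (intro psubset_card_mono) auto
    then have IH: "(\<Sum>u\<in>U. (hnorm (\<Sum>v\<in>V. hscale (L u v) (G v)))\<^sup>2) \<le> C * (\<Sum>v\<in>V. (hnorm (G v))\<^sup>2)"
      by (rule less)
    have "(hnorm (\<Sum>v\<in>V. hscale (L u v) (F v)))\<^sup>2
        = (hnorm (\<Sum>v\<in>V. hscale (L u v) (G v)))\<^sup>2 + (cmod (\<Sum>v\<in>V. L u v * c v))\<^sup>2" for u
    proof -
      have "(\<Sum>v\<in>V. hscale (L u v) (F v)) = (\<Sum>v\<in>V. hscale (L u v) (G v)) + hscale (\<Sum>v\<in>V. L u v * c v) e"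
        unfolding F hscale_sum_left by (simp add: hscale_add_right hscale_hscale sum.distrib)
      moreover have "hinner (\<Sum>v\<in>V. hscale (L u v) (G v)) e = 0"
        by (simp add: hinner_sum_left hinner_scale_left Ge)
      ultimately show ?thesis
        using pyth by simp
    qed
    moreover have "(hnorm (F v))\<^sup>2 = (hnorm (G v))\<^sup>2 + (cmod (c v))\<^sup>2" for v
      using pyth[OF Ge, of v "c v"] by (simp flip: F)
    ultimately show ?thesis
      using IH L[of c] by (simp add: sum.distrib distrib_left)
  qed
qed

text \<open>The inner sum is the matrix entry of \<open>polyS p\<close> between the basis words
  \<open>\<beta>\<close> and \<open>w\<close>.\<close>

lemma polyS_finite_support:
  assumes "finite K" "{\<alpha>. p \<alpha> \<noteq> 0} \<subseteq> K" and B: "finite B" "\<And>\<beta>. \<beta> \<notin> B \<Longrightarrow> \<xi> \<beta> = 0"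
  shows "polyS p \<xi> w = (\<Sum>\<beta>\<in>B. (\<Sum>\<alpha>\<in>K. if \<alpha> @ \<beta> = w then p \<alpha> else 0) * \<xi> \<beta>)"
proof -
  have shift: "shift_by \<alpha> \<xi> w = (\<Sum>\<beta>\<in>B. if \<alpha> @ \<beta> = w then \<xi> \<beta> else 0)" for \<alpha>
  proof (cases "take (length \<alpha>) w = \<alpha>")
    case True
    then have "\<alpha> @ \<beta> = w \<longleftrightarrow> \<beta> = drop (length \<alpha>) w" for \<beta>
      using append_take_drop_id[of "length \<alpha>" w] by (metis append_eq_conv_conj)
    then show ?thesis
      using True B by (simp add: shift_by_def)
  next
    case False
    then have "\<alpha> @ \<beta> \<noteq> w" for \<beta>
      by auto
    then show ?thesis
      using False by (simp add: shift_by_def)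
  qed
  have "polyS p \<xi> w = (\<Sum>\<alpha>\<in>K. p \<alpha> * shift_by \<alpha> \<xi> w)"
    unfolding polyS_eq_sum_shift[OF finite_subset[OF assms(2,1)]]
    by (rule sum.mono_neutral_left) (use assms in auto)
  also have "\<dots> = (\<Sum>\<alpha>\<in>K. \<Sum>\<beta>\<in>B. (if \<alpha> @ \<beta> = w then p \<alpha> else 0) * \<xi> \<beta>)"
    unfolding shift sum_distrib_left by (intro sum.cong refl) auto
  also have "\<dots> = (\<Sum>\<beta>\<in>B. \<Sum>\<alpha>\<in>K. (if \<alpha> @ \<beta> = w then p \<alpha> else 0) * \<xi> \<beta>)"
    by (rule sum.swap)
  finally show ?thesis
    by (simp only: sum_distrib_right)
qed

lemma l2fun_finite_support:
  assumes "finite B" "\<And>\<beta>. \<beta> \<notin> B \<Longrightarrow> \<xi> \<beta> = 0"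
  shows "l2fun \<xi>" "(fnorm \<xi>)\<^sup>2 = (\<Sum>\<beta>\<in>B. (cmod (\<xi> \<beta>))\<^sup>2)"
proof -
  have "((\<lambda>w. (cmod (\<xi> w))\<^sup>2) has_sum (\<Sum>\<beta>\<in>B. (cmod (\<xi> \<beta>))\<^sup>2)) UNIV"
    by (rule has_sum_cong_neutral[THEN iffD1, OF _ _ _ has_sum_finite[OF assms(1)]]) (use assms(2) in auto)
  then show "l2fun \<xi>" "(fnorm \<xi>)\<^sup>2 = (\<Sum>\<beta>\<in>B. (cmod (\<xi> \<beta>))\<^sup>2)"
    by (auto simp: fnorm_sq dest: infsumI has_sum_imp_summable)
qed

lemma l2fun_matS:
  assumes P: "\<And>j. j < m \<Longrightarrow> ncpoly I (P i j)" and \<xi>: "\<And>j. j < m \<Longrightarrow> l2fun (\<xi> j)"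
  shows "l2fun (matS m P \<xi> i)"
  unfolding matS_def
proof (rule l2fun_sum(1))
  fix j assume "j \<in> {..<m}"
  then have j: "j < m" by simp
  have "finite {\<alpha>. P i j \<alpha> \<noteq> 0}"
    using P[OF j] by (simp add: ncpoly_def)
  then show "l2fun (polyS (P i j) (\<xi> j))"
    using polyS_bounded \<xi>[OF j] by blast
qed simp

context row_operator
begin

abbreviation words :: "nat list set" where
  "words \<equiv> {w. set w \<subseteq> I}"

lemma bop_wordop: "\<alpha> \<in> words \<Longrightarrow> bop (wordop A \<alpha>)"
proof (induction \<alpha>)
  case (Cons i \<alpha>)
  then have "bop (wordop A \<alpha>)" "bop (A i)"
    using bop_A by auto
  then show ?case
    unfolding wordop_Cons using bop_comp by blast
qed (simp add: wordop_Nil bop_id)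

lemma adj_wordop_Cons:
  assumes "i # \<alpha> \<in> words" shows "adj (wordop A (i # \<alpha>)) x = adj (wordop A \<alpha>) (adj (A i) x)"
proof -
  have "bop (A i)" "bop (wordop A \<alpha>)"
    using assms bop_A bop_wordop by auto
  from adj_comp[OF this] show ?thesis
    unfolding wordop_Cons by simp
qed

lemma adj_wordop_append:
  assumes "\<alpha> \<in> words" "\<beta> \<in> words"
  shows "adj (wordop A (\<alpha> @ \<beta>)) x = adj (wordop A \<beta>) (adj (wordop A \<alpha>) x)"
  unfolding wordop_append using adj_comp[OF bop_wordop[OF assms(1)] bop_wordop[OF assms(2)]] by simp

lemma ncpoly_words: "ncpoly I p \<Longrightarrow> finite {\<alpha>. p \<alpha> \<noteq> 0} \<and> {\<alpha>. p \<alpha> \<noteq> 0} \<subseteq> words"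
  by (auto simp: ncpoly_def)

lemma bop_polyA: assumes "ncpoly I p" shows "bop (polyA A p)"
  unfolding polyA_def by (intro bop_sum_op bop_scaled bop_wordop) (use assms in \<open>auto simp: ncpoly_def\<close>)

lemma adj_polyA:
  assumes p: "ncpoly I p"
  shows "adj (polyA A p) = (\<lambda>y. \<Sum>\<alpha>\<in>{\<alpha>. p \<alpha> \<noteq> 0}. hscale (cnj (p \<alpha>)) (adj (wordop A \<alpha>) y))"
proof (rule adj_unique[OF bop_polyA[OF p]])
  fix x y
  have "hinner (hscale (p \<alpha>) (wordop A \<alpha> x)) y = hinner x (hscale (cnj (p \<alpha>)) (adj (wordop A \<alpha>) y))"
    if "\<alpha> \<in> {\<alpha>. p \<alpha> \<noteq> 0}" for \<alpha>
  proof -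
    have "bop (wordop A \<alpha>)"
      using that p by (intro bop_wordop) (auto simp: ncpoly_def)
    then show ?thesis
      by (simp add: hinner_scale_left hinner_scale_right hinner_adj)
  qed
  then show "hinner (polyA A p x) y = hinner x (\<Sum>\<alpha>\<in>{\<alpha>. p \<alpha> \<noteq> 0}. hscale (cnj (p \<alpha>)) (adj (wordop A \<alpha>) y))"
    unfolding polyA_def hinner_sum_left hinner_sum_right by (rule sum.cong[OF refl])
qed

text \<open>Induction on \<open>k\<close>, splitting off the first letter; positivity of the
  summands justifies the rearrangement of the double sum.\<close>

lemma qform_words_has_sum:
  assumes X: "opos X"
  shows "((\<lambda>w. qform X (adj (wordop A w) x)) has_sum qform ((\<phi> ^^ k) X) x) {w\<in>words. length w = k}"
proof (induction k arbitrary: x)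
  case 0
  have "{w\<in>words. length w = 0} = {[]}"
    by auto
  then show ?case
    using has_sum_finite[of "{[]}" "\<lambda>w. qform X (adj (wordop A w) x)"] by (simp add: wordop_Nil adj_id)
next
  case (Suc k)
  define f where "f p = qform X (adj (wordop A (snd p)) (adj (A (fst p)) x))" for p
  have g: "((\<lambda>i. qform ((\<phi> ^^ k) X) (adj (A i) x)) has_sum qform (\<phi> ((\<phi> ^^ k) X)) x) I"
    by (rule qform_phi_has_sum[OF bop_phi_pow[OF opos_bop[OF X]]])
  have fi: "((\<lambda>w. f (i, w)) has_sum qform ((\<phi> ^^ k) X) (adj (A i) x)) {w\<in>words. length w = k}" for i
    using Suc[of "adj (A i) x"] by (simp add: f_def)
  have "f summable_on (SIGMA i:I. {w\<in>words. length w = k})"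
    by (rule summable_on_SigmaI[OF fi has_sum_imp_summable[OF g]]) (simp add: f_def opos_nonneg[OF X])
  then have "(f has_sum qform (\<phi> ((\<phi> ^^ k) X)) x) (SIGMA i:I. {w\<in>words. length w = k})"
    by (rule has_sum_SigmaI[OF fi g])
  moreover have "f p = ((\<lambda>w. qform X (adj (wordop A w) x)) \<circ> (\<lambda>(i, w). i # w)) p"
    if "p \<in> (SIGMA i:I. {w\<in>words. length w = k})" for p
    using that by (auto simp: f_def adj_wordop_Cons)
  ultimately have "(((\<lambda>w. qform X (adj (wordop A w) x)) \<circ> (\<lambda>(i, w). i # w)) has_sum qform (\<phi> ((\<phi> ^^ k) X)) x)
      (SIGMA i:I. {w\<in>words. length w = k})"
    by (rule has_sum_cong[THEN iffD1, rotated])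
  then have "((\<lambda>w. qform X (adj (wordop A w) x)) has_sum qform (\<phi> ((\<phi> ^^ k) X)) x)
      ((\<lambda>(i, w). i # w) ` (SIGMA i:I. {w\<in>words. length w = k}))"
    by (rule has_sum_reindex[THEN iffD2, rotated]) (auto simp: inj_on_def)
  moreover have "(\<lambda>(i, w). i # w) ` (SIGMA i:I. {w\<in>words. length w = k}) = {w\<in>words. length w = Suc k}"
    by (auto simp: length_Suc_conv image_iff)
  ultimately show ?case
    by simp
qed

text \<open>The defect \<open>D = R - \<phi> R\<close> telescopes along the word length, so that \<open>R\<close> is recovered by
  summing \<open>A\<^sub>w D A\<^sub>w\<^sup>*\<close> over all words: the Poisson kernel of the row is an isometry.\<close>

lemma qform_defect_has_sum:
  assumes R: "opos R" and q: "0 \<le> q" "q < 1" and le: "\<And>x. qform (\<phi> R) x \<le> q * qform R x"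
    and D: "opos D" "D = (\<lambda>x. R x - \<phi> R x)"
  shows "((\<lambda>w. qform D (adj (wordop A w) x)) has_sum qform R x) words"
proof -
  note bR = opos_bop[OF R]
  define r where "r k = qform ((\<phi> ^^ k) R) x" for k
  have "(\<phi> ^^ k) D = (\<lambda>x. (\<phi> ^^ k) R x - (\<phi> ^^ Suc k) R x)" for k
    unfolding D(2) funpow_Suc_right comp_def by (rule phi_pow_diff[OF bR bop_phi[OF bR]])
  then have gk: "qform ((\<phi> ^^ k) D) x = r k - r (Suc k)" for k
    by (simp add: r_def hinner_diff_left)
  \<comment> \<open>Here \<open>q < 1\<close> enters: nothing of \<open>R\<close> is left in the
    limit of the powers.\<close>
  have "r \<longlonglongrightarrow> 0"
  proof (rule tendsto_sandwich[OF _ _ tendsto_const])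
    show "(\<lambda>k. q ^ k * qform R x) \<longlonglongrightarrow> 0"
      using q by (intro tendsto_mult_left_zero LIMSEQ_power_zero) simp
    show "eventually (\<lambda>k. 0 \<le> r k) sequentially"
      using opos_nonneg[OF opos_phi_pow[OF R]] by (simp add: r_def)
    show "eventually (\<lambda>k. r k \<le> q ^ k * qform R x) sequentially"
      using qform_phi_pow_geometric[OF bR q(1) le] by (simp add: r_def)
  qed
  from telescope_sums'[OF this] have "(\<lambda>k. qform ((\<phi> ^^ k) D) x) sums qform R x"
    by (simp add: gk r_def)
  then have g: "((\<lambda>k. qform ((\<phi> ^^ k) D) x) has_sum qform R x) UNIV"
    by (rule sums_nonneg_imp_has_sum) (rule opos_nonneg[OF opos_phi_pow[OF D(1)]])
  \<comment> \<open>Words are grouped by length. The first component of a pair repeats the length of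
    the second, so \<open>snd\<close> is a bijection onto the words.\<close>
  define f where "f p = qform D (adj (wordop A (snd p)) x)" for p :: "nat \<times> nat list"
  have fi: "((\<lambda>w. f (k, w)) has_sum qform ((\<phi> ^^ k) D) x) {w\<in>words. length w = k}" for k
    using qform_words_has_sum[OF D(1)] by (simp add: f_def)
  have "f summable_on (SIGMA k:UNIV. {w\<in>words. length w = k})"
    by (rule summable_on_SigmaI[OF fi has_sum_imp_summable[OF g]]) (simp add: f_def opos_nonneg[OF D(1)])
  then have "(f has_sum qform R x) (SIGMA k:UNIV. {w\<in>words. length w = k})"
    by (rule has_sum_SigmaI[OF fi g])
  moreover have "f = (\<lambda>w. qform D (adj (wordop A w) x)) \<circ> snd"
    by (simp add: f_def fun_eq_iff)
  moreover have "snd ` (SIGMA k:UNIV. {w\<in>words. length w = k}) = words"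
    by (force simp: image_iff)
  moreover have "inj_on snd (SIGMA k:(UNIV::nat set). {w\<in>words. length w = k})"
    by (auto simp: inj_on_def)
  ultimately show ?thesis
    using has_sum_reindex[of snd "SIGMA k:UNIV. {w\<in>words. length w = k}" "\<lambda>w. qform D (adj (wordop A w) x)"] by simp
qed

text \<open>The family \<open>S (adj (wordop A w) y)\<close> over all words is the Poisson kernel at
  \<open>y\<close>. It carries the adjoint of the matrix \<open>P\<close> at \<open>A\<close> to the
  adjoint of \<open>P\<close> at the creation operators. The part of the result on the words in
  \<open>B\<close> is paired with itself, and \<open>matnormS\<close> estimates the transposed
  matrix; only finite sums of vectors occur.\<close>

lemma von_Neumann_strict_finite:
  assumes S: "bop S"
    and G: "\<And>y. ((\<lambda>w. (hnorm (S (adj (wordop A w) y)))\<^sup>2) has_sum r y) words"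
    and P: "\<And>i j. i < m \<Longrightarrow> j < m \<Longrightarrow> ncpoly I (P i j)"
    and B: "finite B" "B \<subseteq> words"
  shows "(\<Sum>j<m. \<Sum>\<beta>\<in>B. (hnorm (S (adj (wordop A \<beta>) (\<Sum>i<m. adj (polyA A (P i j)) (y i)))))\<^sup>2)
    \<le> (matnormS I m P)\<^sup>2 * (\<Sum>i<m. r (y i))"
proof -
  define C where "C = (matnormS I m P)\<^sup>2"
  have C: "0 \<le> C"
    by (simp add: C_def)
  define K where "K = (\<Union>i<m. \<Union>j<m. {\<alpha>. P i j \<alpha> \<noteq> 0})"
  have K: "finite K" "K \<subseteq> words"
  proof -
    have "finite {\<alpha>. P i j \<alpha> \<noteq> 0} \<and> {\<alpha>. P i j \<alpha> \<noteq> 0} \<subseteq> words" if "i < m" "j < m" for i j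
      by (rule ncpoly_words[OF P[OF that]])
    then show "finite K" "K \<subseteq> words"
      unfolding K_def by (intro finite_UN_I UN_least; simp)+
  qed
  have suppK: "{\<alpha>. P i j \<alpha> \<noteq> 0} \<subseteq> K" if "i < m" "j < m" for i j
    using that by (auto simp: K_def)
  \<comment> \<open>The words that the polynomials reach from \<open>B\<close>; all nonzero rows of
    \<open>L\<close> below are indexed by them.\<close>
  define W where "W = (\<lambda>(\<alpha>, \<beta>). \<alpha> @ \<beta>) ` (K \<times> B)"
  have W: "finite W" "W \<subseteq> words"
    unfolding W_def using K B by (auto simp: subset_iff)
  define H where "H y w = S (adj (wordop A w) y)" for y w
  define x where "x j = (\<Sum>i<m. adj (polyA A (P i j)) (y i))" for j
  define F where "F v = H (x (fst v)) (snd v)" for v :: "nat \<times> nat list"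
  define U where "U = {..<m} \<times> W"
  define V where "V = {..<m} \<times> B"
  have V: "finite V"
    using B by (simp add: V_def)
  \<comment> \<open>The matrix of \<open>P\<close> at the creation operators, restricted to basis
    words in \<open>B\<close> on the input side.\<close>
  define L where "L u v = (\<Sum>\<alpha>\<in>K. if \<alpha> @ snd v = snd u then P (fst u) (fst v) \<alpha> else 0)"
    for u v :: "nat \<times> nat list"
  have contr: "(\<Sum>u\<in>U. (cmod (\<Sum>v\<in>V. L u v * c v))\<^sup>2) \<le> C * (\<Sum>v\<in>V. (cmod (c v))\<^sup>2)" for c
  proof -
    define \<xi> where "\<xi> j \<beta> = (if \<beta> \<in> B then c (j, \<beta>) else 0)" for j \<beta>
    have \<xi>0: "\<beta> \<notin> B \<Longrightarrow> \<xi> j \<beta> = 0" for j \<beta>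
      by (simp add: \<xi>_def)
    have l2: "l2fun (\<xi> j)" "(fnorm (\<xi> j))\<^sup>2 = (\<Sum>\<beta>\<in>B. (cmod (c (j, \<beta>)))\<^sup>2)" for j
      using l2fun_finite_support[of B "\<xi> j", OF B(1) \<xi>0] by (simp_all add: \<xi>_def)
    have fock: "fock I (\<xi> j)" for j
      using l2(1)[of j] B(2) by (auto simp: fock_def \<xi>_def split: if_splits)
    have "(\<Sum>v\<in>V. L (i, w) v * c v) = matS m P \<xi> i w" if i: "i < m" for i w
    proof -
      have "matS m P \<xi> i w = (\<Sum>j<m. \<Sum>\<beta>\<in>B. (\<Sum>\<alpha>\<in>K. if \<alpha> @ \<beta> = w then P i j \<alpha> else 0) * \<xi> j \<beta>)"
        unfolding matS_def
        by (intro sum.cong refl polyS_finite_support K(1) suppK B(1) \<xi>0) (use i in auto)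
      also have "\<dots> = (\<Sum>j<m. \<Sum>\<beta>\<in>B. L (i, w) (j, \<beta>) * c (j, \<beta>))"
        by (intro sum.cong refl) (simp add: L_def \<xi>_def cong: if_cong)
      also have "\<dots> = (\<Sum>v\<in>V. L (i, w) v * c v)"
        unfolding V_def sum.cartesian_product' ..
      finally show ?thesis
        by simp
    qed
    then have "(\<Sum>u\<in>U. (cmod (\<Sum>v\<in>V. L u v * c v))\<^sup>2) = (\<Sum>i<m. \<Sum>w\<in>W. (cmod (matS m P \<xi> i w))\<^sup>2)"
      unfolding U_def sum.cartesian_product' by (intro sum.cong refl) simp
    also have "\<dots> \<le> (\<Sum>i<m. (fnorm (matS m P \<xi> i))\<^sup>2)"
    proof (rule sum_mono)
      fix i assume "i \<in> {..<m}"
      then have "l2fun (matS m P \<xi> i)"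
        by (intro l2fun_matS[where I=I] P l2(1)) auto
      then show "(\<Sum>w\<in>W. (cmod (matS m P \<xi> i w))\<^sup>2) \<le> (fnorm (matS m P \<xi> i))\<^sup>2"
        unfolding fnorm_sq by (rule finite_sum_le_infsum) (use W in auto)
    qed
    also have "\<dots> \<le> C * (\<Sum>j<m. (fnorm (\<xi> j))\<^sup>2)"
      unfolding C_def by (rule matS_le_matnormS) (use P fock in auto)
    also have "(\<Sum>j<m. (fnorm (\<xi> j))\<^sup>2) = (\<Sum>v\<in>V. (cmod (c v))\<^sup>2)"
      unfolding V_def sum.cartesian_product' l2(2) ..
    finally show ?thesis .
  qed
  define s where "s = (\<Sum>v\<in>V. (hnorm (F v))\<^sup>2)"
  have amp: "(\<Sum>u\<in>U. (hnorm (\<Sum>v\<in>V. hscale (L u v) (F v)))\<^sup>2) \<le> C * s"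
    unfolding s_def by (rule scalar_matrix_ampliation[OF V contr])
  have F_eq: "F (j, \<beta>) = (\<Sum>i<m. \<Sum>\<alpha>\<in>K. hscale (cnj (P i j \<alpha>)) (H (y i) (\<alpha> @ \<beta>)))" if "j < m" "\<beta> \<in> B" for j \<beta>
  proof -
    have bT: "bop (\<lambda>z. H z \<beta>)"
      unfolding H_def by (rule bop_comp[OF S bop_adj[OF bop_wordop]]) (use that B in auto)
    have "F (j, \<beta>) = (\<Sum>i<m. H (adj (polyA A (P i j)) (y i)) \<beta>)"
      by (simp add: F_def x_def bop_sum[OF bT])
    also have "\<dots> = (\<Sum>i<m. \<Sum>\<alpha>\<in>K. hscale (cnj (P i j \<alpha>)) (H (y i) (\<alpha> @ \<beta>)))"
    proof (rule sum.cong[OF refl])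
      fix i assume "i \<in> {..<m}"
      then have i: "i < m" by simp
      have "adj (polyA A (P i j)) (y i) = (\<Sum>\<alpha>\<in>K. hscale (cnj (P i j \<alpha>)) (adj (wordop A \<alpha>) (y i)))"
        unfolding adj_polyA[OF P[OF i that(1)]]
        by (rule sum.mono_neutral_left) (use K suppK[OF i that(1)] in auto)
      then have "H (adj (polyA A (P i j)) (y i)) \<beta> = (\<Sum>\<alpha>\<in>K. hscale (cnj (P i j \<alpha>)) (H (adj (wordop A \<alpha>) (y i)) \<beta>))"
        by (simp add: bop_sum[OF bT] bop_scale[OF bT])
      also have "\<dots> = (\<Sum>\<alpha>\<in>K. hscale (cnj (P i j \<alpha>)) (H (y i) (\<alpha> @ \<beta>)))"
      proof (rule sum.cong[OF refl])
        fix \<alpha> assume "\<alpha> \<in> K"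
        then have "\<alpha> \<in> words" "\<beta> \<in> words"
          using K B that by auto
        then show "hscale (cnj (P i j \<alpha>)) (H (adj (wordop A \<alpha>) (y i)) \<beta>) = hscale (cnj (P i j \<alpha>)) (H (y i) (\<alpha> @ \<beta>))"
          by (simp add: H_def adj_wordop_append)
      qed
      finally show "H (adj (polyA A (P i j)) (y i)) \<beta> = (\<Sum>\<alpha>\<in>K. hscale (cnj (P i j \<alpha>)) (H (y i) (\<alpha> @ \<beta>)))" .
    qed
    finally show ?thesis .
  qed
  \<comment> \<open>\<open>F_eq\<close> writes \<open>F v\<close> through the conjugate entries of
    \<open>L\<close> applied to the kernel of \<open>y\<close>; inserting it in one slot of the
    pairing moves \<open>L\<close> to the other slot.\<close>
  have term_eq: "hinner (F v) (F v) = (\<Sum>u\<in>U. hinner (hscale (L u v) (F v)) (H (y (fst u)) (snd u)))" if vV: "v \<in> V" for v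
  proof -
    obtain j \<beta> where v: "v = (j, \<beta>)" and j: "j < m" and \<beta>: "\<beta> \<in> B"
      using vV by (auto simp: V_def)
    have "(\<Sum>u\<in>U. hinner (hscale (L u v) (F v)) (H (y (fst u)) (snd u)))
        = (\<Sum>i<m. \<Sum>w\<in>W. \<Sum>\<alpha>\<in>K. if \<alpha> @ \<beta> = w then P i j \<alpha> * hinner (F v) (H (y i) w) else 0)"
      unfolding U_def sum.cartesian_product'
      by (intro sum.cong refl) (auto simp: L_def v hinner_scale_left sum_distrib_right intro!: sum.cong)
    also have "\<dots> = (\<Sum>i<m. \<Sum>\<alpha>\<in>K. P i j \<alpha> * hinner (F v) (H (y i) (\<alpha> @ \<beta>)))"
    proof (rule sum.cong[OF refl])
      fix i assume "i \<in> {..<m}"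
      have "(\<Sum>w\<in>W. \<Sum>\<alpha>\<in>K. if \<alpha> @ \<beta> = w then P i j \<alpha> * hinner (F v) (H (y i) w) else 0)
          = (\<Sum>\<alpha>\<in>K. \<Sum>w\<in>W. if \<alpha> @ \<beta> = w then P i j \<alpha> * hinner (F v) (H (y i) w) else 0)"
        by (rule sum.swap)
      also have "\<dots> = (\<Sum>\<alpha>\<in>K. P i j \<alpha> * hinner (F v) (H (y i) (\<alpha> @ \<beta>)))"
      proof (rule sum.cong[OF refl])
        fix \<alpha> assume "\<alpha> \<in> K"
        then have "\<alpha> @ \<beta> \<in> W"
          using \<beta> by (force simp: W_def)
        then show "(\<Sum>w\<in>W. if \<alpha> @ \<beta> = w then P i j \<alpha> * hinner (F v) (H (y i) w) else 0)
            = P i j \<alpha> * hinner (F v) (H (y i) (\<alpha> @ \<beta>))"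
          using W(1) by simp
      qed
      finally show "(\<Sum>w\<in>W. \<Sum>\<alpha>\<in>K. if \<alpha> @ \<beta> = w then P i j \<alpha> * hinner (F v) (H (y i) w) else 0)
          = (\<Sum>\<alpha>\<in>K. P i j \<alpha> * hinner (F v) (H (y i) (\<alpha> @ \<beta>)))" .
    qed
    also have "\<dots> = hinner (F v) (\<Sum>i<m. \<Sum>\<alpha>\<in>K. hscale (cnj (P i j \<alpha>)) (H (y i) (\<alpha> @ \<beta>)))"
      by (simp add: hinner_sum_right hinner_scale_right)
    also have "\<dots> = hinner (F v) (F v)"
      unfolding v F_eq[OF j \<beta>] ..
    finally show ?thesis
      by simp
  qed
  have "complex_of_real s = (\<Sum>v\<in>V. hinner (F v) (F v))"
    by (simp add: s_def hinner_self)
  also have "\<dots> = (\<Sum>v\<in>V. \<Sum>u\<in>U. hinner (hscale (L u v) (F v)) (H (y (fst u)) (snd u)))"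
    by (rule sum.cong[OF refl term_eq])
  also have "\<dots> = (\<Sum>u\<in>U. hinner (\<Sum>v\<in>V. hscale (L u v) (F v)) (H (y (fst u)) (snd u)))"
    by (subst sum.swap) (simp add: hinner_sum_left)
  finally have "s = cmod (\<Sum>u\<in>U. hinner (\<Sum>v\<in>V. hscale (L u v) (F v)) (H (y (fst u)) (snd u)))"
    using norm_of_real[of s, where 'a=complex] by (simp add: s_def sum_nonneg)
  also have "\<dots> \<le> sqrt (C * s) * sqrt (\<Sum>i<m. r (y i))"
  proof (rule sum_hinner_le[OF amp])
    have "(\<Sum>u\<in>U. (hnorm (H (y (fst u)) (snd u)))\<^sup>2) = (\<Sum>i<m. \<Sum>w\<in>W. (hnorm (H (y i) w))\<^sup>2)"
      unfolding U_def sum.cartesian_product' by simp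
    also have "\<dots> \<le> (\<Sum>i<m. r (y i))"
      unfolding H_def by (intro sum_mono finite_sum_le_has_sum[OF G] W) simp
    finally show "(\<Sum>u\<in>U. (hnorm (H (y (fst u)) (snd u)))\<^sup>2) \<le> (\<Sum>i<m. r (y i))" .
  qed
  finally have "s \<le> sqrt (\<Sum>i<m. r (y i)) * sqrt (C * s)"
    by (simp add: mult.commute)
  then have "s \<le> C * (\<Sum>i<m. r (y i))"
  proof (rule le_of_le_sqrt_mult)
    show "0 \<le> (\<Sum>i<m. r (y i))"
      by (intro sum_nonneg has_sum_nonneg[OF G]) simp
  qed (simp_all add: C s_def sum_nonneg)
  moreover have "s = (\<Sum>j<m. \<Sum>\<beta>\<in>B. (hnorm (S (adj (wordop A \<beta>) (x j))))\<^sup>2)"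
    unfolding s_def V_def sum.cartesian_product' by (simp add: F_def H_def)
  ultimately show ?thesis
    by (simp add: C_def x_def)
qed

text \<open>Strictness makes the defect \<open>D\<close> coercive, so it has a root
  \<open>S\<close>, and the kernel built from it is isometric for the norm given by
  \<open>R\<close>. Passing between that norm and the original one costs \<open>b\<close> on one
  side and \<open>1 / a\<close> on the other.\<close>

lemma von_Neumann_strict:
  assumes R: "opos R" and a: "0 < a" and low: "\<And>x. a * (hnorm x)\<^sup>2 \<le> qform R x"
    and up: "\<And>x. qform R x \<le> b * (hnorm x)\<^sup>2"
    and q: "0 \<le> q" "q < 1" and le: "\<And>x. qform (\<phi> R) x \<le> q * qform R x"
    and P: "\<And>i j. i < m \<Longrightarrow> j < m \<Longrightarrow> ncpoly I (P i j)" and b: "0 \<le> b"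
  shows "(\<Sum>i<m. (hnorm (matA A m P h i))\<^sup>2) \<le> b / a * (matnormS I m P)\<^sup>2 * (\<Sum>j<m. (hnorm (h j))\<^sup>2)"
proof -
  note bR = opos_bop[OF R]
  define D where "D = (\<lambda>x. R x - \<phi> R x)"
  have qD: "(1 - q) * qform R x \<le> qform D x" for x
    using le[of x] by (simp add: D_def hinner_diff_left algebra_simps)
  have lowD: "(1 - q) * a * (hnorm x)\<^sup>2 \<le> qform D x" for x
  proof -
    have "(1 - q) * (a * (hnorm x)\<^sup>2) \<le> (1 - q) * qform R x"
      using q by (intro mult_left_mono low) simp
    then show ?thesis
      using qD[of x] by (simp add: mult.assoc)
  qed
  have oD: "opos D"
    unfolding opos_def
  proof (intro conjI allI)
    show "bop D"
      unfolding D_def by (rule bop_minus_op[OF bR bop_phi[OF bR]])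
    show "Im (hinner (D x) x) = 0" for x
      using hform_Im[OF opos_hform[OF R], of x] hform_Im[OF opos_hform[OF opos_phi[OF R]], of x]
      by (simp add: D_def hinner_diff_left)
    have "0 \<le> (1 - q) * qform R x" for x
      using q opos_nonneg[OF R] by simp
    then show "0 \<le> qform D x" for x
      using qD by (rule order_trans)
  qed
  have "0 < (1 - q) * a"
    using q a by simp
  then obtain S where S: "bop S" "\<And>x y. hinner (S x) y = hinner x (S y)" "\<And>x. S (S x) = D x"
    using sqrt_coercive[OF oD _ lowD] by metis
  have nS: "(hnorm (S z))\<^sup>2 = qform D z" for z
  proof -
    have "hinner (S z) (S z) = hinner (D z) z"
      using S(2)[of "S z" z] by (simp add: S(3))
    then show ?thesis
      by (simp add: hnorm_sq)
  qed
  have G: "((\<lambda>w. (hnorm (S (adj (wordop A w) z)))\<^sup>2) has_sum qform R z) words" for z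
    unfolding nS by (rule qform_defect_has_sum[OF R q le oD D_def])
  have dual: "(\<Sum>j<m. (hnorm (\<Sum>i<m. adj (polyA A (P i j)) (y i)))\<^sup>2)
      \<le> b / a * (matnormS I m P)\<^sup>2 * (\<Sum>i<m. (hnorm (y i))\<^sup>2)" for y
  proof -
    define x where "x j = (\<Sum>i<m. adj (polyA A (P i j)) (y i))" for j
    have "((\<lambda>\<beta>. \<Sum>j<m. (hnorm (S (adj (wordop A \<beta>) (x j))))\<^sup>2) has_sum (\<Sum>j<m. qform R (x j))) words"
      by (rule has_sum_finite_sum[OF finite_lessThan G])
    then have "(\<Sum>j<m. qform R (x j)) \<le> (matnormS I m P)\<^sup>2 * (\<Sum>i<m. qform R (y i))"
    proof (rule has_sum_le_finite_sums)
      fix B assume B: "finite B" "B \<subseteq> words"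
      have "(\<Sum>\<beta>\<in>B. \<Sum>j<m. (hnorm (S (adj (wordop A \<beta>) (x j))))\<^sup>2)
          = (\<Sum>j<m. \<Sum>\<beta>\<in>B. (hnorm (S (adj (wordop A \<beta>) (x j))))\<^sup>2)"
        by (rule sum.swap)
      also have "\<dots> \<le> (matnormS I m P)\<^sup>2 * (\<Sum>i<m. qform R (y i))"
        unfolding x_def by (rule von_Neumann_strict_finite[OF S(1) G P B])
      finally show "(\<Sum>\<beta>\<in>B. \<Sum>j<m. (hnorm (S (adj (wordop A \<beta>) (x j))))\<^sup>2)
          \<le> (matnormS I m P)\<^sup>2 * (\<Sum>i<m. qform R (y i))" .
    qed
    also have "\<dots> \<le> (matnormS I m P)\<^sup>2 * (\<Sum>i<m. b * (hnorm (y i))\<^sup>2)"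
      by (intro mult_left_mono sum_mono up) simp
    finally have *: "(\<Sum>j<m. qform R (x j)) \<le> (matnormS I m P)\<^sup>2 * (b * (\<Sum>i<m. (hnorm (y i))\<^sup>2))"
      by (simp add: sum_distrib_left)
    have "a * (\<Sum>j<m. (hnorm (x j))\<^sup>2) \<le> (\<Sum>j<m. qform R (x j))"
      unfolding sum_distrib_left by (intro sum_mono low)
    with * have "a * (\<Sum>j<m. (hnorm (x j))\<^sup>2) \<le> (matnormS I m P)\<^sup>2 * (b * (\<Sum>i<m. (hnorm (y i))\<^sup>2))"
      by simp
    then show ?thesis
      using a by (simp add: x_def field_simps)
  qed
  show ?thesis
    unfolding matA_def
    by (rule matrix_norm_dual[OF bop_polyA[OF P] _ dual]) (use a b in auto)
qed

end

section \<open>Matrix norms at the row, and radial approximation\<close>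

lemma matnormA_eq:
  "matnormA A m P = Sup ((\<lambda>h. sqrt (\<Sum>i<m. (hnorm (matA A m P h i))\<^sup>2)) ` {h. (\<Sum>j<m. (hnorm (h j))\<^sup>2) \<le> 1})"
  unfolding matnormA_def matA_def by (rule arg_cong[of _ _ Sup]) auto

lemma matnormA_le:
  assumes "\<And>h. (\<Sum>j<m. (hnorm (h j))\<^sup>2) \<le> 1 \<Longrightarrow> (\<Sum>i<m. (hnorm (matA A m P h i))\<^sup>2) \<le> C\<^sup>2" and "0 \<le> C"
  shows "matnormA A m P \<le> C"
  unfolding matnormA_eq
proof (rule cSup_least)
  have "(\<lambda>_. 0) \<in> {h :: nat \<Rightarrow> 'a. (\<Sum>j<m. (hnorm (h j))\<^sup>2) \<le> 1}"
    by simp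
  then show "(\<lambda>h. sqrt (\<Sum>i<m. (hnorm (matA A m P h i))\<^sup>2)) ` {h. (\<Sum>j<m. (hnorm (h j))\<^sup>2) \<le> 1} \<noteq> {}"
    unfolding image_is_empty by (intro notI) (simp only: empty_iff)
next
  fix r assume "r \<in> (\<lambda>h. sqrt (\<Sum>i<m. (hnorm (matA A m P h i))\<^sup>2)) ` {h. (\<Sum>j<m. (hnorm (h j))\<^sup>2) \<le> 1}"
  then obtain h where "h \<in> {h. (\<Sum>j<m. (hnorm (h j))\<^sup>2) \<le> 1}"
    and r: "r = sqrt (\<Sum>i<m. (hnorm (matA A m P h i))\<^sup>2)"
    by (elim imageE)
  then have "(\<Sum>i<m. (hnorm (matA A m P h i))\<^sup>2) \<le> C\<^sup>2"
    by (intro assms(1)[of h]) simp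
  then show "r \<le> C"
    unfolding r by (rule real_le_lsqrt[OF assms(2)])
qed

lemma tendsto_hnorm_zero:
  "(\<lambda>n. hnorm (X n - L)) \<longlonglongrightarrow> 0 \<Longrightarrow> (\<lambda>n. hnorm (X n)) \<longlonglongrightarrow> hnorm L"
  by (rule LIM_zero_cancel, rule Lim_null_comparison[rotated], assumption)
    (intro always_eventually allI, simp add: hnorm_reverse_triangle)

lemma tendsto_hnorm_sum_diff:
  assumes "\<And>k. k \<in> K \<Longrightarrow> (\<lambda>n. hnorm (X k n - L k)) \<longlonglongrightarrow> 0"
  shows "(\<lambda>n. hnorm ((\<Sum>k\<in>K. X k n) - (\<Sum>k\<in>K. L k))) \<longlonglongrightarrow> 0"
proof (rule Lim_null_comparison)
  show "(\<lambda>n. \<Sum>k\<in>K. hnorm (X k n - L k)) \<longlonglongrightarrow> 0"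
    by (rule tendsto_null_sum[OF assms])
  have "norm (hnorm ((\<Sum>k\<in>K. X k n) - (\<Sum>k\<in>K. L k))) \<le> (\<Sum>k\<in>K. hnorm (X k n - L k))" for n
    using hnorm_sum[of "\<lambda>k. X k n - L k" K] by (simp add: sum_subtractf)
  then show "eventually (\<lambda>n. norm (hnorm ((\<Sum>k\<in>K. X k n) - (\<Sum>k\<in>K. L k))) \<le> (\<Sum>k\<in>K. hnorm (X k n - L k))) sequentially"
    by simp
qed

context row_operator
begin

lemma bdd_above_matnormA:
  assumes P: "\<And>i j. i < m \<Longrightarrow> j < m \<Longrightarrow> ncpoly I (P i j)"
  shows "bdd_above ((\<lambda>h. sqrt (\<Sum>i<m. (hnorm (matA A m P h i))\<^sup>2)) ` {h. (\<Sum>j<m. (hnorm (h j))\<^sup>2) \<le> 1})"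
proof (rule bdd_aboveI2)
  fix h :: "nat \<Rightarrow> 'a" assume "h \<in> {h. (\<Sum>j<m. (hnorm (h j))\<^sup>2) \<le> 1}"
  then have h: "(\<Sum>j<m. (hnorm (h j))\<^sup>2) \<le> 1"
    by simp
  have h1: "hnorm (h j) \<le> 1" if "j < m" for j
  proof -
    have "(hnorm (h j))\<^sup>2 \<le> (\<Sum>j<m. (hnorm (h j))\<^sup>2)"
      by (rule member_le_sum) (use that in auto)
    then have "(hnorm (h j))\<^sup>2 \<le> 1\<^sup>2"
      using h by simp
    then show ?thesis
      by (rule power2_le_imp_le) simp
  qed
  show "sqrt (\<Sum>i<m. (hnorm (matA A m P h i))\<^sup>2) \<le> sqrt (\<Sum>i<m. (\<Sum>j<m. opnorm (polyA A (P i j)))\<^sup>2)"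
  proof (intro real_sqrt_le_mono sum_mono power_mono hnorm_nonneg)
    fix i assume i: "i \<in> {..<m}"
    have "hnorm (matA A m P h i) \<le> (\<Sum>j<m. hnorm (polyA A (P i j) (h j)))"
      unfolding matA_def by (rule hnorm_sum)
    also have "\<dots> \<le> (\<Sum>j<m. opnorm (polyA A (P i j)))"
    proof (rule sum_mono)
      fix j assume j: "j \<in> {..<m}"
      have bP: "bop (polyA A (P i j))"
        by (rule bop_polyA[OF P]) (use i j in auto)
      have "hnorm (polyA A (P i j) (h j)) \<le> opnorm (polyA A (P i j)) * hnorm (h j)"
        by (rule hnorm_le_opnorm[OF bP])
      also have "\<dots> \<le> opnorm (polyA A (P i j))"
        using h1 j opnorm_nonneg[OF bP] by (simp add: mult_left_le)
      finally show "hnorm (polyA A (P i j) (h j)) \<le> opnorm (polyA A (P i j))" .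
    qed
    finally show "hnorm (matA A m P h i) \<le> (\<Sum>j<m. opnorm (polyA A (P i j)))" .
  qed
qed

lemma matnormA_nonneg:
  assumes P: "\<And>i j. i < m \<Longrightarrow> j < m \<Longrightarrow> ncpoly I (P i j)"
  shows "0 \<le> matnormA A m P"
proof -
  have "sqrt (\<Sum>i<m. (hnorm (matA A m P (\<lambda>_. 0) i))\<^sup>2) \<le> matnormA A m P"
    unfolding matnormA_eq by (rule cSup_upper[OF _ bdd_above_matnormA[where P=P, OF P]]) auto
  moreover have "0 \<le> sqrt (\<Sum>i<m. (hnorm (matA A m P (\<lambda>_. 0) i))\<^sup>2)"
    by (simp add: sum_nonneg)
  ultimately show ?thesis
    by (rule order_trans[rotated])
qed

lemma matA_le_matnormA:
  assumes P: "\<And>i j. i < m \<Longrightarrow> j < m \<Longrightarrow> ncpoly I (P i j)"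
  shows "(\<Sum>i<m. (hnorm (matA A m P h i))\<^sup>2) \<le> (matnormA A m P)\<^sup>2 * (\<Sum>j<m. (hnorm (h j))\<^sup>2)"
proof -
  define s where "s = (\<Sum>j<m. (hnorm (h j))\<^sup>2)"
  have s: "0 \<le> s"
    by (simp add: s_def sum_nonneg)
  show ?thesis
  proof (cases "s = 0")
    case True
    then have h: "h j = 0" if "j < m" for j
      using that sum_nonneg_eq_0_iff[of "{..<m}" "\<lambda>j. (hnorm (h j))\<^sup>2"] by (simp add: s_def)
    have "matA A m P h i = 0" if "i < m" for i
      unfolding matA_def by (rule sum.neutral) (use h that in \<open>simp add: bop_zero[OF bop_polyA[OF P]]\<close>)
    then show ?thesis
      using True by (simp add: s_def)
  next
    case False
    with s have s: "s > 0"
      by simp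
    define c where "c = complex_of_real (1 / sqrt s)"
    have c: "(cmod c)\<^sup>2 = 1 / s"
      using s by (auto simp: c_def norm_divide power_divide)
    define g where "g j = hscale c (h j)" for j
    have g: "(\<Sum>j<m. (hnorm (g j))\<^sup>2) = 1"
    proof -
      have "(\<Sum>j<m. (hnorm (g j))\<^sup>2) = 1 / s * s"
        unfolding g_def hnorm_scale power_mult_distrib c s_def[symmetric] sum_distrib_left[symmetric] ..
      then show ?thesis
        using s by simp
    qed
    have mg: "matA A m P g i = hscale c (matA A m P h i)" if "i < m" for i
      unfolding matA_def g_def hscale_sum_right
      by (rule sum.cong[OF refl]) (use that in \<open>simp add: bop_scale[OF bop_polyA[OF P]]\<close>)
    have "sqrt (\<Sum>i<m. (hnorm (matA A m P g i))\<^sup>2) \<le> matnormA A m P"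
      unfolding matnormA_eq
    proof (rule cSup_upper)
      show "bdd_above ((\<lambda>h. sqrt (\<Sum>i<m. (hnorm (matA A m P h i))\<^sup>2)) ` {h. (\<Sum>j<m. (hnorm (h j))\<^sup>2) \<le> 1})"
        by (rule bdd_above_matnormA[where P=P, OF P])
    qed (use g in auto)
    then have "(\<Sum>i<m. (hnorm (matA A m P g i))\<^sup>2) \<le> (matnormA A m P)\<^sup>2"
      by (rule sqrt_le_D)
    moreover have "(\<Sum>i<m. (hnorm (matA A m P g i))\<^sup>2) = (\<Sum>i<m. (hnorm (matA A m P h i))\<^sup>2) / s"
      by (simp add: mg hnorm_scale power_mult_distrib c sum_divide_distrib)
    ultimately show ?thesis
      using s by (simp add: pos_divide_le_eq flip: s_def)
  qed
qed

lemma row_operator_scaled: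
  assumes "0 \<le> r" "r \<le> 1"
  shows "row_operator (\<lambda>i x. hscale (complex_of_real r) (A i x)) I K"
proof
  show "bop (\<lambda>x. hscale (complex_of_real r) (A i x))" if "i \<in> I" for i
    by (rule bop_scaled[OF bop_A[OF that]])
  show "0 \<le> K"
    by (rule K_nonneg)
  fix J :: "nat set" and x assume J: "finite J" "J \<subseteq> I"
  have "(\<Sum>i\<in>J. (hnorm (adj (\<lambda>x. hscale (complex_of_real r) (A i x)) x))\<^sup>2) \<le> (\<Sum>i\<in>J. (hnorm (adj (A i) x))\<^sup>2)"
  proof (intro sum_mono power_mono hnorm_nonneg)
    fix i assume "i \<in> J"
    then have "bop (A i)"
      using J bop_A by blast
    then show "hnorm (adj (\<lambda>x. hscale (complex_of_real r) (A i x)) x) \<le> hnorm (adj (A i) x)"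
      using assms by (simp add: adj_scaled hnorm_scale mult_left_le_one_le)
  qed
  also have "\<dots> \<le> K * (hnorm x)\<^sup>2"
    by (rule row_bound[OF J])
  finally show "(\<Sum>i\<in>J. (hnorm (adj (\<lambda>x. hscale (complex_of_real r) (A i x)) x))\<^sup>2) \<le> K * (hnorm x)\<^sup>2" .
qed

lemma phi_scaled:
  assumes r: "0 \<le> r" "r \<le> 1" and X: "bop X"
  shows "phiA (\<lambda>i x. hscale (complex_of_real r) (A i x)) I X = (\<lambda>x. hscale (complex_of_real (r\<^sup>2)) (\<phi> X x))"
proof (rule row_operator.phi_eqI[OF row_operator_scaled[OF r] X])
  fix x y
  have "((\<lambda>i. complex_of_real (r\<^sup>2) * hinner (X (adj (A i) x)) (adj (A i) y)) has_sum
      complex_of_real (r\<^sup>2) * hinner (\<phi> X x) y) I"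
    by (rule has_sum_cmult_right[OF phi_has_sum[OF X]])
  then have "((\<lambda>i. hinner (X (adj (\<lambda>x. hscale (complex_of_real r) (A i x)) x)) (adj (\<lambda>x. hscale (complex_of_real r) (A i x)) y))
      has_sum complex_of_real (r\<^sup>2) * hinner (\<phi> X x) y) I"
    by (rule has_sum_cong[THEN iffD1, rotated])
      (simp add: adj_scaled[OF bop_A] bop_scale[OF X] hinner_scale_left hinner_scale_right power2_eq_square)
  then show "((\<lambda>i. hinner (X (adj (\<lambda>x. hscale (complex_of_real r) (A i x)) x)) (adj (\<lambda>x. hscale (complex_of_real r) (A i x)) y))
      has_sum hinner (hscale (complex_of_real (r\<^sup>2)) (\<phi> X x)) y) I"
    by (simp add: hinner_scale_left)
qed

lemma wordop_scaled:
  "\<alpha> \<in> words \<Longrightarrow> wordop (\<lambda>i x. hscale c (A i x)) \<alpha> x = hscale (c ^ length \<alpha>) (wordop A \<alpha> x)"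
proof (induction \<alpha>)
  case (Cons i \<alpha>)
  then have "bop (A i)" "\<alpha> \<in> words"
    using bop_A by auto
  then show ?case
    using Cons.IH by (simp add: wordop_Cons bop_scale hscale_hscale)
qed (simp add: wordop_Nil hscale_one)

lemma polyA_scaled_tendsto:
  assumes p: "ncpoly I p" and r: "r \<longlonglongrightarrow> 1"
  shows "(\<lambda>n. hnorm (polyA (\<lambda>i x. hscale (complex_of_real (r n)) (A i x)) p x - polyA A p x)) \<longlonglongrightarrow> 0"
  unfolding polyA_def
proof (rule tendsto_hnorm_sum_diff)
  fix \<alpha> assume "\<alpha> \<in> {\<alpha>. p \<alpha> \<noteq> 0}"
  then have \<alpha>: "\<alpha> \<in> words"
    using p by (auto simp: ncpoly_def)
  have eq: "hscale (p \<alpha>) (wordop (\<lambda>i x. hscale (complex_of_real (r n)) (A i x)) \<alpha> x) - hscale (p \<alpha>) (wordop A \<alpha> x)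
      = hscale (p \<alpha> * (complex_of_real (r n) ^ length \<alpha> - 1)) (wordop A \<alpha> x)" for n
    by (simp add: wordop_scaled[OF \<alpha>] hscale_hscale algebra_simps hscale_diff_left)
  have "(\<lambda>n. complex_of_real (r n) ^ length \<alpha>) \<longlonglongrightarrow> complex_of_real 1 ^ length \<alpha>"
    by (intro tendsto_power tendsto_of_real r)
  then have "(\<lambda>n. complex_of_real (r n) ^ length \<alpha> - 1) \<longlonglongrightarrow> 0"
    by (simp add: LIM_zero)
  then have "(\<lambda>n. cmod (p \<alpha> * (complex_of_real (r n) ^ length \<alpha> - 1)) * hnorm (wordop A \<alpha> x)) \<longlonglongrightarrow> 0"
    by (intro tendsto_mult_left_zero tendsto_norm_zero tendsto_mult_right_zero)
  then show "(\<lambda>n. hnorm (hscale (p \<alpha>) (wordop (\<lambda>i x. hscale (complex_of_real (r n)) (A i x)) \<alpha> x)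
      - hscale (p \<alpha>) (wordop A \<alpha> x))) \<longlonglongrightarrow> 0"
    unfolding eq hnorm_scale .
qed

lemma von_Neumann:
  assumes R: "opos R" and a: "0 < a" and low: "\<And>x. a * (hnorm x)\<^sup>2 \<le> qform R x"
    and up: "\<And>x. qform R x \<le> b * (hnorm x)\<^sup>2" and b: "0 \<le> b"
    and le: "\<And>x. qform (\<phi> R) x \<le> qform R x"
    and P: "\<And>i j. i < m \<Longrightarrow> j < m \<Longrightarrow> ncpoly I (P i j)"
  shows "(\<Sum>i<m. (hnorm (matA A m P h i))\<^sup>2) \<le> b / a * (matnormS I m P)\<^sup>2 * (\<Sum>j<m. (hnorm (h j))\<^sup>2)"
proof (rule LIMSEQ_le_const2)
  \<comment> \<open>Scaling the row by \<open>r n < 1\<close> multiplies \<open>\<phi>\<close> by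
    \<open>(r n)\<^sup>2\<close>, which provides the strict factor \<open>q\<close>; polynomials
    have finitely many terms, so the limit can be taken word by word.\<close>
  define r where "r n = real n / real (Suc n)" for n
  define B where "B n i x = hscale (complex_of_real (r n)) (A i x)" for n i x
  have r: "0 \<le> r n" "r n < 1" for n
    by (auto simp: r_def)
  have r1: "r \<longlonglongrightarrow> 1"
    unfolding r_def by (rule LIMSEQ_n_over_Suc_n)
  have "(\<lambda>n. hnorm (matA (B n) m P h i - matA A m P h i)) \<longlonglongrightarrow> 0" if "i < m" for i
    unfolding matA_def B_def
    by (intro tendsto_hnorm_sum_diff polyA_scaled_tendsto r1 P) (use that in auto)
  then show "(\<lambda>n. \<Sum>i<m. (hnorm (matA (B n) m P h i))\<^sup>2) \<longlonglongrightarrow> (\<Sum>i<m. (hnorm (matA A m P h i))\<^sup>2)"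
    by (intro tendsto_sum tendsto_power tendsto_hnorm_zero) simp
  have "(\<Sum>i<m. (hnorm (matA (B n) m P h i))\<^sup>2) \<le> b / a * (matnormS I m P)\<^sup>2 * (\<Sum>j<m. (hnorm (h j))\<^sup>2)" for n
    unfolding B_def
  proof (rule row_operator.von_Neumann_strict[OF row_operator_scaled R a low up _ _ _ P b])
    show "0 \<le> r n" "r n \<le> 1" "0 \<le> (r n)\<^sup>2" "(r n)\<^sup>2 < 1"
      using r[of n] by (auto simp: power_less_one_iff abs_square_less_1)
    have "qform (phiA (\<lambda>i x. hscale (complex_of_real (r n)) (A i x)) I R) x = (r n)\<^sup>2 * qform (\<phi> R) x" for x
      using r[of n] by (simp add: phi_scaled[OF _ _ opos_bop[OF R]] hinner_scale_left flip: of_real_power)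
    then show "qform (phiA (\<lambda>i x. hscale (complex_of_real (r n)) (A i x)) I R) x \<le> (r n)\<^sup>2 * qform R x" for x
      using le[of x] by (simp add: mult_left_mono)
  qed
  then show "\<exists>N. \<forall>n\<ge>N. (\<Sum>i<m. (hnorm (matA (B n) m P h i))\<^sup>2)
      \<le> b / a * (matnormS I m P)\<^sup>2 * (\<Sum>j<m. (hnorm (h j))\<^sup>2)"
    by blast
qed

lemma superharmonic_cb_bound:
  assumes R: "opos R" "ople (\<phi> R) R" and a: "0 < a" "a \<le> b"
    and low: "\<And>x. a * (hnorm x)\<^sup>2 \<le> qform R x" and up: "\<And>x. qform R x \<le> b * (hnorm x)\<^sup>2"
  shows "cb_bound A I (sqrt (b / a))"
  unfolding cb_bound_def
proof (intro allI impI)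
  fix m :: nat and P :: "nat \<Rightarrow> nat \<Rightarrow> nat list \<Rightarrow> complex"
  assume "\<forall>i<m. \<forall>j<m. ncpoly I (P i j)"
  then have P: "ncpoly I (P i j)" if "i < m" "j < m" for i j
    using that by blast
  have le: "qform (\<phi> R) x \<le> qform R x" for x
    using R(2) ople_iff[OF opos_phi[OF R(1)] R(1)] by blast
  have S: "0 \<le> matnormS I m P"
    by (rule matnormS_nonneg[where P=P, OF P])
  show "matnormA A m P \<le> sqrt (b / a) * matnormS I m P"
  proof (rule matnormA_le)
    show "0 \<le> sqrt (b / a) * matnormS I m P"
      using S a by simp
    fix h :: "nat \<Rightarrow> 'a" assume h: "(\<Sum>j<m. (hnorm (h j))\<^sup>2) \<le> 1"
    have "(\<Sum>i<m. (hnorm (matA A m P h i))\<^sup>2) \<le> b / a * (matnormS I m P)\<^sup>2 * (\<Sum>j<m. (hnorm (h j))\<^sup>2)"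
      by (rule von_Neumann[OF R(1) a(1) low up _ le P]) (use a in auto)
    also have "\<dots> \<le> b / a * (matnormS I m P)\<^sup>2"
      using h a by (intro mult_left_le) auto
    also have "\<dots> = (sqrt (b / a) * matnormS I m P)\<^sup>2"
      using a by (simp add: power_mult_distrib)
    finally show "(\<Sum>i<m. (hnorm (matA A m P h i))\<^sup>2) \<le> (sqrt (b / a) * matnormS I m P)\<^sup>2" .
  qed
qed

end

section \<open>Farkas' lemma and Douglas' factorization\<close>

text \<open>Induction over the coordinates stands in for a separation theorem, so the subspace may
  come from an infinite-dimensional space of forms. A coordinate \<open>k\<close> on which
  \<open>L\<close> does not vanish is eliminated with an element \<open>e\<close> such that
  \<open>e k = 1\<close>: the other coordinates are treated for the members of \<open>L\<close> that
  vanish at \<open>k\<close>.\<close>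

lemma Farkas_subspace:
  fixes L :: "('i \<Rightarrow> real) set"
  assumes "finite F" and zero: "(\<lambda>_. 0) \<in> L"
    and lin: "\<And>f g s t. f \<in> L \<Longrightarrow> g \<in> L \<Longrightarrow> (\<lambda>i. s * f i + t * g i) \<in> L"
  shows "(\<exists>f\<in>L. \<forall>i\<in>F. c i \<le> f i) \<or>
    (\<exists>w. (\<forall>i\<in>F. 0 \<le> w i) \<and> (\<forall>f\<in>L. (\<Sum>i\<in>F. w i * f i) = 0) \<and> 0 < (\<Sum>i\<in>F. w i * c i))"
  using assms
proof (induction F arbitrary: L c rule: finite_induct)
  case empty
  then show ?case
    by auto
next
  case (insert k F)
  let ?dual = "\<lambda>G w. (\<forall>i\<in>G. 0 \<le> w i) \<and> (\<forall>f\<in>L. (\<Sum>i\<in>G. w i * f i) = 0) \<and> 0 < (\<Sum>i\<in>G. w i * c i)"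
  have sum_upd: "(\<Sum>i\<in>insert k F. (w(k := z)) i * f i) = z * f k + (\<Sum>i\<in>F. w i * f i)" for w f :: "'i \<Rightarrow> real" and z
  proof -
    have "(\<Sum>i\<in>F. (w(k := z)) i * f i) = (\<Sum>i\<in>F. w i * f i)"
      by (rule sum.cong[OF refl]) (use insert.hyps in auto)
    then show ?thesis
      using insert.hyps by simp
  qed
  show ?case
  proof (rule ccontr)
    assume neg: "\<not> ((\<exists>f\<in>L. \<forall>i\<in>insert k F. c i \<le> f i) \<or> (\<exists>w. ?dual (insert k F) w))"
    then have infeasible: "\<exists>i\<in>insert k F. f i < c i" if "f \<in> L" for f
      using that by (meson not_le)
    have no_dual: "False" if "?dual (insert k F) w" for w
      using neg that by blast
    have no_dual': "False" if "?dual F w" for w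
    proof (rule no_dual[of "w(k := 0)"], intro conjI ballI)
      show "0 \<le> (w(k := 0)) i" if "i \<in> insert k F" for i
        using that \<open>?dual F w\<close> by auto
    qed (use that in \<open>simp_all only: sum_upd, simp_all\<close>)
    have "(\<exists>f\<in>L. \<forall>i\<in>F. c i \<le> f i) \<or> (\<exists>w. ?dual F w)"
      by (rule insert.IH[OF insert.prems])
    then obtain f0 where f0: "f0 \<in> L" "\<And>i. i \<in> F \<Longrightarrow> c i \<le> f0 i"
      using no_dual' by auto
    then have f0k: "f0 k < c k"
      using infeasible[OF f0(1)] by (force simp: not_le[symmetric])
    show False
    proof (cases "\<exists>e\<in>L. e k \<noteq> 0")
      case False
      then have z: "f k = 0" if "f \<in> L" for f
        using that by blast
      have "c k > 0"
        using f0k z[OF f0(1)] by simp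
      show False
      proof (rule no_dual[of "(\<lambda>_. 0)(k := 1)"], intro conjI ballI)
        show "0 \<le> ((\<lambda>_. 0)(k := 1 :: real)) i" for i
          by simp
      qed (use z \<open>c k > 0\<close> in \<open>simp_all only: sum_upd, simp_all\<close>)
    next
      case True
      then obtain e0 where e0: "e0 \<in> L" "e0 k \<noteq> 0"
        by blast
      \<comment> \<open>The vacuous second summand brings a scalar multiple into the shape of the
        closure condition on \<open>L\<close>.\<close>
      define e where "e = (\<lambda>i. 1 / e0 k * e0 i + 0 * e0 i)"
      have e: "e \<in> L" "e k = 1"
        using insert.prems(2)[OF e0(1) e0(1), of "1 / e0 k" 0] e0(2) by (simp_all add: e_def)
      define L0 where "L0 = {f \<in> L. f k = 0}"
      have L0: "(\<lambda>_. 0) \<in> L0" "\<And>f g s t. f \<in> L0 \<Longrightarrow> g \<in> L0 \<Longrightarrow> (\<lambda>i. s * f i + t * g i) \<in> L0"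
        using insert.prems by (auto simp: L0_def)
      from insert.IH[OF L0, of "\<lambda>i. c i - c k * e i"]
      consider (feasible) f where "f \<in> L0" "\<And>i. i \<in> F \<Longrightarrow> c i - c k * e i \<le> f i"
        | (dual) w where "\<And>i. i \<in> F \<Longrightarrow> 0 \<le> w i" "\<And>f. f \<in> L0 \<Longrightarrow> (\<Sum>i\<in>F. w i * f i) = 0"
          "0 < (\<Sum>i\<in>F. w i * (c i - c k * e i))"
        by auto
      then show False
      proof cases
        case feasible
        then have "(\<lambda>i. c k * e i + 1 * f i) \<in> L" "f k = 0"
          using insert.prems(2)[OF e(1), of f "c k" 1] by (simp_all add: L0_def)
        from infeasible[OF this(1)] show False
          using feasible(2) e(2) \<open>f k = 0\<close> by (auto simp: not_le[symmetric] algebra_simps)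
      next
        case dual
        \<comment> \<open>On \<open>L\<close> the multiplier found for \<open>F\<close> equals
          \<open>\<kappa>\<close> times evaluation at \<open>k\<close>, so \<open>- \<kappa>\<close>
          is the weight to be given to \<open>k\<close>. Its sign follows by comparison with
          \<open>f0\<close>, which violates only the constraint at \<open>k\<close>.\<close>
        define \<kappa> where "\<kappa> = (\<Sum>i\<in>F. w i * e i)"
        have wf: "(\<Sum>i\<in>F. w i * f i) = \<kappa> * f k" if "f \<in> L" for f
        proof -
          have "(\<lambda>i. 1 * f i + (- f k) * e i) \<in> L0"
            using insert.prems(2)[OF that e(1), of 1 "- f k"] e(2) by (simp add: L0_def)
          from dual(2)[OF this] show ?thesis
            by (simp add: \<kappa>_def sum_subtractf right_diff_distrib sum_distrib_left mult.commute mult.left_commute)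
        qed
        have wc: "c k * \<kappa> < (\<Sum>i\<in>F. w i * c i)"
          using dual(3) by (simp add: \<kappa>_def sum_subtractf right_diff_distrib sum_distrib_left mult.left_commute)
        have "\<kappa> \<le> 0"
        proof (rule ccontr)
          assume "\<not> \<kappa> \<le> 0"
          have "(\<Sum>i\<in>F. w i * c i) \<le> (\<Sum>i\<in>F. w i * f0 i)"
            by (intro sum_mono mult_left_mono f0 dual)
          then have "c k * \<kappa> < f0 k * \<kappa>"
            using wc wf[OF f0(1)] by (simp add: mult.commute)
          then show False
            using f0k \<open>\<not> \<kappa> \<le> 0\<close> by (simp add: mult_less_cancel_right)
        qed
        show False
        proof (rule no_dual[of "w(k := - \<kappa>)"], intro conjI ballI)
          show "0 \<le> (w(k := - \<kappa>)) i" if "i \<in> insert k F" for i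
            using that dual(1) \<open>\<kappa> \<le> 0\<close> by auto
          show "(\<Sum>i\<in>insert k F. (w(k := - \<kappa>)) i * f i) = 0" if "f \<in> L" for f
            unfolding sum_upd using wf[OF that] by simp
          show "0 < (\<Sum>i\<in>insert k F. (w(k := - \<kappa>)) i * c i)"
            unfolding sum_upd using wc by (simp add: mult.commute)
        qed
      qed
    qed
  qed
qed

section \<open>Frame operators of finite families\<close>

definition frame_op :: "'b set \<Rightarrow> ('b \<Rightarrow> 'a::chilbert) \<Rightarrow> 'a \<Rightarrow> 'a" where
  "frame_op J y z = (\<Sum>b\<in>J. hscale (hinner z (y b)) (y b))"

lemma frame_op_add: "frame_op J y (u + v) = frame_op J y u + frame_op J y v"
  by (simp add: frame_op_def hinner_add_left hscale_add_left sum.distrib)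

lemma frame_op_scale: "frame_op J y (hscale c u) = hscale c (frame_op J y u)"
  by (simp add: frame_op_def hinner_scale_left hscale_sum_right hscale_hscale)

lemma frame_op_diff: "frame_op J y (u - v) = frame_op J y u - frame_op J y v"
  by (simp add: frame_op_def hinner_diff_left hscale_diff_left sum_subtractf)

lemma frame_op_sum: "frame_op J y (\<Sum>k\<in>K. u k) = (\<Sum>k\<in>K. frame_op J y (u k))"
proof (induction K rule: infinite_finite_induct)
  case (insert k K)
  then show ?case
    by (simp add: frame_op_add)
qed (simp_all add: frame_op_def)

lemma hinner_frame_op: "hinner (frame_op J y z) z = complex_of_real (\<Sum>b\<in>J. (cmod (hinner (y b) z))\<^sup>2)"
proof -
  have "hinner z (y b) * hinner (y b) z = complex_of_real ((cmod (hinner (y b) z))\<^sup>2)" for b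
    using hinner_commute[of z "y b"] complex_norm_square[of "hinner (y b) z"] by (simp add: mult.commute)
  then show ?thesis
    by (simp add: frame_op_def hinner_sum_left hinner_scale_left)
qed

text \<open>The two claims are proved together. The second provides the orthogonal projection onto
  the span of the old vectors, which splits a new vector into a part \<open>d\<close> orthogonal to
  them and a part in the range of the old frame operator. No basis has to be chosen.\<close>

lemma frame_op_range:
  assumes "finite J"
  shows "(\<forall>b\<in>J. \<exists>v. frame_op J y v = y b) \<and> (\<forall>z. \<exists>w. \<forall>b\<in>J. hinner (z - frame_op J y w) (y b) = 0)"
  using assms
proof (induction J rule: finite_induct)
  case empty
  then show ?case
    by simp
next
  case (insert k J)
  let ?G = "frame_op J y" and ?H = "frame_op (insert k J) y"
  have H: "?H z = hscale (hinner z (y k)) (y k) + ?G z" for z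
    using insert.hyps by (simp add: frame_op_def)
  have orth: "hinner z (?G w) = 0" if "\<And>b. b \<in> J \<Longrightarrow> hinner z (y b) = 0" for z w
    by (simp add: frame_op_def hinner_sum_right hinner_scale_right that)
  have Gy: "\<exists>v. ?G v = y b" if "b \<in> J" for b
    using insert.IH that by blast
  have res: "\<exists>w. \<forall>b\<in>J. hinner (z - ?G w) (y b) = 0" for z
    using insert.IH by blast
  obtain w where w: "\<And>b. b \<in> J \<Longrightarrow> hinner (y k - ?G w) (y b) = 0"
    using res by blast
  define d where "d = y k - ?G w"
  have "\<exists>u. ?H u = y k"
  proof (cases "d = 0")
    \<comment> \<open>The new vector already lies in the old range. The new operator then maps
      \<open>w\<close> to \<open>1 + t\<close> times it, and \<open>t \<ge> 0\<close> keeps this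
      factor away from 0.\<close>
    case True
    then have Gw: "?G w = y k"
      by (simp add: d_def)
    define t where "t = (\<Sum>b\<in>J. (cmod (hinner (y b) w))\<^sup>2)"
    have t: "hinner w (y k) = complex_of_real t"
      using hinner_frame_op[of J y w] hinner_commute[of w "y k"] by (simp add: Gw t_def)
    have "1 + t \<noteq> 0"
      using sum_nonneg[of J "\<lambda>b. (cmod (hinner (y b) w))\<^sup>2"] by (simp add: t_def add_nonneg_eq_0_iff)
    then have t1: "complex_of_real (1 / (1 + t)) * (complex_of_real t + 1) = 1"
      by (metis add.commute nonzero_divide_eq_eq of_real_1 of_real_add of_real_mult)
    have "?H (hscale (complex_of_real (1 / (1 + t))) w) = hscale (complex_of_real (1 / (1 + t)) * (complex_of_real t + 1)) (y k)"
      unfolding frame_op_scale H Gw t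
      by (simp add: hscale_add_right hscale_add_left hscale_hscale hscale_one distrib_left)
    then have "?H (hscale (complex_of_real (1 / (1 + t))) w) = y k"
      unfolding t1 hscale_one .
    then show ?thesis
      by blast
  next
    \<comment> \<open>The old operator kills \<open>d\<close>, so the new one maps \<open>d\<close>
      to \<open>hinner d d\<close> times the new vector.\<close>
    case False
    have "hinner d (y b) = 0" if "b \<in> J" for b
      unfolding d_def by (rule w[OF that])
    then have Gd: "?G d = 0"
      by (simp add: frame_op_def)
    have "hinner d (y k) = hinner d d"
      using orth[of d w] w by (simp add: d_def hinner_diff_right)
    moreover have "hinner d d \<noteq> 0"
      using False by (simp add: hinner_eq_zero)
    ultimately have "?H (hscale (1 / hinner d d) d) = y k"
      unfolding frame_op_scale H Gd by (simp add: hscale_hscale hscale_one)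
    then show ?thesis
      by blast
  qed
  then obtain u where u: "?H u = y k"
    by blast
  have Hy: "\<exists>v. ?H v = y b" if b: "b \<in> insert k J" for b
  proof (cases "b = k")
    case False
    then obtain v where "?G v = y b"
      using Gy b by blast
    then have "?H (v - hscale (hinner v (y k)) u) = y b"
      unfolding frame_op_diff frame_op_scale u H[of v] by simp
    then show ?thesis
      by blast
  qed (use u in blast)
  then obtain V where V: "\<And>b. b \<in> insert k J \<Longrightarrow> ?H (V b) = y b"
    by metis
  have HG: "\<exists>a. ?H a = ?G z" for z
  proof -
    have "?H (\<Sum>b\<in>J. hscale (hinner z (y b)) (V b)) = (\<Sum>b\<in>J. hscale (hinner z (y b)) (?H (V b)))"
      by (simp only: frame_op_sum frame_op_scale)
    also have "\<dots> = ?G z"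
      unfolding frame_op_def[of J] by (intro sum.cong refl) (simp add: V)
    finally show ?thesis
      by blast
  qed
  have "\<exists>a. \<forall>b\<in>insert k J. hinner (z - ?H a) (y b) = 0" for z
  proof -
    obtain w1 where w1: "\<And>b. b \<in> J \<Longrightarrow> hinner (z - ?G w1) (y b) = 0"
      using res by blast
    define t where "t = hinner (z - ?G w1) d / hinner d d"
    define z2 where "z2 = z - ?G w1 - hscale t d"
    have z2J: "hinner z2 (y b) = 0" if "b \<in> J" for b
      using w1[OF that] w[OF that] by (simp add: z2_def hinner_diff_left hinner_scale_left d_def)
    have "hinner z2 d = 0"
      by (cases "d = 0") (simp_all add: z2_def t_def hinner_diff_left hinner_scale_left hinner_eq_zero)
    then have z2k: "hinner z2 (y k) = 0"
      using orth[of z2 w] z2J by (simp add: d_def hinner_diff_right)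
    obtain a1 a2 where a: "?H a1 = ?G w1" "?H a2 = ?G w"
      using HG by metis
    have "z - ?H (a1 + hscale t (u - a2)) = z2"
      unfolding frame_op_add frame_op_scale frame_op_diff a u by (simp add: z2_def d_def algebra_simps)
    then have "\<forall>b\<in>insert k J. hinner (z - ?H (a1 + hscale t (u - a2))) (y b) = 0"
      using z2J z2k by simp
    then show ?thesis
      by blast
  qed
  with Hy show ?case
    by blast
qed

text \<open>The factor is explicit: \<open>u a b = hinner (x a) (v b)\<close>, where the frame
  operator maps \<open>v b\<close> to \<open>y b\<close>. The two families have equal quadratic
  forms: their common null vectors give the representation of \<open>x a\<close>, and their values
  at combinations of the \<open>v b\<close> give the contraction.\<close>

lemma Douglas_factorization:
  fixes x :: "'i \<Rightarrow> 'a::chilbert" and y :: "'j \<Rightarrow> 'a"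
  assumes fin: "finite A" "finite B"
    and eq: "\<And>z. (\<Sum>a\<in>A. (cmod (hinner (x a) z))\<^sup>2) = (\<Sum>b\<in>B. (cmod (hinner (y b) z))\<^sup>2)"
  shows "\<exists>u. (\<forall>a\<in>A. x a = (\<Sum>b\<in>B. hscale (u a b) (y b))) \<and>
    (\<forall>c. (\<Sum>a\<in>A. (cmod (\<Sum>b\<in>B. u a b * c b))\<^sup>2) \<le> (\<Sum>b\<in>B. (cmod (c b))\<^sup>2))"
proof -
  have "\<exists>v. frame_op B y v = y b" if "b \<in> B" for b
    using frame_op_range[OF fin(2), of y] that by blast
  then obtain v where v: "\<And>b. b \<in> B \<Longrightarrow> frame_op B y (v b) = y b"
    by metis
  define u where "u a b = hinner (x a) (v b)" for a b
  have "x a = (\<Sum>b\<in>B. hscale (u a b) (y b))" if a: "a \<in> A" for a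
  proof (rule hinner_ext)
    fix z
    \<comment> \<open>\<open>z'\<close> differs from \<open>z\<close> by a combination of the
      \<open>v b\<close> and is orthogonal to all \<open>y b\<close>, hence to all
      \<open>x a\<close>.\<close>
    define z' where "z' = z - (\<Sum>b\<in>B. hscale (hinner z (y b)) (v b))"
    have "frame_op B y z' = frame_op B y z - (\<Sum>b\<in>B. hscale (hinner z (y b)) (frame_op B y (v b)))"
      unfolding z'_def frame_op_diff frame_op_sum frame_op_scale ..
    also have "(\<Sum>b\<in>B. hscale (hinner z (y b)) (frame_op B y (v b))) = frame_op B y z"
      unfolding frame_op_def[of B y z] by (intro sum.cong refl) (simp add: v)
    finally have "frame_op B y z' = 0"
      by simp
    then have "complex_of_real (\<Sum>b\<in>B. (cmod (hinner (y b) z'))\<^sup>2) = 0"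
      using hinner_frame_op[of B y z'] by simp
    then have "(\<Sum>a\<in>A. (cmod (hinner (x a) z'))\<^sup>2) = 0"
      by (simp only: eq of_real_eq_0_iff)
    then have "hinner (x a) z' = 0"
      using a fin(1) by (simp add: sum_nonneg_eq_0_iff)
    then have "hinner (x a) z = (\<Sum>b\<in>B. cnj (hinner z (y b)) * hinner (x a) (v b))"
      by (simp add: z'_def hinner_diff_right hinner_sum_right hinner_scale_right)
    also have "\<dots> = (\<Sum>b\<in>B. u a b * hinner (y b) z)"
      by (intro sum.cong refl) (simp add: u_def hinner_commute[symmetric] mult.commute)
    finally show "hinner (x a) z = hinner (\<Sum>b\<in>B. hscale (u a b) (y b)) z"
      by (simp add: hinner_sum_left hinner_scale_left)
  qed
  moreover have "(\<Sum>a\<in>A. (cmod (\<Sum>b\<in>B. u a b * c b))\<^sup>2) \<le> (\<Sum>b\<in>B. (cmod (c b))\<^sup>2)" for c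
  proof -
    define z where "z = (\<Sum>b\<in>B. hscale (cnj (c b)) (v b))"
    define S where "S = (\<Sum>b\<in>B. (cmod (hinner (y b) z))\<^sup>2)"
    have "(\<Sum>b\<in>B. u a b * c b) = hinner (x a) z" for a
      by (simp add: z_def u_def hinner_sum_right hinner_scale_right mult.commute)
    then have S1: "(\<Sum>a\<in>A. (cmod (\<Sum>b\<in>B. u a b * c b))\<^sup>2) = S"
      by (simp add: eq S_def)
    have "frame_op B y z = (\<Sum>b\<in>B. hscale (cnj (c b)) (y b))"
      unfolding z_def frame_op_sum frame_op_scale by (intro sum.cong refl) (simp add: v)
    then have "complex_of_real S = (\<Sum>b\<in>B. cnj (c b) * hinner (y b) z)"
      using hinner_frame_op[of B y z] by (simp add: S_def hinner_sum_left hinner_scale_left)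
    then have "S = cmod (\<Sum>b\<in>B. cnj (c b) * hinner (y b) z)"
      using norm_of_real[of S, where 'a=complex] by (simp add: S_def sum_nonneg)
    also have "\<dots> \<le> (\<Sum>b\<in>B. \<bar>cmod (c b)\<bar> * \<bar>cmod (hinner (y b) z)\<bar>)"
      by (rule sum_norm_le) (simp add: norm_mult)
    also have "\<dots> \<le> sqrt (\<Sum>b\<in>B. (cmod (c b))\<^sup>2) * sqrt (1 * S)"
      by (rule sum_mult_le_sqrt) (simp_all add: S_def)
    finally have "S \<le> 1 * (\<Sum>b\<in>B. (cmod (c b))\<^sup>2)"
      by (rule le_of_le_sqrt_mult) (simp_all add: S_def sum_nonneg)
    then show ?thesis
      by (simp add: S1)
  qed
  ultimately show ?thesis
    by blast
qed

lemma adjoint_matrix_contraction: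
  fixes u :: "'i \<Rightarrow> 'j \<Rightarrow> complex"
  assumes u: "\<And>c. (\<Sum>a\<in>A. (cmod (\<Sum>b\<in>B. u a b * c b))\<^sup>2) \<le> (\<Sum>b\<in>B. (cmod (c b))\<^sup>2)"
  shows "(\<Sum>b\<in>B. (cmod (\<Sum>a\<in>A. cnj (u a b) * k a))\<^sup>2) \<le> (\<Sum>a\<in>A. (cmod (k a))\<^sup>2)"
proof -
  define c where "c b = (\<Sum>a\<in>A. cnj (u a b) * k a)" for b
  define S where "S = (\<Sum>b\<in>B. (cmod (c b))\<^sup>2)"
  have "complex_of_real S = (\<Sum>b\<in>B. c b * cnj (c b))"
    by (simp add: S_def complex_norm_square del: of_real_power)
  also have "\<dots> = (\<Sum>b\<in>B. \<Sum>a\<in>A. c b * (u a b * cnj (k a)))"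
    by (intro sum.cong refl) (subst (2) c_def, simp add: sum_distrib_left)
  also have "\<dots> = (\<Sum>a\<in>A. (\<Sum>b\<in>B. u a b * c b) * cnj (k a))"
    by (subst sum.swap) (simp add: sum_distrib_right sum_distrib_left mult.commute mult.left_commute)
  finally have "S = cmod (\<Sum>a\<in>A. (\<Sum>b\<in>B. u a b * c b) * cnj (k a))"
    using norm_of_real[of S, where 'a=complex] by (simp add: S_def sum_nonneg)
  also have "\<dots> \<le> (\<Sum>a\<in>A. \<bar>cmod (k a)\<bar> * \<bar>cmod (\<Sum>b\<in>B. u a b * c b)\<bar>)"
    by (rule sum_norm_le) (simp add: norm_mult)
  also have "\<dots> \<le> sqrt (\<Sum>a\<in>A. (cmod (k a))\<^sup>2) * sqrt (1 * S)"
    by (rule sum_mult_le_sqrt) (simp_all add: S_def u)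
  finally have "S \<le> 1 * (\<Sum>a\<in>A. (cmod (k a))\<^sup>2)"
    by (rule le_of_le_sqrt_mult) (simp_all add: S_def sum_nonneg)
  then show ?thesis
    by (simp add: S_def c_def)
qed

section \<open>Contractive systems\<close>

text \<open>Component \<open>b\<close> of the adjoint of \<open>u\<close> applied to states
  \<open>\<kappa>\<close> and inputs. In the first index of \<open>u\<close>, \<open>Inl k\<close>
  is a state and \<open>Inr l\<close> an input; in the second, \<open>Inl (k, i)\<close> feeds state
  \<open>k\<close> through the letter \<open>i\<close> and \<open>Inr k\<close> is an output. Column
  \<open>l\<close> belongs to the \<open>l\<close>-th unit input, a constant polynomial and so
  supported on the empty word.\<close>

definition transfer_poly ::
    "nat \<Rightarrow> (nat + nat \<Rightarrow> (nat \<times> nat) + nat \<Rightarrow> complex) \<Rightarrow> (nat \<Rightarrow> nat \<Rightarrow> nat list \<Rightarrow> complex)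
      \<Rightarrow> (nat \<times> nat) + nat \<Rightarrow> nat \<Rightarrow> nat list \<Rightarrow> complex" where
  "transfer_poly d u \<kappa> b l w =
    (\<Sum>k<d. cnj (u (Inl k) b) * \<kappa> k l w) + cnj (u (Inr l) b) * (if w = [] then 1 else 0)"

text \<open>The \<open>n\<close>-th state and the \<open>n\<close>-th output of the discrete-time system with matrix \<open>u\<^sup>*\<close>, as
  polynomials in the letters; the input is the same at every time.\<close>

primrec state_poly ::
    "nat set \<Rightarrow> nat \<Rightarrow> (nat + nat \<Rightarrow> (nat \<times> nat) + nat \<Rightarrow> complex) \<Rightarrow> nat \<Rightarrow> nat \<Rightarrow> nat \<Rightarrow> nat list \<Rightarrow> complex" where
  "state_poly J d u 0 = (\<lambda>k l w. 0)"
| "state_poly J d u (Suc n) = (\<lambda>k l w. case w of [] \<Rightarrow> 0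
      | i # v \<Rightarrow> if i \<in> J then transfer_poly d u (state_poly J d u n) (Inl (k, i)) l v else 0)"

text \<open>Outputs are added up over time: the argument later exploits that the bound for this sum
  grows faster in \<open>N\<close> than the bound for the state.\<close>

definition output_poly ::
    "nat set \<Rightarrow> nat \<Rightarrow> (nat + nat \<Rightarrow> (nat \<times> nat) + nat \<Rightarrow> complex) \<Rightarrow> nat \<Rightarrow> nat \<Rightarrow> nat \<Rightarrow> nat list \<Rightarrow> complex" where
  "output_poly J d u N k l w = (\<Sum>n<N. transfer_poly d u (state_poly J d u n) (Inr k) l w)"

lemma ncpolyI: "finite K \<Longrightarrow> {\<alpha>. p \<alpha> \<noteq> 0} \<subseteq> K \<Longrightarrow> (\<And>\<alpha>. \<alpha> \<in> K \<Longrightarrow> set \<alpha> \<subseteq> I) \<Longrightarrow> ncpoly I p"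
  unfolding ncpoly_def using finite_subset by blast

lemma ncpoly_transfer_poly:
  assumes "\<And>k. k < d \<Longrightarrow> ncpoly I (\<kappa> k l)"
  shows "ncpoly I (transfer_poly d u \<kappa> b l)"
proof (rule ncpolyI)
  show "finite (insert [] (\<Union>k<d. {w. \<kappa> k l w \<noteq> 0}))"
    using assms by (auto simp: ncpoly_def)
  show "{w. transfer_poly d u \<kappa> b l w \<noteq> 0} \<subseteq> insert [] (\<Union>k<d. {w. \<kappa> k l w \<noteq> 0})"
  proof
    fix w assume w: "w \<in> {w. transfer_poly d u \<kappa> b l w \<noteq> 0}"
    show "w \<in> insert [] (\<Union>k<d. {w. \<kappa> k l w \<noteq> 0})"
    proof (rule ccontr)
      assume "w \<notin> insert [] (\<Union>k<d. {w. \<kappa> k l w \<noteq> 0})"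
      then have "w \<noteq> []" "\<And>k. k < d \<Longrightarrow> \<kappa> k l w = 0"
        by auto
      then show False
        using w by (simp add: transfer_poly_def)
    qed
  qed
  show "set w \<subseteq> I" if w: "w \<in> insert [] (\<Union>k<d. {w. \<kappa> k l w \<noteq> 0})" for w
    using w assms by (auto simp: ncpoly_def)
qed

lemma ncpoly_state_poly:
  assumes J: "finite J" "J \<subseteq> I"
  shows "ncpoly I (state_poly J d u n k l)"
proof (induction n arbitrary: k l)
  case 0
  show ?case
    by (simp add: ncpoly_def)
next
  case (Suc n)
  let ?t = "\<lambda>i. transfer_poly d u (state_poly J d u n) (Inl (k, i)) l"
  have t: "ncpoly I (?t i)" for i
    by (rule ncpoly_transfer_poly) (rule Suc)
  show ?case
  proof (rule ncpolyI)
    show "finite (\<Union>i\<in>J. (#) i ` {w. ?t i w \<noteq> 0})"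
      using J t by (simp add: ncpoly_def)
    show "{w. state_poly J d u (Suc n) k l w \<noteq> 0} \<subseteq> (\<Union>i\<in>J. (#) i ` {w. ?t i w \<noteq> 0})"
    proof
      fix w assume w: "w \<in> {w. state_poly J d u (Suc n) k l w \<noteq> 0}"
      show "w \<in> (\<Union>i\<in>J. (#) i ` {w. ?t i w \<noteq> 0})"
      proof (cases w)
        case (Cons i v)
        then have "i \<in> J" "?t i v \<noteq> 0"
          using w by (simp_all split: if_splits)
        then show ?thesis
          unfolding Cons by blast
      qed (use w in simp)
    qed
    show "set w \<subseteq> I" if w: "w \<in> (\<Union>i\<in>J. (#) i ` {w. ?t i w \<noteq> 0})" for w
    proof -
      obtain i v where i: "i \<in> J" and v: "?t i v \<noteq> 0" "w = i # v"
        using w by blast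
      have "set v \<subseteq> I"
        using t[of i] v(1) unfolding ncpoly_def by blast
      then show ?thesis
        using i J(2) v(2) by auto
    qed
  qed
qed

lemma ncpoly_output_poly:
  assumes J: "finite J" "J \<subseteq> I"
  shows "ncpoly I (output_poly J d u N k l)"
proof (rule ncpolyI)
  let ?t = "\<lambda>n. transfer_poly d u (state_poly J d u n) (Inr k) l"
  have t: "ncpoly I (?t n)" for n
    by (rule ncpoly_transfer_poly) (rule ncpoly_state_poly[OF J])
  show "finite (\<Union>n<N. {w. ?t n w \<noteq> 0})"
    using t by (simp add: ncpoly_def)
  show "{w. output_poly J d u N k l w \<noteq> 0} \<subseteq> (\<Union>n<N. {w. ?t n w \<noteq> 0})"
  proof
    fix w assume w: "w \<in> {w. output_poly J d u N k l w \<noteq> 0}"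
    show "w \<in> (\<Union>n<N. {w. ?t n w \<noteq> 0})"
    proof (rule ccontr)
      assume "w \<notin> (\<Union>n<N. {w. ?t n w \<noteq> 0})"
      then have "?t n w = 0" if "n < N" for n
        using that by blast
      then have "output_poly J d u N k l w = 0"
        unfolding output_poly_def by (intro sum.neutral) simp
      then show False
        using w by simp
    qed
  qed
  show "set w \<subseteq> I" if w: "w \<in> (\<Union>n<N. {w. ?t n w \<noteq> 0})" for w
  proof -
    obtain n where "?t n w \<noteq> 0"
      using w by blast
    then show ?thesis
      using t[of n] unfolding ncpoly_def by blast
  qed
qed

lemma polyS_transfer_poly:
  "polyS (transfer_poly d u \<kappa> b l) \<xi> w
    = (\<Sum>k<d. cnj (u (Inl k) b) * polyS (\<kappa> k l) \<xi> w) + cnj (u (Inr l) b) * \<xi> w"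
proof -
  have "(\<Sum>m\<le>length w. cnj (u (Inr l) b) * (if take m w = [] then 1 else 0) * \<xi> (drop m w))
      = (\<Sum>m\<le>length w. if m = 0 then cnj (u (Inr l) b) * \<xi> w else 0)"
    by (intro sum.cong refl) auto
  also have "\<dots> = cnj (u (Inr l) b) * \<xi> w"
    by simp
  finally have 1: "(\<Sum>m\<le>length w. cnj (u (Inr l) b) * (if take m w = [] then 1 else 0) * \<xi> (drop m w))
      = cnj (u (Inr l) b) * \<xi> w" .
  have "(\<Sum>m\<le>length w. (\<Sum>k<d. cnj (u (Inl k) b) * \<kappa> k l (take m w)) * \<xi> (drop m w))
      = (\<Sum>m\<le>length w. \<Sum>k<d. cnj (u (Inl k) b) * (\<kappa> k l (take m w) * \<xi> (drop m w)))"
    by (simp add: sum_distrib_right mult.assoc)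
  also have "\<dots> = (\<Sum>k<d. \<Sum>m\<le>length w. cnj (u (Inl k) b) * (\<kappa> k l (take m w) * \<xi> (drop m w)))"
    by (rule sum.swap)
  finally have 2: "(\<Sum>m\<le>length w. (\<Sum>k<d. cnj (u (Inl k) b) * \<kappa> k l (take m w)) * \<xi> (drop m w))
      = (\<Sum>k<d. cnj (u (Inl k) b) * polyS (\<kappa> k l) \<xi> w)"
    by (simp add: polyS_def sum_distrib_left)
  have "polyS (transfer_poly d u \<kappa> b l) \<xi> w
      = (\<Sum>m\<le>length w. (\<Sum>k<d. cnj (u (Inl k) b) * \<kappa> k l (take m w)) * \<xi> (drop m w)
        + cnj (u (Inr l) b) * (if take m w = [] then 1 else 0) * \<xi> (drop m w))"
    unfolding polyS_def transfer_poly_def by (intro sum.cong refl) (rule distrib_right)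
  then show ?thesis
    unfolding sum.distrib 1 2 .
qed

lemma polyS_state_poly_Suc:
  "polyS (state_poly J d u (Suc n) k l) \<xi> w = (case w of [] \<Rightarrow> 0
    | i # v \<Rightarrow> if i \<in> J then polyS (transfer_poly d u (state_poly J d u n) (Inl (k, i)) l) \<xi> v else 0)"
proof (cases w)
  case (Cons i v)
  have "polyS (state_poly J d u (Suc n) k l) \<xi> w = (\<Sum>m\<le>Suc (length v).
      state_poly J d u (Suc n) k l (take m (i # v)) * \<xi> (drop m (i # v)))"
    by (simp add: polyS_def Cons)
  also have "\<dots> = (\<Sum>m\<le>length v. (if i \<in> J then transfer_poly d u (state_poly J d u n) (Inl (k, i)) l (take m v) else 0) * \<xi> (drop m v))"
    unfolding sum.atMost_Suc_shift by simp
  also have "\<dots> = (if i \<in> J then polyS (transfer_poly d u (state_poly J d u n) (Inl (k, i)) l) \<xi> v else 0)"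
    by (simp add: polyS_def)
  finally show ?thesis
    by (simp add: Cons)
qed (simp add: polyS_def)

lemma matS_transfer_poly:
  "matS d (\<lambda>_. transfer_poly d u \<kappa> b) \<xi> 0 w
    = (\<Sum>a\<in>{..<d} <+> {..<d}. cnj (u a b) * case_sum (\<lambda>k. matS d \<kappa> \<xi> k w) (\<lambda>l. \<xi> l w) a)"
proof -
  have "(\<Sum>l<d. \<Sum>k<d. cnj (u (Inl k) b) * polyS (\<kappa> k l) (\<xi> l) w) = (\<Sum>k<d. cnj (u (Inl k) b) * matS d \<kappa> \<xi> k w)"
    by (subst sum.swap) (simp add: matS_def sum_distrib_left)
  then show ?thesis
    by (simp add: matS_def[of d "\<lambda>_. transfer_poly d u \<kappa> b"] polyS_transfer_poly sum.distrib sum.Plus)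
qed

text \<open>Creation operators of different letters have orthogonal ranges: a nonempty word
  determines its first letter, so the squared norms add up.\<close>

lemma fnorm_state_poly_Suc:
  assumes J: "finite J"
    and l2: "\<And>i. l2fun (matS d (\<lambda>_. transfer_poly d u (state_poly J d u n) (Inl (k, i))) \<xi> 0)"
  shows "(fnorm (matS d (state_poly J d u (Suc n)) \<xi> k))\<^sup>2
    = (\<Sum>i\<in>J. (fnorm (matS d (\<lambda>_. transfer_poly d u (state_poly J d u n) (Inl (k, i))) \<xi> 0))\<^sup>2)"
proof -
  define f where "f = matS d (state_poly J d u (Suc n)) \<xi> k"
  define g where "g i = matS d (\<lambda>_. transfer_poly d u (state_poly J d u n) (Inl (k, i))) \<xi> 0" for i
  have f_Cons: "f (i # v) = (if i \<in> J then g i v else 0)" and f_Nil: "f [] = 0" for i v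
    by (simp_all add: f_def g_def matS_def polyS_state_poly_Suc del: state_poly.simps)
  have "((\<lambda>w. (cmod (f w))\<^sup>2) has_sum (fnorm (g i))\<^sup>2) (range ((#) i))" if i: "i \<in> J" for i
  proof -
    have "((\<lambda>v. (cmod (g i v))\<^sup>2) has_sum (fnorm (g i))\<^sup>2) UNIV"
      unfolding fnorm_sq g_def by (rule has_sum_infsum[OF l2])
    moreover have "(\<lambda>v. (cmod (g i v))\<^sup>2) = (\<lambda>w. (cmod (f w))\<^sup>2) \<circ> (#) i"
      using i by (simp add: fun_eq_iff f_Cons)
    ultimately show ?thesis
      by (intro has_sum_reindex[THEN iffD2]) (simp_all add: inj_on_def)
  qed
  then have sum: "((\<lambda>w. (cmod (f w))\<^sup>2) has_sum (\<Sum>i\<in>J. (fnorm (g i))\<^sup>2)) (\<Union>i\<in>J. range ((#) i))"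
    by (rule sum_has_sum[OF J]) auto
  have zero: "(cmod (f w))\<^sup>2 = 0" if w: "w \<notin> (\<Union>i\<in>J. range ((#) i))" for w
    using w by (cases w) (auto simp: f_Cons f_Nil)
  have "((\<lambda>w. (cmod (f w))\<^sup>2) has_sum (\<Sum>i\<in>J. (fnorm (g i))\<^sup>2)) UNIV"
    by (rule has_sum_cong_neutral[THEN iffD1, OF _ _ _ sum]) (rule zero, blast, blast, rule refl)
  then have "(fnorm f)\<^sup>2 = (\<Sum>i\<in>J. (fnorm (g i))\<^sup>2)"
    unfolding fnorm_sq[of f] by (rule infsumI)
  then show ?thesis
    by (simp only: f_def g_def)
qed

text \<open>\<open>J\<close> is the finite alphabet; \<open>d\<close> counts the states, the inputs
  and the outputs alike.\<close>

locale contractive_system =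
  fixes J :: "nat set" and I :: "nat set" and d :: nat
    and u :: "nat + nat \<Rightarrow> (nat \<times> nat) + nat \<Rightarrow> complex"
  assumes J: "finite J" "J \<subseteq> I"
    and u: "\<And>c. (\<Sum>a\<in>{..<d} <+> {..<d}. (cmod (\<Sum>b\<in>({..<d} \<times> J) <+> {..<d}. u a b * c b))\<^sup>2)
      \<le> (\<Sum>b\<in>({..<d} \<times> J) <+> {..<d}. (cmod (c b))\<^sup>2)"
begin

abbreviation "states n \<equiv> state_poly J d u n"
abbreviation "outputs N \<equiv> output_poly J d u N"
abbreviation "transfers n b \<equiv> transfer_poly d u (states n) b"

lemma ncpoly_transfers: "ncpoly I (transfers n b l)"
  by (rule ncpoly_transfer_poly) (rule ncpoly_state_poly[OF J])

text \<open>The adjoint of the contraction \<open>u\<close> acts on the coefficients at each word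
  separately; summing over all words gives the energy balance of one time step.\<close>

lemma energy_step:
  assumes \<xi>: "\<And>l. l < d \<Longrightarrow> l2fun (\<xi> l)"
  shows "(\<Sum>k<d. (fnorm (matS d (states (Suc n)) \<xi> k))\<^sup>2) + (\<Sum>k<d. (fnorm (matS d (\<lambda>_. transfers n (Inr k)) \<xi> 0))\<^sup>2)
    \<le> (\<Sum>k<d. (fnorm (matS d (states n) \<xi> k))\<^sup>2) + (\<Sum>l<d. (fnorm (\<xi> l))\<^sup>2)"
proof -
  let ?A = "{..<d} <+> {..<d}" and ?B = "({..<d} \<times> J) <+> {..<d}"
  define X where "X = case_sum (matS d (states n) \<xi>) \<xi>"
  define G where "G b = matS d (\<lambda>_. transfers n b) \<xi> 0" for b
  have l2G: "l2fun (G b)" for b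
    unfolding G_def by (rule l2fun_matS[where I=I], rule ncpoly_transfers, erule \<xi>)
  have l2X: "l2fun (X a)" if a: "a \<in> ?A" for a
  proof (cases a)
    case (Inl k)
    have "l2fun (matS d (states n) \<xi> k)"
      by (rule l2fun_matS[where I=I], rule ncpoly_state_poly[OF J], erule \<xi>)
    then show ?thesis
      by (simp add: X_def Inl)
  next
    case (Inr l)
    then show ?thesis
      using a \<xi>[of l] by (auto simp: X_def)
  qed
  have G: "G b w = (\<Sum>a\<in>?A. cnj (u a b) * X a w)" for b w
    unfolding G_def matS_transfer_poly by (intro sum.cong refl) (auto simp: X_def)
  have "(\<Sum>b\<in>?B. (fnorm (G b))\<^sup>2) \<le> (\<Sum>a\<in>?A. (fnorm (X a))\<^sup>2)"
  proof (rule has_sum_mono)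
    show "((\<lambda>w. \<Sum>b\<in>?B. (cmod (G b w))\<^sup>2) has_sum (\<Sum>b\<in>?B. (fnorm (G b))\<^sup>2)) UNIV"
      unfolding fnorm_sq using J(1) by (intro has_sum_finite_sum has_sum_infsum l2G) simp
    show "((\<lambda>w. \<Sum>a\<in>?A. (cmod (X a w))\<^sup>2) has_sum (\<Sum>a\<in>?A. (fnorm (X a))\<^sup>2)) UNIV"
      unfolding fnorm_sq by (intro has_sum_finite_sum has_sum_infsum l2X) simp_all
    show "(\<Sum>b\<in>?B. (cmod (G b w))\<^sup>2) \<le> (\<Sum>a\<in>?A. (cmod (X a w))\<^sup>2)" for w
      unfolding G by (rule adjoint_matrix_contraction[OF u])
  qed
  moreover have "(\<Sum>k<d. (fnorm (matS d (states (Suc n)) \<xi> k))\<^sup>2) = (\<Sum>k<d. \<Sum>i\<in>J. (fnorm (G (Inl (k, i))))\<^sup>2)"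
    by (intro sum.cong refl) (simp only: fnorm_state_poly_Suc[OF J(1) l2G[unfolded G_def]] G_def)
  ultimately show ?thesis
    using J(1) by (simp add: sum.Plus sum.cartesian_product' X_def G_def)
qed

text \<open>The balance is summed from the initial state zero; every step brings in the same input
  energy.\<close>

lemma energy_sum:
  assumes \<xi>: "\<And>l. l < d \<Longrightarrow> l2fun (\<xi> l)"
  shows "(\<Sum>k<d. (fnorm (matS d (states N) \<xi> k))\<^sup>2) + (\<Sum>n<N. \<Sum>k<d. (fnorm (matS d (\<lambda>_. transfers n (Inr k)) \<xi> 0))\<^sup>2)
    \<le> real N * (\<Sum>l<d. (fnorm (\<xi> l))\<^sup>2)"
proof (induction N)
  case 0
  have "matS d (states 0) \<xi> k = (\<lambda>_. 0)" for k
    by (simp add: matS_def polyS_def fun_eq_iff)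
  then show ?case
    by simp
next
  case (Suc N)
  then show ?case
    using energy_step[where \<xi>=\<xi> and n=N, OF \<xi>] by (simp add: algebra_simps del: state_poly.simps)
qed

lemma matnormS_states: "matnormS I d (states N) \<le> sqrt (real N)"
proof (rule matnormS_le)
  fix \<xi> assume fock: "\<And>l. l < d \<Longrightarrow> fock I (\<xi> l)" and 1: "(\<Sum>l<d. (fnorm (\<xi> l))\<^sup>2) \<le> 1"
  have \<xi>: "l2fun (\<xi> l)" if "l < d" for l
    using fock[OF that] by (simp add: fock_def)
  have "(\<Sum>k<d. (fnorm (matS d (states N) \<xi> k))\<^sup>2) \<le> real N * (\<Sum>l<d. (fnorm (\<xi> l))\<^sup>2)"
  proof -
    have "0 \<le> (\<Sum>n<N. \<Sum>k<d. (fnorm (matS d (\<lambda>_. transfers n (Inr k)) \<xi> 0))\<^sup>2)"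
      by (intro sum_nonneg zero_le_power2)
    then show ?thesis
      using energy_sum[where \<xi>=\<xi> and N=N, OF \<xi>] by linarith
  qed
  also have "\<dots> \<le> real N"
    using 1 by (intro mult_left_le) auto
  finally show "(\<Sum>k<d. (fnorm (matS d (states N) \<xi> k))\<^sup>2) \<le> (sqrt (real N))\<^sup>2"
    by simp
qed simp

text \<open>For an input of norm at most 1 the \<open>N\<close> outputs have total energy at most
  \<open>N\<close>; adding them up costs a further factor \<open>N\<close> by
  Cauchy-Schwarz.\<close>

lemma matnormS_outputs: "matnormS I d (outputs N) \<le> real N"
proof (rule matnormS_le)
  fix \<xi> assume fock: "\<And>l. l < d \<Longrightarrow> fock I (\<xi> l)" and 1: "(\<Sum>l<d. (fnorm (\<xi> l))\<^sup>2) \<le> 1"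
  have \<xi>: "l2fun (\<xi> l)" if "l < d" for l
    using fock[OF that] by (simp add: fock_def)
  define G where "G n k = matS d (\<lambda>_. transfers n (Inr k)) \<xi> 0" for n k
  have l2G: "l2fun (G n k)" for n k
    unfolding G_def by (rule l2fun_matS[where I=I], rule ncpoly_transfers, erule \<xi>)
  have "matS d (outputs N) \<xi> k = (\<lambda>w. \<Sum>n<N. G n k w)" for k
  proof (rule ext)
    fix w
    have "polyS (outputs N k l) \<xi>' w = (\<Sum>n<N. polyS (transfers n (Inr k) l) \<xi>' w)" for l \<xi>'
      unfolding polyS_def output_poly_def by (subst sum.swap) (simp add: sum_distrib_right)
    then show "matS d (outputs N) \<xi> k w = (\<Sum>n<N. G n k w)"
      unfolding matS_def G_def by (subst sum.swap) simp
  qed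
  then have "(fnorm (matS d (outputs N) \<xi> k))\<^sup>2 \<le> real N * (\<Sum>n<N. (fnorm (G n k))\<^sup>2)" for k
    using l2fun_sum(2)[of "{..<N}" "\<lambda>n. G n k", OF finite_lessThan l2G] by simp
  then have "(\<Sum>k<d. (fnorm (matS d (outputs N) \<xi> k))\<^sup>2) \<le> (\<Sum>k<d. real N * (\<Sum>n<N. (fnorm (G n k))\<^sup>2))"
    by (rule sum_mono)
  also have "\<dots> = real N * (\<Sum>n<N. \<Sum>k<d. (fnorm (G n k))\<^sup>2)"
    unfolding sum_distrib_left[symmetric] by (subst sum.swap) (rule refl)
  also have "\<dots> \<le> real N * (real N * (\<Sum>l<d. (fnorm (\<xi> l))\<^sup>2))"
  proof (rule mult_left_mono)
    have "0 \<le> (\<Sum>k<d. (fnorm (matS d (states N) \<xi> k))\<^sup>2)"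
      by (intro sum_nonneg zero_le_power2)
    then show "(\<Sum>n<N. \<Sum>k<d. (fnorm (G n k))\<^sup>2) \<le> real N * (\<Sum>l<d. (fnorm (\<xi> l))\<^sup>2)"
      unfolding G_def using energy_sum[where \<xi>=\<xi> and N=N, OF \<xi>] by linarith
  qed simp
  also have "\<dots> \<le> real N * (real N * 1)"
    using 1 by (intro mult_left_mono) auto
  finally show "(\<Sum>k<d. (fnorm (matS d (outputs N) \<xi> k))\<^sup>2) \<le> (real N)\<^sup>2"
    by (simp add: power2_eq_square)
qed simp

end

context row_operator
begin

lemma polyA_transfer_poly:
  assumes "\<And>k. k < d \<Longrightarrow> ncpoly I (\<kappa> k l)"
  shows "polyA A (transfer_poly d u \<kappa> b l) x
    = (\<Sum>k<d. hscale (cnj (u (Inl k) b)) (polyA A (\<kappa> k l) x)) + hscale (cnj (u (Inr l) b)) x"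
proof -
  let ?t = "transfer_poly d u \<kappa> b l"
  define K where "K = insert [] ({w. ?t w \<noteq> 0} \<union> (\<Union>k<d. {w. \<kappa> k l w \<noteq> 0}))"
  have "finite {w. ?t w \<noteq> 0}"
    using ncpoly_transfer_poly[where \<kappa>=\<kappa> and l=l and d=d and I=I, OF assms] by (simp add: ncpoly_def)
  then have K: "finite K"
    unfolding K_def using assms by (simp add: ncpoly_def)
  have \<kappa>: "polyA A (\<kappa> k l) x = (\<Sum>w\<in>K. hscale (\<kappa> k l w) (wordop A w x))" if "k < d" for k
    by (rule polyA_eq_sum[OF K]) (use that in \<open>auto simp: K_def\<close>)
  have "polyA A ?t x = (\<Sum>w\<in>K. hscale (?t w) (wordop A w x))"
    by (rule polyA_eq_sum[OF K]) (auto simp: K_def)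
  also have "\<dots> = (\<Sum>w\<in>K. (\<Sum>k<d. hscale (cnj (u (Inl k) b)) (hscale (\<kappa> k l w) (wordop A w x)))
      + (if w = [] then hscale (cnj (u (Inr l) b)) x else 0))"
    by (intro sum.cong refl)
      (simp add: transfer_poly_def hscale_add_left hscale_sum_left hscale_hscale wordop_Nil)
  also have "\<dots> = (\<Sum>k<d. \<Sum>w\<in>K. hscale (cnj (u (Inl k) b)) (hscale (\<kappa> k l w) (wordop A w x)))
      + (\<Sum>w\<in>K. if w = [] then hscale (cnj (u (Inr l) b)) x else 0)"
    unfolding sum.distrib by (subst sum.swap) (rule refl)
  also have "(\<Sum>w\<in>K. if w = [] then hscale (cnj (u (Inr l) b)) x else 0) = hscale (cnj (u (Inr l) b)) x"
    using K by (simp add: K_def)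
  also have "(\<Sum>k<d. \<Sum>w\<in>K. hscale (cnj (u (Inl k) b)) (hscale (\<kappa> k l w) (wordop A w x)))
      = (\<Sum>k<d. hscale (cnj (u (Inl k) b)) (polyA A (\<kappa> k l) x))"
    by (intro sum.cong refl) (simp add: \<kappa> hscale_sum_right)
  finally show ?thesis .
qed

lemma polyA_state_poly_Suc:
  assumes J: "finite J" "J \<subseteq> I"
  shows "polyA A (state_poly J d u (Suc n) k l) x
    = (\<Sum>i\<in>J. A i (polyA A (transfer_poly d u (state_poly J d u n) (Inl (k, i)) l) x))"
proof -
  let ?t = "\<lambda>i. transfer_poly d u (state_poly J d u n) (Inl (k, i)) l"
  define K where "K = (\<Union>i\<in>J. {w. ?t i w \<noteq> 0})"
  have t: "ncpoly I (?t i)" for i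
    by (rule ncpoly_transfer_poly) (rule ncpoly_state_poly[OF J])
  then have K: "finite K"
    using J(1) by (simp add: K_def ncpoly_def)
  define M where "M = (\<lambda>(i, w). i # w) ` (J \<times> K)"
  have supp: "{w. state_poly J d u (Suc n) k l w \<noteq> 0} \<subseteq> M"
  proof
    fix w assume w: "w \<in> {w. state_poly J d u (Suc n) k l w \<noteq> 0}"
    show "w \<in> M"
    proof (cases w)
      case (Cons i v)
      then have "i \<in> J" "?t i v \<noteq> 0"
        using w by (simp_all split: if_splits)
      then have "(i, v) \<in> J \<times> K"
        by (auto simp: K_def)
      then show ?thesis
        unfolding M_def Cons by force
    qed (use w in simp)
  qed
  have inj: "inj_on (\<lambda>(i, w). i # w) (J \<times> K)"
    by (auto simp: inj_on_def)
  have "polyA A (state_poly J d u (Suc n) k l) x = (\<Sum>w\<in>M. hscale (state_poly J d u (Suc n) k l w) (wordop A w x))"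
    by (rule polyA_eq_sum[OF _ supp]) (use J K in \<open>simp add: M_def\<close>)
  also have "\<dots> = (\<Sum>i\<in>J. \<Sum>w\<in>K. hscale (?t i w) (A i (wordop A w x)))"
    unfolding M_def sum.reindex[OF inj] sum.cartesian_product' by (intro sum.cong refl) (simp add: wordop_Cons)
  also have "\<dots> = (\<Sum>i\<in>J. A i (polyA A (?t i) x))"
  proof (rule sum.cong[OF refl])
    fix i assume i: "i \<in> J"
    then have bA: "bop (A i)"
      using J bop_A by blast
    have "polyA A (?t i) x = (\<Sum>w\<in>K. hscale (?t i w) (wordop A w x))"
      by (rule polyA_eq_sum[OF K]) (use i in \<open>auto simp: K_def\<close>)
    then show "(\<Sum>w\<in>K. hscale (?t i w) (A i (wordop A w x))) = A i (polyA A (?t i) x)"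
      by (simp add: bop_sum[OF bA] bop_scale[OF bA])
  qed
  finally show ?thesis .
qed

lemma matA_transfer_poly:
  assumes \<kappa>: "\<And>k l. k < d \<Longrightarrow> ncpoly I (\<kappa> k l)"
  shows "matA A d (\<lambda>_. transfer_poly d u \<kappa> b) h 0
    = (\<Sum>a\<in>{..<d} <+> {..<d}. hscale (cnj (u a b)) (case_sum (matA A d \<kappa> h) h a))"
proof -
  have "(\<Sum>l<d. \<Sum>k<d. hscale (cnj (u (Inl k) b)) (polyA A (\<kappa> k l) (h l)))
      = (\<Sum>k<d. hscale (cnj (u (Inl k) b)) (matA A d \<kappa> h k))"
    by (subst sum.swap) (simp add: matA_def hscale_sum_right)
  then show ?thesis
    by (simp add: matA_def[of A d "\<lambda>_. transfer_poly d u \<kappa> b"] polyA_transfer_poly[OF \<kappa>] sum.distrib sum.Plus)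
qed

lemma cb_bound_matA:
  assumes cb: "cb_bound A I C" and C: "0 \<le> C"
    and P: "\<And>i j. i < m \<Longrightarrow> j < m \<Longrightarrow> ncpoly I (P i j)" and le: "matnormS I m P \<le> B"
  shows "(\<Sum>i<m. (hnorm (matA A m P h i))\<^sup>2) \<le> (C * B)\<^sup>2 * (\<Sum>j<m. (hnorm (h j))\<^sup>2)"
proof -
  have "matnormA A m P \<le> C * matnormS I m P"
    using cb P unfolding cb_bound_def by blast
  also have "\<dots> \<le> C * B"
    by (rule mult_left_mono[OF le C])
  finally have "(matnormA A m P)\<^sup>2 \<le> (C * B)\<^sup>2"
    by (rule power_mono) (rule matnormA_nonneg[where P=P, OF P])
  then have "(matnormA A m P)\<^sup>2 * (\<Sum>j<m. (hnorm (h j))\<^sup>2) \<le> (C * B)\<^sup>2 * (\<Sum>j<m. (hnorm (h j))\<^sup>2)"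
    by (rule mult_right_mono) (simp add: sum_nonneg)
  then show ?thesis
    using matA_le_matnormA[where P=P and h=h, OF P] by (rule order_trans[rotated])
qed

text \<open>If the vectors \<open>h, s\<close> and \<open>A\<^sup>*h, p\<close> have the same frame operator, then Douglas' factorization
  provides a contractive system for which \<open>h\<close> is a stationary state with input \<open>p\<close> and output \<open>s\<close>.
  Running the adjoint system for \<open>N\<close> steps with constant input \<open>s\<close> and letting \<open>N\<close> tend to
  infinity removes the influence of the state.\<close>

lemma cb_bound_frame:
  fixes d :: nat and h s p :: "nat \<Rightarrow> 'a"
  assumes cb: "cb_bound A I C" and C: "0 \<le> C" and J: "finite J" "J \<subseteq> I"
    and frame: "\<And>z. (\<Sum>k<d. (cmod (hinner (h k) z))\<^sup>2) + (\<Sum>k<d. (cmod (hinner (s k) z))\<^sup>2)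
      = (\<Sum>k<d. \<Sum>i\<in>J. (cmod (hinner (adj (A i) (h k)) z))\<^sup>2) + (\<Sum>k<d. (cmod (hinner (p k) z))\<^sup>2)"
  shows "(\<Sum>k<d. (hnorm (s k))\<^sup>2) \<le> C\<^sup>2 * (\<Sum>k<d. (hnorm (p k))\<^sup>2)"
proof -
  let ?A = "{..<d} <+> {..<d}" and ?B = "({..<d} \<times> J) <+> {..<d}"
  define x where "x = case_sum h s"
  define y where "y = case_sum (\<lambda>(k, i). adj (A i) (h k)) p"
  have fin: "finite ?A" "finite ?B"
    using J(1) by (simp_all add: finite_Plus)
  have "(\<Sum>a\<in>?A. (cmod (hinner (x a) z))\<^sup>2) = (\<Sum>b\<in>?B. (cmod (hinner (y b) z))\<^sup>2)" for z
    using frame[of z] J(1) by (simp add: sum.Plus sum.cartesian_product' x_def y_def)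
  from Douglas_factorization[OF fin this] obtain u
    where x: "\<And>a. a \<in> ?A \<Longrightarrow> x a = (\<Sum>b\<in>?B. hscale (u a b) (y b))"
      and u: "\<And>c. (\<Sum>a\<in>?A. (cmod (\<Sum>b\<in>?B. u a b * c b))\<^sup>2) \<le> (\<Sum>b\<in>?B. (cmod (c b))\<^sup>2)"
    by blast
  interpret contractive_system J I d u
    using J u by unfold_locales
  define G where "G n b = matA A d (\<lambda>_. transfers n b) s 0" for n b
  define \<kappa> where "\<kappa> n = matA A d (states n) s" for n
  define v where "v N = matA A d (outputs N) s" for N
  define S where "S = (\<Sum>k<d. (hnorm (s k))\<^sup>2)"
  have nS: "ncpoly I (states n k l)" for n k l
    by (rule ncpoly_state_poly[OF J])
  have nO: "ncpoly I (outputs n k l)" for n k l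
    by (rule ncpoly_output_poly[OF J])
  have \<kappa>_Suc: "\<kappa> (Suc n) k = (\<Sum>i\<in>J. A i (G n (Inl (k, i))))" for n k
  proof -
    have "\<kappa> (Suc n) k = (\<Sum>l<d. \<Sum>i\<in>J. A i (polyA A (transfers n (Inl (k, i)) l) (s l)))"
      unfolding \<kappa>_def matA_def polyA_state_poly_Suc[OF J] ..
    also have "\<dots> = (\<Sum>i\<in>J. \<Sum>l<d. A i (polyA A (transfers n (Inl (k, i)) l) (s l)))"
      by (rule sum.swap)
    also have "\<dots> = (\<Sum>i\<in>J. A i (G n (Inl (k, i))))"
    proof (rule sum.cong[OF refl])
      fix i assume "i \<in> J"
      then have "bop (A i)"
        using J bop_A by blast
      then show "(\<Sum>l<d. A i (polyA A (transfers n (Inl (k, i)) l) (s l))) = A i (G n (Inl (k, i)))"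
        by (simp add: G_def matA_def bop_sum)
    qed
    finally show ?thesis .
  qed
  have v_eq: "v N k = (\<Sum>n<N. G n (Inr k))" for N k
  proof -
    have "polyA A (outputs N k l) z = (\<Sum>n<N. polyA A (transfers n (Inr k) l) z)" for l z
    proof -
      define K where "K = {w. outputs N k l w \<noteq> 0} \<union> (\<Union>n<N. {w. transfers n (Inr k) l w \<noteq> 0})"
      have K: "finite K"
        unfolding K_def using nO ncpoly_transfers by (simp add: ncpoly_def)
      have "polyA A (outputs N k l) z = (\<Sum>w\<in>K. hscale (outputs N k l w) (wordop A w z))"
        by (rule polyA_eq_sum[OF K]) (auto simp: K_def)
      also have "\<dots> = (\<Sum>n<N. \<Sum>w\<in>K. hscale (transfers n (Inr k) l w) (wordop A w z))"
        unfolding output_poly_def hscale_sum_left by (rule sum.swap)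
      also have "\<dots> = (\<Sum>n<N. polyA A (transfers n (Inr k) l) z)"
        by (intro sum.cong refl polyA_eq_sum[OF K, symmetric]) (auto simp: K_def)
      finally show ?thesis .
    qed
    then have "v N k = (\<Sum>l<d. \<Sum>n<N. polyA A (transfers n (Inr k) l) (s l))"
      by (simp add: v_def matA_def)
    also have "\<dots> = (\<Sum>n<N. G n (Inr k))"
      by (subst sum.swap) (simp add: G_def matA_def)
    finally show ?thesis .
  qed
  \<comment> \<open>Since \<open>x\<close> is \<open>u\<close> applied to \<open>y\<close>, pairing
    states and input with \<open>x\<close> amounts to pairing the transfers with \<open>y\<close>.
    Moving \<open>adj (A i)\<close> across then produces the next state.\<close>
  have step: "(\<Sum>k<d. hinner (\<kappa> n k) (h k)) + complex_of_real S
      = (\<Sum>k<d. hinner (\<kappa> (Suc n) k) (h k)) + (\<Sum>k<d. hinner (G n (Inr k)) (p k))" for n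
  proof -
    define X where "X = case_sum (\<kappa> n) s"
    have G: "G n b = (\<Sum>a\<in>?A. hscale (cnj (u a b)) (X a))" for b
      unfolding G_def X_def \<kappa>_def by (rule matA_transfer_poly[OF nS])
    have "(\<Sum>k<d. hinner (\<kappa> n k) (h k)) + complex_of_real S = (\<Sum>a\<in>?A. hinner (X a) (x a))"
      by (simp add: sum.Plus X_def x_def S_def hinner_self)
    also have "\<dots> = (\<Sum>a\<in>?A. \<Sum>b\<in>?B. cnj (u a b) * hinner (X a) (y b))"
      by (intro sum.cong refl) (simp add: x hinner_sum_right hinner_scale_right)
    also have "\<dots> = (\<Sum>b\<in>?B. \<Sum>a\<in>?A. cnj (u a b) * hinner (X a) (y b))"
      by (rule sum.swap)
    also have "\<dots> = (\<Sum>b\<in>?B. hinner (G n b) (y b))"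
      unfolding G by (simp add: hinner_sum_left hinner_scale_left)
    also have "\<dots> = (\<Sum>k<d. \<Sum>i\<in>J. hinner (G n (Inl (k, i))) (adj (A i) (h k))) + (\<Sum>k<d. hinner (G n (Inr k)) (p k))"
      using J(1) by (simp add: sum.Plus sum.cartesian_product' y_def)
    also have "(\<Sum>k<d. \<Sum>i\<in>J. hinner (G n (Inl (k, i))) (adj (A i) (h k))) = (\<Sum>k<d. hinner (\<kappa> (Suc n) k) (h k))"
    proof (rule sum.cong[OF refl])
      fix k
      have "(\<Sum>i\<in>J. hinner (G n (Inl (k, i))) (adj (A i) (h k))) = (\<Sum>i\<in>J. hinner (A i (G n (Inl (k, i)))) (h k))"
      proof (rule sum.cong[OF refl])
        fix i assume "i \<in> J"
        then have "bop (A i)"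
          using J bop_A by blast
        then show "hinner (G n (Inl (k, i))) (adj (A i) (h k)) = hinner (A i (G n (Inl (k, i)))) (h k)"
          by (simp add: hinner_adj)
      qed
      then show "(\<Sum>i\<in>J. hinner (G n (Inl (k, i))) (adj (A i) (h k))) = hinner (\<kappa> (Suc n) k) (h k)"
        by (simp add: \<kappa>_Suc hinner_sum_left)
    qed
    finally show ?thesis .
  qed
  have "\<kappa> 0 k = 0" for k
    by (simp add: \<kappa>_def matA_def polyA_def)
  then have total: "complex_of_real (real N * S) = (\<Sum>k<d. hinner (\<kappa> N k) (h k)) + (\<Sum>k<d. hinner (v N k) (p k))" for N
  proof (induction N)
    case (Suc N)
    have "v (Suc N) k = v N k + G N (Inr k)" for k
      by (simp add: v_eq)
    then show ?case
      using Suc step[of N] by (simp add: algebra_simps hinner_add_left sum.distrib)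
  qed (simp add: v_eq)
  define H where "H = (\<Sum>k<d. (hnorm (h k))\<^sup>2)"
  define P where "P = (\<Sum>k<d. (hnorm (p k))\<^sup>2)"
  have pos: "0 \<le> S" "0 \<le> H" "0 \<le> P"
    by (simp_all add: S_def H_def P_def sum_nonneg)
  \<comment> \<open>The complete bound allows the state order \<open>sqrt N\<close> and the outputs
    order \<open>N\<close>. Dividing \<open>N * S\<close> by \<open>N * sqrt S\<close> leaves the
    state term with the factor \<open>1 / sqrt N\<close>.\<close>
  have main: "sqrt S \<le> C * sqrt H * (1 / sqrt (real N)) + C * sqrt P" if N: "N \<ge> 1" for N
  proof (cases "S = 0")
    case True
    then show ?thesis
      using C pos by simp
  next
    case False
    then have S: "sqrt S > 0"
      using pos by simp
    have \<kappa>_le: "(\<Sum>k<d. (hnorm (\<kappa> N k))\<^sup>2) \<le> (C * sqrt (real N))\<^sup>2 * S"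
      unfolding \<kappa>_def S_def by (rule cb_bound_matA[OF cb C nS matnormS_states])
    have v_le: "(\<Sum>k<d. (hnorm (v N k))\<^sup>2) \<le> (C * real N)\<^sup>2 * S"
      unfolding v_def S_def by (rule cb_bound_matA[OF cb C nO matnormS_outputs])
    have "real N * S = cmod (complex_of_real (real N * S))"
      using pos by (simp only: norm_of_real) simp
    also have "\<dots> \<le> cmod (\<Sum>k<d. hinner (\<kappa> N k) (h k)) + cmod (\<Sum>k<d. hinner (v N k) (p k))"
      unfolding total by (rule norm_triangle_ineq)
    also have "\<dots> \<le> sqrt ((C * sqrt (real N))\<^sup>2 * S) * sqrt H + sqrt ((C * real N)\<^sup>2 * S) * sqrt P"
      by (intro add_mono sum_hinner_le \<kappa>_le v_le) (simp_all add: H_def P_def)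
    also have "\<dots> = (C * sqrt (real N) * sqrt H + C * real N * sqrt P) * sqrt S"
      using C by (simp add: real_sqrt_mult algebra_simps)
    finally have "(real N * sqrt S) * sqrt S \<le> (C * sqrt (real N) * sqrt H + C * real N * sqrt P) * sqrt S"
      using pos by (simp add: mult.assoc)
    then have "real N * sqrt S \<le> C * sqrt (real N) * sqrt H + C * real N * sqrt P"
      using S by (rule mult_right_le_imp_le)
    also have "\<dots> = real N * (C * sqrt H * (1 / sqrt (real N)) + C * sqrt P)"
    proof -
      have q: "sqrt (real N) = real N * (1 / sqrt (real N))"
        by (simp add: real_div_sqrt)
      show ?thesis
        by (subst q) (simp only: distrib_left mult.commute mult.left_commute mult.assoc)
    qed
    finally show ?thesis
      using N by simp
  qed
  have "sqrt S \<le> C * sqrt P"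
  proof (rule LIMSEQ_le_const)
    have "(\<lambda>N. 1 / sqrt (real N)) \<longlonglongrightarrow> 0"
      by (intro tendsto_divide_0[OF tendsto_const] filterlim_at_top_imp_at_infinity
          filterlim_compose[OF sqrt_at_top filterlim_real_sequentially])
    then have "(\<lambda>N. C * sqrt H * (1 / sqrt (real N)) + C * sqrt P) \<longlonglongrightarrow> C * sqrt H * 0 + C * sqrt P"
      by (intro tendsto_add tendsto_mult_left tendsto_const)
    then show "(\<lambda>N. C * sqrt H * (1 / sqrt (real N)) + C * sqrt P) \<longlonglongrightarrow> C * sqrt P"
      by simp
    show "\<exists>N0. \<forall>N\<ge>N0. sqrt S \<le> C * sqrt H * (1 / sqrt (real N)) + C * sqrt P"
      using main by blast
  qed
  then have "(sqrt S)\<^sup>2 \<le> (C * sqrt P)\<^sup>2"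
    using pos by (intro power_mono) simp_all
  then show ?thesis
    using pos by (simp add: power_mult_distrib S_def P_def)
qed

text \<open>Test forms for the multipliers: on them the annihilation condition of Farkas' lemma
  becomes an identity of frame operators at \<open>z\<close>.\<close>

lemma hform_rank_one: "hform (\<lambda>x y. hinner x z * hinner z y)"
  unfolding hform_def
proof (intro conjI allI)
  show "hinner y z * hinner z x = cnj (hinner x z * hinner z y)" for x y
    using hinner_commute[of y z] hinner_commute[of z x] by (simp add: mult.commute)
qed (simp_all add: hinner_add_left hinner_scale_left distrib_right)

lemma hform_lincomb:
  assumes "hform B" "hform B'"
  shows "hform (\<lambda>x y. complex_of_real s * B x y + complex_of_real t * B' x y)"
  unfolding hform_def
proof (intro conjI allI)
  show "complex_of_real s * B y x + complex_of_real t * B' y x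
      = cnj (complex_of_real s * B x y + complex_of_real t * B' x y)" for x y
    using hform_commute[OF assms(1), of y x] hform_commute[OF assms(2), of y x] by simp
qed (simp_all add: hform_add[OF assms(1)] hform_add[OF assms(2)] hform_scale[OF assms(1)]
    hform_scale[OF assms(2)] algebra_simps)

text \<open>By Farkas' lemma an obstruction to the finitely many constraints is a triple of multipliers, and
  these are exactly the data of \<open>cb_bound_frame\<close>.\<close>

lemma cb_bound_finite_form:
  fixes F :: "'a set"
  assumes cb: "cb_bound A I C" and C: "0 \<le> C" and J: "finite J" "J \<subseteq> I" and F: "finite F"
  shows "\<exists>B. hform B \<and> (\<forall>x\<in>F. (hnorm x)\<^sup>2 \<le> Re (B x x) \<and> Re (B x x) \<le> C\<^sup>2 * (hnorm x)\<^sup>2 \<and>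
    (\<Sum>i\<in>J. Re (B (adj (A i) x) (adj (A i) x))) \<le> Re (B x x))"
proof -
  obtain xs :: "nat \<Rightarrow> 'a" and d where xs: "F = xs ` {..<d}"
    using finite_imp_nat_seg_image_inj_on[OF F] unfolding lessThan_def by blast
  \<comment> \<open>All three kinds of constraint take the shape \<open>c \<le> g B\<close>: the
    lower bound, the upper bound with reversed sign, and the domination of the section
    \<open>J\<close>.\<close>
  define g :: "('a \<Rightarrow> 'a \<Rightarrow> complex) \<Rightarrow> nat + (nat + nat) \<Rightarrow> real" where
    "g B = case_sum (\<lambda>k. Re (B (xs k) (xs k))) (case_sum (\<lambda>k. - Re (B (xs k) (xs k)))
      (\<lambda>k. Re (B (xs k) (xs k)) - (\<Sum>i\<in>J. Re (B (adj (A i) (xs k)) (adj (A i) (xs k))))))" for B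
  define c :: "nat + (nat + nat) \<Rightarrow> real" where
    "c = case_sum (\<lambda>k. (hnorm (xs k))\<^sup>2) (case_sum (\<lambda>k. - (C\<^sup>2 * (hnorm (xs k))\<^sup>2)) (\<lambda>k. 0))"
  let ?K = "{..<d} <+> ({..<d} <+> {..<d})"
  have fin: "finite ?K"
    by (simp add: finite_Plus)
  have zero: "(\<lambda>_. 0) \<in> g ` Collect hform"
  proof (rule image_eqI)
    show "(\<lambda>_. 0) = g (\<lambda>_ _. 0)"
      by (auto simp: g_def fun_eq_iff split: sum.split)
  qed (simp add: hform_def)
  have lin: "(\<lambda>i. s * f i + t * f' i) \<in> g ` Collect hform" if f: "f \<in> g ` Collect hform" "f' \<in> g ` Collect hform" for f f' s t
  proof -
    obtain B B' where B: "hform B" "hform B'" "f = g B" "f' = g B'"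
      using f by auto
    let ?B = "\<lambda>x y. complex_of_real s * B x y + complex_of_real t * B' x y"
    have "(\<lambda>i. s * f i + t * f' i) = g ?B"
      by (auto simp: B g_def fun_eq_iff sum.distrib sum_distrib_left algebra_simps split: sum.split)
    then show ?thesis
      using hform_lincomb[OF B(1,2)] by blast
  qed
  have "(\<exists>f\<in>g ` Collect hform. \<forall>k\<in>?K. c k \<le> f k) \<or> (\<exists>w. (\<forall>k\<in>?K. 0 \<le> w k) \<and>
      (\<forall>f\<in>g ` Collect hform. (\<Sum>k\<in>?K. w k * f k) = 0) \<and> 0 < (\<Sum>k\<in>?K. w k * c k))"
    by (rule Farkas_subspace[OF fin zero]) (rule lin)
  then show ?thesis
  proof (elim disjE bexE exE conjE)
    fix f assume "f \<in> g ` Collect hform" and f: "\<forall>k\<in>?K. c k \<le> f k"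
    then obtain B where B: "hform B" "f = g B"
      by auto
    have feasible: "hform B" "\<And>k. k \<in> ?K \<Longrightarrow> c k \<le> g B k"
      using B f by simp_all
    have "(hnorm (xs k))\<^sup>2 \<le> Re (B (xs k) (xs k)) \<and> Re (B (xs k) (xs k)) \<le> C\<^sup>2 * (hnorm (xs k))\<^sup>2 \<and>
        (\<Sum>i\<in>J. Re (B (adj (A i) (xs k)) (adj (A i) (xs k)))) \<le> Re (B (xs k) (xs k))" if "k < d" for k
    proof -
      have "Inl k \<in> ?K" "Inr (Inl k) \<in> ?K" "Inr (Inr k) \<in> ?K"
        using that by auto
      from this[THEN feasible(2)] show ?thesis
        by (simp add: g_def c_def)
    qed
    then show ?thesis
      using feasible(1) unfolding xs by (intro exI[of _ B]) simp
  next
    fix w assume w: "\<forall>k\<in>?K. 0 \<le> w k" "\<forall>f\<in>g ` Collect hform. (\<Sum>k\<in>?K. w k * f k) = 0" "0 < (\<Sum>k\<in>?K. w k * c k)"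
    have dual: "\<And>k. k \<in> ?K \<Longrightarrow> 0 \<le> w k" "\<And>B. hform B \<Longrightarrow> (\<Sum>k\<in>?K. w k * g B k) = 0"
      "0 < (\<Sum>k\<in>?K. w k * c k)"
      using w by simp_all
    \<comment> \<open>Square roots turn multipliers into vectors: domination weights give the state
      \<open>h\<close>, lower-bound weights give \<open>s\<close>, upper-bound weights give
      \<open>p\<close>.\<close>
    define h where "h k = hscale (complex_of_real (sqrt (w (Inr (Inr k))))) (xs k)" for k
    define s where "s k = hscale (complex_of_real (sqrt (w (Inl k)))) (xs k)" for k
    define p where "p k = hscale (complex_of_real (sqrt (w (Inr (Inl k))))) (xs k)" for k
    have pos: "0 \<le> w (Inl k)" "0 \<le> w (Inr (Inl k))" "0 \<le> w (Inr (Inr k))" if "k < d" for k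
      using dual(1) that by auto
    have sq: "(cmod (complex_of_real (sqrt r) * a))\<^sup>2 = r * (cmod a)\<^sup>2" if "0 \<le> r" for r a
      using that by (simp add: norm_mult power_mult_distrib)
    have sc: "(cmod (hinner (hscale (complex_of_real (sqrt r)) a) z))\<^sup>2 = r * (cmod (hinner a z))\<^sup>2"
      if "0 \<le> r" for r and a z :: 'a
      unfolding hinner_scale_left by (rule sq[OF that])
    have "(\<Sum>k<d. (cmod (hinner (h k) z))\<^sup>2) + (\<Sum>k<d. (cmod (hinner (s k) z))\<^sup>2)
        = (\<Sum>k<d. \<Sum>i\<in>J. (cmod (hinner (adj (A i) (h k)) z))\<^sup>2) + (\<Sum>k<d. (cmod (hinner (p k) z))\<^sup>2)" for z
    proof -
      have one: "Re (hinner x z * hinner z x) = (cmod (hinner x z))\<^sup>2" for x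
      proof -
        have "hinner z x = cnj (hinner x z)"
          by (rule hinner_commute)
        then show ?thesis
          unfolding cmod_power2 by (simp add: power2_eq_square)
      qed
      have "(\<Sum>k\<in>?K. w k * g (\<lambda>x y. hinner x z * hinner z y) k) = 0"
        by (rule dual(2)[OF hform_rank_one])
      then have "(\<Sum>k<d. w (Inl k) * (cmod (hinner (xs k) z))\<^sup>2) - (\<Sum>k<d. w (Inr (Inl k)) * (cmod (hinner (xs k) z))\<^sup>2)
          + (\<Sum>k<d. w (Inr (Inr k)) * (cmod (hinner (xs k) z))\<^sup>2)
          - (\<Sum>k<d. \<Sum>i\<in>J. w (Inr (Inr k)) * (cmod (hinner (adj (A i) (xs k)) z))\<^sup>2) = 0"
        unfolding g_def one
        by (simp add: sum.Plus finite_Plus right_diff_distrib sum_subtractf sum_negf sum_distrib_left)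
      moreover have "(\<Sum>k<d. (cmod (hinner (h k) z))\<^sup>2) = (\<Sum>k<d. w (Inr (Inr k)) * (cmod (hinner (xs k) z))\<^sup>2)"
        by (intro sum.cong refl) (simp only: h_def sc[OF pos(3)] lessThan_iff)
      moreover have "(\<Sum>k<d. (cmod (hinner (s k) z))\<^sup>2) = (\<Sum>k<d. w (Inl k) * (cmod (hinner (xs k) z))\<^sup>2)"
        by (intro sum.cong refl) (simp only: s_def sc[OF pos(1)] lessThan_iff)
      moreover have "(\<Sum>k<d. (cmod (hinner (p k) z))\<^sup>2) = (\<Sum>k<d. w (Inr (Inl k)) * (cmod (hinner (xs k) z))\<^sup>2)"
        by (intro sum.cong refl) (simp only: p_def sc[OF pos(2)] lessThan_iff)
      moreover have "(\<Sum>k<d. \<Sum>i\<in>J. (cmod (hinner (adj (A i) (h k)) z))\<^sup>2)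
          = (\<Sum>k<d. \<Sum>i\<in>J. w (Inr (Inr k)) * (cmod (hinner (adj (A i) (xs k)) z))\<^sup>2)"
      proof (intro sum.cong refl)
        fix k i assume "k \<in> {..<d}" "i \<in> J"
        then have "0 \<le> w (Inr (Inr k))" "bop (adj (A i))"
          using pos(3) J(2) bop_adjA by auto
        then show "(cmod (hinner (adj (A i) (h k)) z))\<^sup>2 = w (Inr (Inr k)) * (cmod (hinner (adj (A i) (xs k)) z))\<^sup>2"
          by (simp only: h_def bop_scale[OF \<open>bop (adj (A i))\<close>] sc)
      qed
      ultimately show ?thesis
        by argo
    qed
    from cb_bound_frame[OF cb C J this]
    have "(\<Sum>k<d. (hnorm (s k))\<^sup>2) \<le> C\<^sup>2 * (\<Sum>k<d. (hnorm (p k))\<^sup>2)" .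
    moreover have "(\<Sum>k<d. (hnorm (s k))\<^sup>2) = (\<Sum>k<d. w (Inl k) * (hnorm (xs k))\<^sup>2)"
      by (intro sum.cong refl) (simp add: s_def hnorm_scale power_mult_distrib pos)
    moreover have "(\<Sum>k<d. (hnorm (p k))\<^sup>2) = (\<Sum>k<d. w (Inr (Inl k)) * (hnorm (xs k))\<^sup>2)"
      by (intro sum.cong refl) (simp add: p_def hnorm_scale power_mult_distrib pos)
    \<comment> \<open>The value that Farkas' lemma makes positive is the difference of the two sides
      of the bound just obtained, hence a contradiction.\<close>
    moreover have "(\<Sum>k\<in>?K. w k * c k)
        = (\<Sum>k<d. w (Inl k) * (hnorm (xs k))\<^sup>2) - C\<^sup>2 * (\<Sum>k<d. w (Inr (Inl k)) * (hnorm (xs k))\<^sup>2)"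
      by (simp add: c_def sum.Plus finite_Plus sum_negf sum_distrib_left mult.left_commute)
    ultimately show ?thesis
      using dual(3) by simp
  qed
qed

text \<open>The finite problems are indexed by a set of vectors together with a length of the row;
  their solutions cluster along the product of the two exhausting filters.\<close>

lemma cb_bound_dominating_form:
  assumes cb: "cb_bound A I C" and C: "0 \<le> C"
  shows "\<exists>M. dominating_form A I 1 (C\<^sup>2) M"
proof -
  define J where "J n = {i \<in> I. i < n}" for n :: nat
  have J: "finite (J n)" "J n \<subseteq> I" for n
    by (auto simp: J_def)
  \<comment> \<open>The vectors \<open>adj (A i) x\<close> are included so that the form is
    nonnegative at them; this allows a section \<open>J'\<close> to be enlarged to
    \<open>J (snd p)\<close>.\<close>
  define E where "E p = fst p \<union> (\<Union>i\<in>J (snd p). adj (A i) ` fst p)" for p :: "'a set \<times> nat"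
  \<comment> \<open>For infinite sets of vectors only Hermitian symmetry is asked, so that
    \<open>m\<close> can be chosen for every index; the filter ignores those indices.\<close>
  define Q where "Q p B \<longleftrightarrow> hform B \<and> (finite (fst p) \<longrightarrow> (\<forall>x\<in>E p. (hnorm x)\<^sup>2 \<le> Re (B x x) \<and>
    Re (B x x) \<le> C\<^sup>2 * (hnorm x)\<^sup>2 \<and> (\<Sum>i\<in>J (snd p). Re (B (adj (A i) x) (adj (A i) x))) \<le> Re (B x x)))"
    for p and B :: "'a \<Rightarrow> 'a \<Rightarrow> complex"
  have "\<exists>B. Q p B" for p
  proof (cases "finite (fst p)")
    case True
    then have "finite (E p)"
      using J by (simp add: E_def)
    from cb_bound_finite_form[OF cb C J[of "snd p"] this] show ?thesis
    proof (elim exE conjE)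
      fix B :: "'a \<Rightarrow> 'a \<Rightarrow> complex"
      assume "hform B" "\<forall>x\<in>E p. (hnorm x)\<^sup>2 \<le> Re (B x x) \<and> Re (B x x) \<le> C\<^sup>2 * (hnorm x)\<^sup>2 \<and>
        (\<Sum>i\<in>J (snd p). Re (B (adj (A i) x) (adj (A i) x))) \<le> Re (B x x)"
      then have "Q p B"
        unfolding Q_def by simp
      then show ?thesis
        by (rule exI[of _ B])
    qed
  next
    case False
    then have "Q p hinner"
      unfolding Q_def using hform_hinner by simp
    then show ?thesis
      by (rule exI[of _ hinner])
  qed
  then obtain m where m: "\<And>p. Q p (m p)"
    by metis
  have hm: "hform (m p)" for p
    using m[of p] by (simp add: Q_def)
  define \<F> where "\<F> = finite_subsets_at_top (UNIV :: 'a set) \<times>\<^sub>F sequentially"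
  have ev: "eventually (\<lambda>p. finite (fst p) \<and> x \<in> fst p \<and> N \<le> snd p) \<F>" for x N
  proof -
    have "eventually (\<lambda>F. finite F \<and> x \<in> F) (finite_subsets_at_top (UNIV :: 'a set))"
      unfolding eventually_finite_subsets_at_top by (intro exI[of _ "{x}"]) auto
    then show ?thesis
      unfolding \<F>_def eventually_prod_filter using eventually_ge_at_top[of N]
      by (intro exI[of _ "\<lambda>F. finite F \<and> x \<in> F"] exI[of _ "\<lambda>n. N \<le> n"]) auto
  qed
  have bounds: "(hnorm x)\<^sup>2 \<le> Re (m p x x)" "Re (m p x x) \<le> C\<^sup>2 * (hnorm x)\<^sup>2"
    "(\<Sum>i\<in>J (snd p). Re (m p (adj (A i) x) (adj (A i) x))) \<le> Re (m p x x)"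
    if "finite (fst p)" "x \<in> E p" for p x
    using m[of p] that unfolding Q_def by simp_all
  show ?thesis
  proof (rule dominating_form_cluster[where F=\<F> and m=m, OF _ hm])
    show "\<F> \<noteq> bot"
      by (simp add: \<F>_def prod_filter_eq_bot)
    show "eventually (\<lambda>p. 1 * (hnorm x)\<^sup>2 \<le> Re (m p x x) \<and> Re (m p x x) \<le> C\<^sup>2 * (hnorm x)\<^sup>2) \<F>" for x
      using ev[of x 0]
    proof eventually_elim
      case (elim p)
      then have "x \<in> E p"
        by (simp add: E_def)
      then show ?case
        using bounds[of p x] elim by simp
    qed
    fix J' x assume J': "finite J'" "J' \<subseteq> I"
    obtain N where N: "\<forall>i\<in>J'. i < N"
      using J'(1) unfolding finite_nat_set_iff_bounded by (elim exE)
    have "eventually (\<lambda>p. (\<Sum>j\<in>J'. Re (m p (adj (A j) x) (adj (A j) x))) \<le> Re (m p x x) + 0) \<F>"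
      using ev[of x N]
    proof eventually_elim
      case (elim p)
      have p: "finite (fst p)" "x \<in> E p"
        using elim by (auto simp: E_def)
      have p3: "J' \<subseteq> J (snd p)"
      proof
        fix i assume "i \<in> J'"
        then show "i \<in> J (snd p)"
          using J'(2) N elim by (auto simp: J_def)
      qed
      have "(\<Sum>j\<in>J'. Re (m p (adj (A j) x) (adj (A j) x))) \<le> (\<Sum>j\<in>J (snd p). Re (m p (adj (A j) x) (adj (A j) x)))"
      proof (rule sum_mono2[OF J(1) p3])
        fix i assume "i \<in> J (snd p) - J'"
        then have "adj (A i) x \<in> E p"
          using elim by (auto simp: E_def)
        from bounds(1)[OF p(1) this] show "0 \<le> Re (m p (adj (A i) x) (adj (A i) x))"
          by (rule order_trans[OF zero_le_power2])
      qed
      then show ?case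
        using bounds(3)[OF p(1,2)] by simp
    qed
    then show "\<exists>e. (e \<longlongrightarrow> 0) \<F> \<and> eventually (\<lambda>p. (\<Sum>j\<in>J'. Re (m p (adj (A j) x) (adj (A j) x))) \<le> Re (m p x x) + e p) \<F>"
      by (intro exI[of _ "\<lambda>_. 0"] conjI tendsto_const)
  qed
qed

lemma completely_bounded_imp_superharmonic:
  assumes "completely_bounded A I"
  shows "\<exists>R. opos R \<and> oinvertible R \<and> ople (\<phi> R) R"
proof -
  obtain C0 where C0: "cb_bound A I C0"
    using assms unfolding completely_bounded_def by blast
  \<comment> \<open>The definition leaves the sign of the constant open; the absolute value is still
    a bound because \<open>matnormS\<close> is nonnegative.\<close>
  have "cb_bound A I \<bar>C0\<bar>"
    unfolding cb_bound_def
  proof (intro allI impI)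
    fix m :: nat and P :: "nat \<Rightarrow> nat \<Rightarrow> nat list \<Rightarrow> complex"
    assume P: "\<forall>i<m. \<forall>j<m. ncpoly I (P i j)"
    then have "matnormA A m P \<le> C0 * matnormS I m P"
      using C0 unfolding cb_bound_def by blast
    also have "\<dots> \<le> \<bar>C0\<bar> * matnormS I m P"
      by (rule mult_right_mono[OF abs_ge_self matnormS_nonneg[where P=P]]) (use P in blast)
    finally show "matnormA A m P \<le> \<bar>C0\<bar> * matnormS I m P" .
  qed
  from cb_bound_dominating_form[OF this] obtain M where "dominating_form A I 1 (\<bar>C0\<bar>\<^sup>2) M"
    by auto
  then show ?thesis
  proof (rule dominating_form_operator)
    fix R assume "opos R" "oinvertible R" "ople (\<phi> R) R"
    then show ?thesis
      by blast
  qed simp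
qed

lemma cond_iii_cb_bound:
  assumes "cond_iii A I a b D" shows "cb_bound A I (sqrt (b / a))"
proof -
  have ab: "0 < a" "a \<le> b"
    using assms by (auto simp: cond_iii_def)
  obtain M where M: "dominating_form A I a b M"
    using cond_iii_dominating_form[OF assms] by blast
  show ?thesis
  proof (rule dominating_form_operator[OF M ab(1)])
    fix R assume R: "opos R" "\<And>x. a * (hnorm x)\<^sup>2 \<le> qform R x" "\<And>x. qform R x \<le> b * (hnorm x)\<^sup>2" "ople (\<phi> R) R"
    show ?thesis
      by (rule superharmonic_cb_bound[OF R(1,4) ab R(2,3)])
  qed
qed

end

theorem theorem5p13:
  fixes A :: "nat \<Rightarrow> ('a::chilbert \<Rightarrow> 'a)" and N :: enat
  defines "I \<equiv> {i::nat. enat i < N}"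
  assumes "N \<ge> 1"
    and "\<forall>i\<in>I. bop (A i)"
    and "\<forall>x. (\<lambda>i. (hnorm (adj (A i) x))\<^sup>2) summable_on I"
    and "cp_map (phiA A I)"
    and "wstar_cont (phiA A I)"
  shows "((\<exists>\<psi>. cp_map \<psi> \<and> wstar_cont \<psi> \<and> (\<forall>X. bop X \<longrightarrow> opnorm (\<psi> X) \<le> opnorm X)
               \<and> similar (phiA A I) \<psi>)
          \<longleftrightarrow> (\<exists>R. opos R \<and> oinvertible R \<and> ople (phiA A I R) R))
       \<and> ((\<exists>R. opos R \<and> oinvertible R \<and> ople (phiA A I R) R)
          \<longleftrightarrow> (\<exists>a b D. cond_iii A I a b D))
       \<and> ((\<exists>a b D. cond_iii A I a b D) \<longleftrightarrow> completely_bounded A I)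
       \<and> (\<forall>a b D. cond_iii A I a b D \<longrightarrow> cb_bound A I (sqrt (b / a)))"
proof -
  have bop: "\<And>i. i \<in> I \<Longrightarrow> bop (A i)" and sum: "\<And>x. (\<lambda>i. (hnorm (adj (A i) x))\<^sup>2) summable_on I"
    using \<open>\<forall>i\<in>I. bop (A i)\<close> \<open>\<forall>x. (\<lambda>i. (hnorm (adj (A i) x))\<^sup>2) summable_on I\<close> by simp_all
  \<comment> \<open>Uniform boundedness turns the pointwise summability into a single constant
    \<open>K\<close>.\<close>
  obtain K where "row_operator A I K"
    using row_operator_ex[where A=A and I=I] bop sum by auto
  then interpret row_operator A I K .
  let ?i = "\<exists>\<psi>. cp_map \<psi> \<and> wstar_cont \<psi> \<and> (\<forall>X. bop X \<longrightarrow> opnorm (\<psi> X) \<le> opnorm X) \<and> similar \<phi> \<psi>"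
  let ?ii = "\<exists>R. opos R \<and> oinvertible R \<and> ople (\<phi> R) R"
  let ?iii = "\<exists>a b D. cond_iii A I a b D"
  have "?ii" if "?i"
    using that similar_imp_superharmonic by (elim exE conjE) simp
  moreover have "?i" if "?ii"
    using that
  proof (elim exE conjE)
    fix R assume "opos R" "oinvertible R" "ople (\<phi> R) R"
    then show "?i"
      by (rule superharmonic_imp_similar[OF \<open>cp_map \<phi>\<close> \<open>wstar_cont \<phi>\<close>])
  qed
  moreover have "?iii" if "?ii"
    using that
  proof (elim exE conjE)
    fix R assume "opos R" "oinvertible R" "ople (\<phi> R) R"
    then show "?iii"
      by (rule superharmonic_imp_cond_iii)
  qed
  moreover have iii: "\<forall>a b D. cond_iii A I a b D \<longrightarrow> cb_bound A I (sqrt (b / a))"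
    using cond_iii_cb_bound by simp
  moreover have "completely_bounded A I" if "?iii"
    using that
  proof (elim exE)
    fix a b D assume "cond_iii A I a b D"
    then have "cb_bound A I (sqrt (b / a))"
      by (rule cond_iii_cb_bound)
    then show "completely_bounded A I"
      unfolding completely_bounded_def by (rule exI[of _ "sqrt (b / a)"])
  qed
  moreover have "?ii" if "completely_bounded A I"
    by (rule completely_bounded_imp_superharmonic[OF that])
  ultimately show ?thesis
    by argo
qed

end
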